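(* Consider the plant with unknown delay $D$ described in the context, where $0<\underline D\le D\le\overline D$ with known $\underline D,\overline D$ and the functions $\psi_i,\varphi_j$ satisfy the stated smoothness conditions. Let the target trajectory $s$ be $n+m$ times continuously differentiable, let the input history satisfy $x_1(t)=0$ for $t\in[-D,0)$, and let $Y(0)\in\mathbb{R}^n$, $X(0)\in\mathbb{R}^m$ satisfy (A4) $P(\theta)$ is finite and $P_1(\theta)>s(\theta+D)$ for all $\theta\in[-D,0]$, where $P(\theta)=Y(0)+\int_{-D}^{\theta}f(P(\sigma),bx_1(\sigma))\,d\sigma$; (A5) $bx_1(0)>\Delta(0)$. Choose design parameters with $$k_i>\max_{\mathcal D\in[\underline D,\overline D]}\{2,\check k_i(\mathcal D)\}\ (1\le i\le n-1),\ k_n>1,\qquad c_j>\max_{\mathcal D\in[\underline D,\overline D]}\{2,\check c_j(\mathcal D)\}\ (1\le j\le m-1),\ c_m>1.$$ Then the closed-loop system consisting of the plant with $U(t)=U_a(t)$, the safe delay-adaptive controller defined in the context, has the following properties. 1) The delay estimate $\hat D(t)$ is bounded and reaches the true value $D$ in the finite time $t_f$. 2) $|y_1(t)-s(t)|$ converges exponentially to zero, and $$\Psi(t)=|X(t)|+|Y(t)|+\max_{x\in[0,1]}|p(x,t)|+\Big(\int_{t-D}^t x_1(\tau)^2\,d\tau\Big)^{1/2}$$ is bounded, with an ultimate bound depending on the target trajectory. If $s(t)\equiv0$, then $\Psi(t)$ converges exponentially to zero. 3) $y_1(t)-s(t)\ge0$ for all $t\ge0$.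
   Context: Plant. Let $n,m\ge1$ be integers, $b\neq0$ a constant, $D>0$ the (unknown) delay. The plant is $$\dot y_i(t)=y_{i+1}(t)+\psi_i(\underline y_i(t)),\ i=1,\dots,n-1,\qquad \dot y_n(t)=\psi_n(\underline y_n(t))+b\,x_1(t-D),$$ $$\dot x_j(t)=x_{j+1}(t)+\varphi_j(\underline x_j(t)),\ j=1,\dots,m-1,\qquad \dot x_m(t)=\varphi_m(\underline x_m(t))+U(t),$$ with $Y=(y_1,\dots,y_n)^T$, $X=(x_1,\dots,x_m)^T$. Notation: $\underline y_i=(y_1,\dots,y_i)^T$, $\underline s^{(i)}=(s,s^{(1)},\dots,s^{(i)})^T$, and similarly for other symbols. Write the $Y$-part as $\dot Y(t)=f(Y(t),bx_1(t-D))$, i.e. $f(Y,v)=(y_2+\psi_1(\underline y_1),\dots,y_n+\psi_{n-1}(\underline y_{n-1}),\psi_n(\underline y_n)+v)^T$. Put $u(x,t)=bx_1(t-D+Dx)$, $x\in[0,1]$. Smoothness conditions: $\psi_i$ is $n+m-i$ times continuously differentiable, $\varphi_j$ is $m-j$ times continuously differentiable, $\psi_i(0)=0$, $\varphi_j(0)=0$. Predictor. $P(t)=(P_1(t),\dots,P_n(t))^T=Y(t+D)$, generated by $P(t)=Y(t)+\int_{t-D}^{t}f(P(\sigma),bx_1(\sigma))\,d\sigma$ for $t\ge0$, with initial values $P(\theta)=Y(0)+\int_{-D}^{\theta}f(P(\sigma),bx_1(\sigma))\,d\sigma$, $\theta\in[-D,0]$. Set $p(x,t)=P(t-D+Dx)$,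 $x\in[0,1]$. Functions $h_i$. With $h_0=0$ and $z_i=y_i-h_{i-1}-s^{(i-1)}$, define recursively for $i=1,\dots,n$ $$h_i(\underline y_i,\underline s^{(i-1)})=-k_iz_i-\psi_i(\underline y_i)+\sum_{k=1}^{i-1}\Big[\frac{\partial h_{i-1}}{\partial y_k}(y_{k+1}+\psi_k(\underline y_k))+\frac{\partial h_{i-1}}{\partial s^{(k-1)}}s^{(k)}\Big].$$ Functions $\Delta,\tau_j,r_j$. $\Delta(t)=h_n(P(t),\underline s^{(n-1)}(t+D))+s^{(n)}(t+D)$; time derivatives $\Delta^{(j)}$ are expressed through $\dot P(t)=f(P(t),bx_1(t))$ and the $X$-dynamics. With $\tau_0=0$ and $r_j=bx_j-\tau_{j-1}-\Delta^{(j-1)}$, for $j=1,\dots,m$, $$\tau_j(\underline x_j,\underline\Delta^{(j-1)})=-c_jr_j-b\varphi_j(\underline x_j)+\sum_{k=1}^{j-1}\Big[\frac{\partial\tau_{j-1}}{\partial x_k}(x_{k+1}+\varphi_k(\underline x_k))+\frac{\partial\tau_{j-1}}{\partial\Delta^{(k-1)}}\Delta^{(k)}\Big].$$ Nominal law and safety bound. Let $$\mathcal U(t,D)=\tfrac1b\big(\tau_m(\underline x_m(t),\underline\Delta^{(m-1)}(t))+\Delta^{(m)}(t)\big),\qquad \mathcal U^*(t,D)=\tfrac1b\big[(c_m-\bar c)r_m(t)+\tau_m+\Delta^{(m)}(t)\big],$$ where $\bar c>0$ is a free parameter. These are functions of $X(t)$, $P(t)$ and $\underline s^{(n+m)}(t+D)$;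 $\mathcal U(t,\mathcal D)$, $\mathcal U^*(t,\mathcal D)$ denote the same expressions with $D$ replaced by $\mathcal D$ (in the predictor integral defining $P$, with $x_1$ zero on the history interval before time $0$, and in the arguments of $s$). Thresholds for the design parameters (recursive). For $i=1,\dots,n-1$, with $h_{i-1}$, its partial derivatives and $\psi_k$ evaluated at $\underline P(0)$ (in place of $y$) and at $s^{(\cdot)}(D)$, $$\check k_i=\frac{-P_{i+1}(0)-\psi_i(\underline P_i(0))+s^{(i)}(D)+\sum_{k=1}^{i-1}\big(\frac{\partial h_{i-1}}{\partial P_k}(P_{k+1}(0)+\psi_k)+\frac{\partial h_{i-1}}{\partial s^{(k-1)}}s^{(k)}(D)\big)}{P_i(0)-h_{i-1}(\underline P_{i-1}(0),\underline s^{(i-2)}(D))-s^{(i-1)}(D)}.$$ For $j=1,\dots,m-1$, with everything evaluated at $t=0$, $$\check c_j=\frac{-bx_{j+1}(0)-b\varphi_j(\underline x_j(0))+\Delta^{(j)}(0)+\sum_{k=1}^{j-1}\big(\frac{\partial\tau_{j-1}}{\partial x_k}(x_{k+1}(0)+\varphi_k)+\frac{\partial\tau_{j-1}}{\partial\Delta^{(k-1)}}\Delta^{(k)}(0)\big)}{bx_j(0)-\tau_{j-1}(\underline x_{j-1}(0),\underline\Delta^{(j-2)}(0))-\Delta^{(j-1)}(0)}.$$ $\check k_i(\mathcal D),\check c_j(\mathcal D)$ are these expressions with $D$ replaced by $\mathcal D$. Delay identifier. Let $D_0=[\underline D,\overline D]$, $T>0$ and an integer $\tilde N\ge1$ be free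 design parameters, $t_0=0$, $t_{i+1}=t_i+T$, and $\mu_{i+1}=\min\{t_g: g\in\{0,\dots,i\},\ t_g\ge t_{i+1}-\tilde NT\}$. For $q=1,2,\dots$ let $$f_q(t)=\pi q\int_0^t\!\int_0^1\cos(x\pi q)u(x,\tau)\,dx\,d\tau,\quad g_q(t)=-\int_0^1\sin(x\pi q)u(x,t)\,dx,$$ $$G_q(t_{i+1},\mu_{i+1})=\int_{\mu_{i+1}}^{t_{i+1}}g_q(t)^2dt,\quad F_q(t_{i+1},\mu_{i+1})=\int_{\mu_{i+1}}^{t_{i+1}}g_q(t)f_q(t)dt.$$ Starting from an initial estimate $\hat D(t_0)\in D_0$, $$\hat D(t_{i+1})=\arg\min\{|\ell-\hat D(t_i)|^2:\ \ell\in D_0,\ G_q(t_{i+1},\mu_{i+1})\ell=F_q(t_{i+1},\mu_{i+1}),\ q=1,2,\dots\},$$ and $\hat D(t)=\hat D(t_i)$ for $t\in[t_i,t_{i+1})$. Let $t_f=\min\{t_i:\exists t\in[0,t_i),\ u(\cdot,t)\ne0\}$. Safe delay-adaptive controller. Put $U_d(t)=\mathcal U(t,\hat D(t_i))$ for $t\in[t_i,t_{i+1})$. For $0\le t\le t_f$, $$U_a(t)=\max\{U_d(t),\max_{\mathcal D\in D_0}\mathcal U^*(t,\mathcal D)\}\ \text{if } b>0,\qquad U_a(t)=\min\{U_d(t),\min_{\mathcal D\in D_0}\mathcal U^*(t,\mathcal D)\}\ \text{if } b<0,$$ and $U_a(t)=U_d(t)$ for $t>t_f$.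
   Formalization: Boundedness and the ultimate bound of Ψ are proved when s and its derivatives up to order n+m−1 are bounded (s(t)=t refutes it otherwise); a closed-loop solution on [0,∞), with the predictors the controller uses, and t_f (x_1 not identically zero) are assumed to exist. *)

theory Defs
  imports "HOL-Analysis.Analysis"
begin

text \<open>
  A vector of R^N is a function of type nat => real of which only the components 1, ..., N matter.
  The jets (s, s', s'', ...) and (Delta, Delta', ...) are functions of the same type, indexed from
  0 by the order of the derivative.
\<close>

definition partial :: "nat \<Rightarrow> ((nat \<Rightarrow> real) \<Rightarrow> real) \<Rightarrow> (nat \<Rightarrow> real) \<Rightarrow> real" where
  "partial k F y = deriv (\<lambda>v. F (y(k := v))) (y k)"

definition function_of_first :: "nat \<Rightarrow> ((nat \<Rightarrow> real) \<Rightarrow> real) \<Rightarrow> bool" where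
  "function_of_first N F \<longleftrightarrow> (\<forall>y y'. (\<forall>i\<in>{1..N}. y i = y' i) \<longrightarrow> F y = F y')"

text \<open>
  Continuity refers to the product topology; for a function of the first N components this is
  continuity on R^N.
\<close>

primrec Ck :: "nat \<Rightarrow> nat \<Rightarrow> ((nat \<Rightarrow> real) \<Rightarrow> real) \<Rightarrow> bool" where
  "Ck N 0 F \<longleftrightarrow> continuous_on UNIV F"
| "Ck N (Suc r) F \<longleftrightarrow> continuous_on UNIV F \<and>
     (\<forall>i\<in>{1..N}. (\<forall>y. (\<lambda>v. F (y(i := v))) differentiable at (y i)) \<and> Ck N r (partial i F))"

record plant =
  ny :: nat
  nx :: nat
  bcoef :: real
  delay :: real
  psi :: "nat \<Rightarrow> (nat \<Rightarrow> real) \<Rightarrow> real"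
  phi :: "nat \<Rightarrow> (nat \<Rightarrow> real) \<Rightarrow> real"

definition smooth_plant :: "plant \<Rightarrow> bool" where
  "smooth_plant p \<longleftrightarrow>
     (\<forall>i\<in>{1..ny p}. function_of_first i (psi p i) \<and> Ck i (ny p + nx p - i) (psi p i) \<and>
        psi p i (\<lambda>_. 0) = 0) \<and>
     (\<forall>j\<in>{1..nx p}. function_of_first j (phi p j) \<and> Ck j (nx p - j) (phi p j) \<and>
        phi p j (\<lambda>_. 0) = 0)"

definition fY :: "plant \<Rightarrow> (nat \<Rightarrow> real) \<Rightarrow> real \<Rightarrow> nat \<Rightarrow> real" where
  "fY p Y v i = (if i < ny p then Y (i + 1) + psi p i Y else psi p i Y + v)"

definition fX :: "plant \<Rightarrow> (nat \<Rightarrow> real) \<Rightarrow> real \<Rightarrow> nat \<Rightarrow> real" where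
  "fX p X U j = (if j < nx p then X (j + 1) + phi p j X else phi p j X + U)"

text \<open>
  The input has jumps, so solutions are continuous and satisfy the differential equations
  outside a countable set of times.
\<close>

definition plant_solution ::
  "plant \<Rightarrow> (real \<Rightarrow> real) \<Rightarrow> (real \<Rightarrow> nat \<Rightarrow> real) \<Rightarrow> (real \<Rightarrow> nat \<Rightarrow> real) \<Rightarrow> bool" where
  "plant_solution p U Y X \<longleftrightarrow>
     (\<forall>i\<in>{1..ny p}. continuous_on {0..} (\<lambda>t. Y t i)) \<and>
     (\<forall>j\<in>{1..nx p}. continuous_on {0..} (\<lambda>t. X t j)) \<and>
     (\<exists>E. countable E \<and> (\<forall>t>0. t \<notin> E \<longrightarrow>
        (\<forall>i\<in>{1..ny p}. ((\<lambda>t. Y t i) has_real_derivative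
            fY p (Y t) (bcoef p * X (t - delay p) 1) i) (at t)) \<and>
        (\<forall>j\<in>{1..nx p}. ((\<lambda>t. X t j) has_real_derivative fX p (X t) (U t) j) (at t))))"

text \<open>
  The trajectory P solves, up to time h, the predictor equations in which the delay is replaced
  by D; the input history before time 0 is taken to be zero.
\<close>

definition is_predictor ::
  "plant \<Rightarrow> (real \<Rightarrow> nat \<Rightarrow> real) \<Rightarrow> (real \<Rightarrow> nat \<Rightarrow> real) \<Rightarrow> real \<Rightarrow> real \<Rightarrow> (real \<Rightarrow> nat \<Rightarrow> real) \<Rightarrow> bool"
where
  "is_predictor p Y X D h P \<longleftrightarrow>
     (let x1 = (\<lambda>t. if t < 0 then 0 else X t 1) in
      \<forall>i\<in>{1..ny p}.
        continuous_on {-D..h} (\<lambda>t. P t i) \<and>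
        (\<forall>\<theta>\<in>{-D..0}. P \<theta> i =
           Y 0 i + integral {-D..\<theta>} (\<lambda>\<sigma>. fY p (P \<sigma>) (bcoef p * x1 \<sigma>) i)) \<and>
        (\<forall>t\<in>{0..h}. P t i =
           Y t i + integral {t - D..t} (\<lambda>\<sigma>. fY p (P \<sigma>) (bcoef p * x1 \<sigma>) i)))"

record design =
  kgain :: "nat \<Rightarrow> real"
  cgain :: "nat \<Rightarrow> real"
  cbar :: real
  Dlow :: real
  Dup :: real
  Dhat0 :: real
  Tsamp :: real
  Nwin :: nat

definition jet :: "(real \<Rightarrow> real) \<Rightarrow> real \<Rightarrow> nat \<Rightarrow> real" where
  "jet s t k = (deriv ^^ k) s t"

text \<open>
  The trajectory is only evaluated on [0, oo) and its derivatives only on (0, oo).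
\<close>

definition smooth_target :: "nat \<Rightarrow> (real \<Rightarrow> real) \<Rightarrow> bool" where
  "smooth_target r s \<longleftrightarrow> continuous_on {0..} s \<and>
     (\<forall>k<r. \<forall>t>0. (deriv ^^ k) s differentiable at t) \<and> continuous_on {0<..} ((deriv ^^ r) s)"

text \<open>
  The sum of partial derivatives occurring in the recursions for both h and tau, where H has
  arguments y and w, the jet w being regarded as an independent variable.
\<close>

definition along ::
  "(nat \<Rightarrow> (nat \<Rightarrow> real) \<Rightarrow> real) \<Rightarrow> nat \<Rightarrow> ((nat \<Rightarrow> real) \<Rightarrow> (nat \<Rightarrow> real) \<Rightarrow> real) \<Rightarrow>
   (nat \<Rightarrow> real) \<Rightarrow> (nat \<Rightarrow> real) \<Rightarrow> real" where
  "along g i H y w =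
     (\<Sum>k=1..i. partial k (\<lambda>y'. H y' w) y * (y (k + 1) + g k y)
             + partial (k - 1) (\<lambda>w'. H y w') w * w k)"

primrec hfun :: "plant \<Rightarrow> design \<Rightarrow> nat \<Rightarrow> (nat \<Rightarrow> real) \<Rightarrow> (nat \<Rightarrow> real) \<Rightarrow> real" where
  "hfun p d 0 = (\<lambda>y w. 0)"
| "hfun p d (Suc i) = (\<lambda>y w.
     - kgain d (Suc i) * (y (Suc i) - hfun p d i y w - w i)
     - psi p (Suc i) y + along (psi p) i (hfun p d i) y w)"

primrec tau :: "plant \<Rightarrow> design \<Rightarrow> nat \<Rightarrow> (nat \<Rightarrow> real) \<Rightarrow> (nat \<Rightarrow> real) \<Rightarrow> real" where
  "tau p d 0 = (\<lambda>x w. 0)"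
| "tau p d (Suc j) = (\<lambda>x w.
     - cgain d (Suc j) * (bcoef p * x (Suc j) - tau p d j x w - w j)
     - bcoef p * phi p (Suc j) x + along (phi p) j (tau p d j) x w)"

text \<open>
  The j-th time derivative of Delta as an expression in P, X and the jet of s: total
  differentiation along the dynamics of P and X. The expression of order j involves only
  the first j components of X and the jet of s up to order n + j.
\<close>

primrec Delta ::
  "plant \<Rightarrow> design \<Rightarrow> nat \<Rightarrow> (nat \<Rightarrow> real) \<Rightarrow> (nat \<Rightarrow> real) \<Rightarrow> (nat \<Rightarrow> real) \<Rightarrow> real" where
  "Delta p d 0 = (\<lambda>P X w. hfun p d (ny p) P w + w (ny p))"
| "Delta p d (Suc j) = (\<lambda>P X w.
     (\<Sum>i=1..ny p. partial i (\<lambda>P'. Delta p d j P' X w) P * fY p P (bcoef p * X 1) i)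
   + (\<Sum>l=1..j. partial l (\<lambda>X'. Delta p d j P X' w) X * (X (l + 1) + phi p l X))
   + (\<Sum>k=0..ny p + j. partial k (\<lambda>w'. Delta p d j P X w') w * w (k + 1)))"

definition Delta_jet ::
  "plant \<Rightarrow> design \<Rightarrow> (nat \<Rightarrow> real) \<Rightarrow> (nat \<Rightarrow> real) \<Rightarrow> (nat \<Rightarrow> real) \<Rightarrow> nat \<Rightarrow> real" where
  "Delta_jet p d P X w j = Delta p d j P X w"

definition rfun :: "plant \<Rightarrow> design \<Rightarrow> nat \<Rightarrow> (nat \<Rightarrow> real) \<Rightarrow> (nat \<Rightarrow> real) \<Rightarrow> real" where
  "rfun p d j x w = bcoef p * x j - tau p d (j - 1) x w - w (j - 1)"

definition U_nominal ::
  "plant \<Rightarrow> design \<Rightarrow> (nat \<Rightarrow> real) \<Rightarrow> (nat \<Rightarrow> real) \<Rightarrow> (nat \<Rightarrow> real) \<Rightarrow> real" where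
  "U_nominal p d P X w =
     (let dl = Delta_jet p d P X w; m = nx p in
      1 / bcoef p * (tau p d m X dl + dl m))"

definition U_star ::
  "plant \<Rightarrow> design \<Rightarrow> (nat \<Rightarrow> real) \<Rightarrow> (nat \<Rightarrow> real) \<Rightarrow> (nat \<Rightarrow> real) \<Rightarrow> real" where
  "U_star p d P X w =
     (let dl = Delta_jet p d P X w; m = nx p in
      1 / bcoef p * ((cgain d m - cbar d) * rfun p d m X dl + tau p d m X dl + dl m))"

definition k_check :: "plant \<Rightarrow> design \<Rightarrow> nat \<Rightarrow> (nat \<Rightarrow> real) \<Rightarrow> (nat \<Rightarrow> real) \<Rightarrow> real" where
  "k_check p d i P w =
     (- P (i + 1) - psi p i P + w i + along (psi p) (i - 1) (hfun p d (i - 1)) P w)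
     / (P i - hfun p d (i - 1) P w - w (i - 1))"

definition c_check :: "plant \<Rightarrow> design \<Rightarrow> nat \<Rightarrow> (nat \<Rightarrow> real) \<Rightarrow> (nat \<Rightarrow> real) \<Rightarrow> real" where
  "c_check p d j x w =
     (- bcoef p * x (j + 1) - bcoef p * phi p j x + w j
      + along (phi p) (j - 1) (tau p d (j - 1)) x w)
     / (bcoef p * x j - tau p d (j - 1) x w - w (j - 1))"

text \<open>
  Here and below, P D is the predictor trajectory for the delay value D.
\<close>

definition gains_ok ::
  "plant \<Rightarrow> design \<Rightarrow> (real \<Rightarrow> real) \<Rightarrow> (real \<Rightarrow> real \<Rightarrow> nat \<Rightarrow> real) \<Rightarrow> (real \<Rightarrow> nat \<Rightarrow> real) \<Rightarrow> bool" where
  "gains_ok p d s P X \<longleftrightarrow>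
     (\<forall>i\<in>{1..<ny p}. \<forall>D\<in>{Dlow d..Dup d}.
        kgain d i > max 2 (k_check p d i (P D 0) (jet s D))) \<and>
     kgain d (ny p) > 1 \<and>
     (\<forall>j\<in>{1..<nx p}. \<forall>D\<in>{Dlow d..Dup d}.
        cgain d j > max 2 (c_check p d j (X 0) (Delta_jet p d (P D 0) (X 0) (jet s D)))) \<and>
     cgain d (nx p) > 1"

definition ufun :: "plant \<Rightarrow> (real \<Rightarrow> nat \<Rightarrow> real) \<Rightarrow> real \<Rightarrow> real \<Rightarrow> real" where
  "ufun p X x t = bcoef p * X (t - delay p + delay p * x) 1"

definition samp :: "design \<Rightarrow> nat \<Rightarrow> real" where
  "samp d i = real i * Tsamp d"

text \<open>
  The window start belonging to the sampling instant of index i + 1.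
\<close>

definition mu_Suc :: "design \<Rightarrow> nat \<Rightarrow> real" where
  "mu_Suc d i =
     Min {samp d g | g. g \<in> {0..i} \<and> samp d g \<ge> samp d (i + 1) - real (Nwin d) * Tsamp d}"

definition fq :: "plant \<Rightarrow> (real \<Rightarrow> nat \<Rightarrow> real) \<Rightarrow> nat \<Rightarrow> real \<Rightarrow> real" where
  "fq p X q t = pi * real q *
     integral {0..t} (\<lambda>\<tau>. integral {0..1} (\<lambda>x. cos (x * pi * real q) * ufun p X x \<tau>))"

definition gq :: "plant \<Rightarrow> (real \<Rightarrow> nat \<Rightarrow> real) \<Rightarrow> nat \<Rightarrow> real \<Rightarrow> real" where
  "gq p X q t = - integral {0..1} (\<lambda>x. sin (x * pi * real q) * ufun p X x t)"

definition Gq :: "plant \<Rightarrow> (real \<Rightarrow> nat \<Rightarrow> real) \<Rightarrow> nat \<Rightarrow> real \<Rightarrow> real \<Rightarrow> real" where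
  "Gq p X q t \<mu> = integral {\<mu>..t} (\<lambda>\<tau>. (gq p X q \<tau>)\<^sup>2)"

definition Fq :: "plant \<Rightarrow> (real \<Rightarrow> nat \<Rightarrow> real) \<Rightarrow> nat \<Rightarrow> real \<Rightarrow> real \<Rightarrow> real" where
  "Fq p X q t \<mu> = integral {\<mu>..t} (\<lambda>\<tau>. gq p X q \<tau> * fq p X q \<tau>)"

primrec Dhat_samp :: "plant \<Rightarrow> design \<Rightarrow> (real \<Rightarrow> nat \<Rightarrow> real) \<Rightarrow> nat \<Rightarrow> real" where
  "Dhat_samp p d X 0 = Dhat0 d"
| "Dhat_samp p d X (Suc i) =
     arg_min (\<lambda>l. \<bar>l - Dhat_samp p d X i\<bar>\<^sup>2)
       (\<lambda>l. l \<in> {Dlow d..Dup d} \<and>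
          (\<forall>q\<ge>1. Gq p X q (samp d (i + 1)) (mu_Suc d i) * l
                = Fq p X q (samp d (i + 1)) (mu_Suc d i)))"

definition Dhat :: "plant \<Rightarrow> design \<Rightarrow> (real \<Rightarrow> nat \<Rightarrow> real) \<Rightarrow> real \<Rightarrow> real" where
  "Dhat p d X t = Dhat_samp p d X (nat \<lfloor>t / Tsamp d\<rfloor>)"

definition is_tf :: "plant \<Rightarrow> design \<Rightarrow> (real \<Rightarrow> nat \<Rightarrow> real) \<Rightarrow> real \<Rightarrow> bool" where
  "is_tf p d X tf \<longleftrightarrow>
     is_arg_min (\<lambda>t. t)
       (\<lambda>t. t \<in> {samp d i | i. \<exists>t'\<in>{0..<samp d i}. \<exists>x\<in>{0..1}. ufun p X x t' \<noteq> 0}) tf"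

definition is_adaptive_input ::
  "plant \<Rightarrow> design \<Rightarrow> (real \<Rightarrow> real) \<Rightarrow> (real \<Rightarrow> real \<Rightarrow> nat \<Rightarrow> real) \<Rightarrow> (real \<Rightarrow> nat \<Rightarrow> real) \<Rightarrow>
   real \<Rightarrow> real \<Rightarrow> real \<Rightarrow> bool" where
  "is_adaptive_input p d s P X tf t v \<longleftrightarrow>
     (let Ud = U_nominal p d (P (Dhat p d X t) t) (X t) (jet s (t + Dhat p d X t));
          Us = (\<lambda>D. U_star p d (P D t) (X t) (jet s (t + D)));
          D0 = {Dlow d..Dup d}
      in if t > tf then v = Ud
         else if bcoef p > 0
         then \<exists>D. is_arg_max Us (\<lambda>D. D \<in> D0) D \<and> v = max Ud (Us D)
         else \<exists>D. is_arg_min Us (\<lambda>D. D \<in> D0) D \<and> v = min Ud (Us D))"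

text \<open>
  Predictors are required to exist only as long as they are used: for every D in [Dlow, Dup] up
  to time tf, and for the current estimate afterwards. For the true delay the predictor always
  exists, namely Y (t + delay).
\<close>

definition closed_loop ::
  "plant \<Rightarrow> design \<Rightarrow> (real \<Rightarrow> real) \<Rightarrow> (real \<Rightarrow> nat \<Rightarrow> real) \<Rightarrow> (real \<Rightarrow> nat \<Rightarrow> real) \<Rightarrow>
   (real \<Rightarrow> real \<Rightarrow> nat \<Rightarrow> real) \<Rightarrow> real \<Rightarrow> bool" where
  "closed_loop p d s Y X P tf \<longleftrightarrow>
     is_tf p d X tf \<and>
     (\<forall>t\<ge>0. \<forall>D. D = delay p \<or> D = Dhat p d X t \<or> (t \<le> tf \<and> D \<in> {Dlow d..Dup d}) \<longrightarrow>
        is_predictor p Y X D t (P D)) \<and>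
     (\<exists>U. (\<forall>t\<ge>0. is_adaptive_input p d s P X tf t (U t)) \<and> plant_solution p U Y X)"

definition vnorm :: "nat \<Rightarrow> (nat \<Rightarrow> real) \<Rightarrow> real" where
  "vnorm N v = L2_set v {1..N}"

definition Psi ::
  "plant \<Rightarrow> (real \<Rightarrow> nat \<Rightarrow> real) \<Rightarrow> (real \<Rightarrow> nat \<Rightarrow> real) \<Rightarrow> (real \<Rightarrow> real \<Rightarrow> nat \<Rightarrow> real) \<Rightarrow>
   real \<Rightarrow> real" where
  "Psi p Y X P t =
     vnorm (nx p) (X t) + vnorm (ny p) (Y t)
     + (SUP x\<in>{0..1}. vnorm (ny p) (P (delay p) (t - delay p + delay p * x)))
     + sqrt (integral {t - delay p..t} (\<lambda>\<tau>. (X \<tau> 1)\<^sup>2))"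

definition decays_exponentially :: "(real \<Rightarrow> real) \<Rightarrow> bool" where
  "decays_exponentially g \<longleftrightarrow> (\<exists>C \<kappa>. \<kappa> > 0 \<and> (\<forall>t\<ge>0. \<bar>g t\<bar> \<le> C * exp (- \<kappa> * t)))"

end

(*
  In the backstepping errors z_i (along the predictor) and r_j the loop is a cascade
  z_i' = - k_i z_i + z_(i+1), z_n' = - k_n z_n + r_1, r_j' = - c_j r_j + r_(j+1).
  Before t_f the maximum over D_0 includes the true delay, so that r_m' >= - cbar r_m; the
  thresholds on the gains make all errors positive initially, and positivity then propagates down
  the cascade to z_1 = y_1 - s. The moments of the transport equation give F_q = D G_q, and by
  completeness of the sines some G_q is nonzero at t_f; hence the estimate equals D from t_f on,
  r_m' = - c_m r_m, and all errors decay exponentially. The states are continuous (and, near the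
  origin, Lipschitz) functions of the errors and the jet of s.
*)
theory Submission
  imports Defs
begin

section \<open>Monotonicity off a countable set\<close>

text \<open>Switching makes solutions differentiable only off a countable set, so every differential
  inequality rests on a monotonicity principle that tolerates such a set. The predictor is given
  only by integral equations whose lower limit moves with time; uniqueness identifies it with
  \<open>Y (t + delay p)\<close>, and only then does it inherit the plant equations that yield the
  cascade. Each backstepping step and each time derivative of Delta spends one order of smoothness;
  the orders granted to \<open>psi\<close> and \<open>phi\<close> last until Delta of order m and
  tau_m are still continuous. \<open>U_star\<close> is the nominal law with \<open>cbar\<close> in
  place of c_m in the last error equation, so before t_f only the sign of the mismatch counts, and
  one member of the family, the one for the true delay, decides it. Errors determine the states
  because each virtual control involves earlier components only. The resulting bound depends on the
  sizes of the errors and of the jet alone, which is why the ultimate bound can be fixed before any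
  initial data.\<close>

lemma le_off_countable:
  fixes f :: "real \<Rightarrow> real"
  assumes "a \<le> b" and cont: "continuous_on {a..b} f" and E: "countable E"
    and der: "\<And>t. a < t \<Longrightarrow> t < b \<Longrightarrow> t \<notin> E \<Longrightarrow> \<exists>D\<ge>0. (f has_real_derivative D) (at t)"
  shows "f a \<le> f b"
proof (rule ccontr)
  assume "\<not> f a \<le> f b"
  then have less: "f b < f a" by simp
  then have ab: "a < b" using \<open>a \<le> b\<close> by (cases "a = b") auto
  \<comment> \<open>The tilt spends half of the supposed drop: \<open>g\<close> still falls from
    \<open>a\<close> to \<open>b\<close>, while its derivative off \<open>E\<close> is strictly
    positive.\<close>
  define \<epsilon> where "\<epsilon> = (f a - f b) / (2 * (b - a))"
  define g where "g t = f t + \<epsilon> * (t - a)" for t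
  have \<epsilon>: "\<epsilon> > 0" using less ab by (simp add: \<epsilon>_def)
  have "\<epsilon> * (b - a) = (f a - f b) / 2" using ab by (simp add: \<epsilon>_def field_simps)
  then have "g b < g a" using less by (simp add: g_def)
  then have "uncountable {g b<..<g a}" by (simp add: uncountable_open_interval)
  moreover have "countable (g ` E)" using E by simp
  \<comment> \<open>a level that is not attained at any exceptional time\<close>
  ultimately have "\<exists>c\<in>{g b<..<g a}. c \<notin> g ` E"
    by (meson countable_subset subsetI)
  then obtain c where c: "g b < c" "c < g a" "c \<notin> g ` E" by auto
  have contg: "continuous_on {a..b} g"
    unfolding g_def by (intro continuous_intros cont)
  \<comment> \<open>Its maximum \<open>r\<close> is the last time at or above the level. Since
    \<open>g r = c\<close> and no exceptional time has this level, \<open>g\<close> has a positive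
    derivative at \<open>r\<close> and exceeds \<open>c\<close> just afterwards.\<close>
  define S where "S = {t \<in> {a..b}. c \<le> g t}"
  have "compact S"
  proof -
    have "S = {a..b} \<inter> {t \<in> {a..b}. c \<le> g t}" by (auto simp: S_def)
    moreover have "closed {t \<in> {a..b}. c \<le> g t}"
      by (intro continuous_on_closed_Collect_le continuous_on_const contg closed_atLeastAtMost)
    ultimately show ?thesis by (metis compact_Int_closed compact_Icc)
  qed
  moreover have "a \<in> S" using c ab by (auto simp: S_def)
  ultimately obtain r where r: "r \<in> S" "\<And>t. t \<in> S \<Longrightarrow> t \<le> r"
    using compact_attains_sup[of S] by blast
  have rb: "a \<le> r" "r < b" "c \<le> g r" using r(1) c by (auto simp: S_def less_le)
  have above: "g t < c" if "r < t" "t \<le> b" for t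
    using r(2)[of t] that rb by (force simp: S_def)
  have gr: "g r = c"
  proof (rule ccontr)
    assume "g r \<noteq> c"
    then have "c < g r" using rb by simp
    moreover have "continuous_on {r..b} g" using contg rb by (auto intro: continuous_on_subset)
    ultimately obtain t where "r \<le> t" "t \<le> b" "g t = c"
      using IVT2'[of g b c r] c rb by auto
    then show False using above[of t] \<open>g r \<noteq> c\<close> by (cases "t = r") auto
  qed
  then have "a < r" "r \<notin> E" using c rb by (auto simp: less_le)
  then obtain D where D: "D \<ge> 0" "(f has_real_derivative D) (at r)" using der rb by blast
  have "(g has_real_derivative D + \<epsilon>) (at r)"
    unfolding g_def by (auto intro!: derivative_eq_intros D)
  then obtain h where h: "h > 0" "\<And>x. 0 < x \<Longrightarrow> x < h \<Longrightarrow> g r < g (r + x)"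
    using DERIV_pos_inc_right[of g "D + \<epsilon>" r] D \<epsilon> by auto
  define x where "x = min (h / 2) (b - r)"
  have "0 < x" "x < h" "r + x \<le> b" using h rb by (auto simp: x_def min_def)
  then show False using h(2)[of x] above[of "r + x"] gr by simp
qed

lemma eq_off_countable:
  fixes f :: "real \<Rightarrow> real"
  assumes "a \<le> b" "continuous_on {a..b} f" "countable E"
    and "\<And>t. a < t \<Longrightarrow> t < b \<Longrightarrow> t \<notin> E \<Longrightarrow> (f has_real_derivative 0) (at t)"
  shows "f a = f b"
proof (rule antisym)
  show "f a \<le> f b" using assms by (intro le_off_countable[of a b f E]) auto
  have "- f a \<le> - f b"
    using assms by (intro le_off_countable[of a b "\<lambda>t. - f t" E])
      (auto intro!: continuous_intros derivative_eq_intros exI[of _ 0])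
  then show "f b \<le> f a" by simp
qed

text \<open>The difference of \<open>f\<close> and the indefinite integral of \<open>g\<close> has
  derivative zero off \<open>E\<close>. Continuity of \<open>g\<close> at the regular times is what
  makes the indefinite integral differentiable there.\<close>

lemma integral_off_countable:
  fixes f g :: "real \<Rightarrow> real"
  assumes "a \<le> b" and cont: "continuous_on {a..b} f" and E: "countable E"
    and g: "g integrable_on {a..b}"
    and contg: "\<And>t. a < t \<Longrightarrow> t < b \<Longrightarrow> t \<notin> E \<Longrightarrow> isCont g t"
    and der: "\<And>t. a < t \<Longrightarrow> t < b \<Longrightarrow> t \<notin> E \<Longrightarrow> (f has_real_derivative g t) (at t)"
  shows "integral {a..b} g = f b - f a"
proof -
  define G where "G t = f t - integral {a..t} g" for t
  have "G a = G b"
  proof (rule eq_off_countable[OF \<open>a \<le> b\<close> _ E])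
    show "continuous_on {a..b} G"
      unfolding G_def by (intro continuous_intros cont indefinite_integral_continuous_1 g)
    fix t assume t: "a < t" "t < b" "t \<notin> E"
    have "((\<lambda>u. integral {a..u} g) has_real_derivative g t) (at t within {a..b})"
      unfolding has_real_derivative_iff_has_vector_derivative
      using t integral_has_vector_derivative_continuous_at[where S="{}", OF g, of t]
        continuous_at_imp_continuous_within[OF contg[OF t]] by simp
    then have "((\<lambda>u. integral {a..u} g) has_real_derivative g t) (at t)"
      using t by (simp add: at_within_Icc_at)
    from DERIV_diff[OF der[OF t] this]
    show "(G has_real_derivative 0) (at t)" by (simp add: G_def[abs_def])
  qed
  then show ?thesis by (simp add: G_def)
qed

section \<open>Smooth functions of finitely many variables\<close>

text \<open>
  The index type is arbitrary, so that a function of several vectors can be regarded as a function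
  of one vector indexed by a sum type; all partial derivatives are required to exist, which is no
  restriction in the coordinates on which the function does not depend.
\<close>

definition partial_deriv :: "'i \<Rightarrow> (('i \<Rightarrow> real) \<Rightarrow> real) \<Rightarrow> ('i \<Rightarrow> real) \<Rightarrow> real" where
  "partial_deriv i F z = deriv (\<lambda>v. F (z(i := v))) (z i)"

primrec smooth :: "nat \<Rightarrow> (('i \<Rightarrow> real) \<Rightarrow> real) \<Rightarrow> bool" where
  "smooth 0 F \<longleftrightarrow> continuous_on UNIV F"
| "smooth (Suc r) F \<longleftrightarrow> continuous_on UNIV F \<and>
     (\<forall>i. (\<forall>z. (\<lambda>v. F (z(i := v))) differentiable at (z i)) \<and> smooth r (partial_deriv i F))"

lemma smooth_continuous: "smooth r F \<Longrightarrow> continuous_on UNIV F"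
  by (cases r) auto

lemma smooth_has_pd:
  "smooth (Suc r) F \<Longrightarrow> ((\<lambda>v. F (z(i := v))) has_real_derivative partial_deriv i F z) (at (z i))"
  unfolding partial_deriv_def by (simp add: DERIV_deriv_iff_real_differentiable)

lemma smooth_has_pd_upd:
  assumes "smooth (Suc r) F"
  shows "((\<lambda>v. F (z(i := v))) has_real_derivative partial_deriv i F (z(i := x))) (at x)"
  using smooth_has_pd[OF assms, of "z(i := x)" i] by simp

lemma smooth_pd: "smooth (Suc r) F \<Longrightarrow> smooth r (partial_deriv i F)"
  by simp

lemma smooth_SucI:
  assumes "continuous_on UNIV F"
    and der: "\<And>i z. ((\<lambda>v. F (z(i := v))) has_real_derivative F' i z) (at (z i))"
    and "\<And>i. smooth r (F' i)"
  shows "smooth (Suc r) F"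
proof -
  have "partial_deriv i F = F' i" for i
    unfolding partial_deriv_def using DERIV_imp_deriv[OF der] by blast
  then show ?thesis
    using assms by (auto simp: real_differentiable_def)
qed

lemma smooth_Suc_imp: "smooth (Suc r) F \<Longrightarrow> smooth r F"
proof (induction r arbitrary: F)
  case (Suc r)
  then show ?case by (metis smooth.simps(2))
qed simp

lemma smooth_mono: "smooth r F \<Longrightarrow> r' \<le> r \<Longrightarrow> smooth r' F"
  by (induction r) (auto simp: le_Suc_eq dest: smooth_Suc_imp simp del: smooth.simps(2))

lemma smooth_const [simp]: "smooth r (\<lambda>z. c)"
  by (induction r arbitrary: c) (auto simp del: smooth.simps(2) intro!: smooth_SucI[where F' = "\<lambda>i z. 0"])

lemma smooth_coord [simp]: "smooth r (\<lambda>z. z i)"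
proof (induction r)
  case (Suc r)
  show ?case
    by (rule smooth_SucI[where F' = "\<lambda>j z. if j = i then 1 else 0"]) (auto intro: continuous_on_product_then_coordinatewise)
qed (auto intro: continuous_on_product_then_coordinatewise)

lemma smooth_add: "smooth r F \<Longrightarrow> smooth r G \<Longrightarrow> smooth r (\<lambda>z. F z + G z)"
proof (induction r arbitrary: F G)
  case (Suc r)
  show ?case
    by (rule smooth_SucI[where F' = "\<lambda>i z. partial_deriv i F z + partial_deriv i G z"])
      (intro continuous_intros smooth_continuous[OF Suc.prems(1)] smooth_continuous[OF Suc.prems(2)]
        DERIV_add smooth_has_pd[OF Suc.prems(1)] smooth_has_pd[OF Suc.prems(2)]
        Suc.IH smooth_pd[OF Suc.prems(1)] smooth_pd[OF Suc.prems(2)])+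
qed (auto intro: continuous_intros)

lemma smooth_mult: "smooth r F \<Longrightarrow> smooth r G \<Longrightarrow> smooth r (\<lambda>z. F z * G z)"
proof (induction r arbitrary: F G)
  case (Suc r)
  show ?case
  proof (rule smooth_SucI[where F' = "\<lambda>i z. partial_deriv i F z * G z + partial_deriv i G z * F z"])
    show "continuous_on UNIV (\<lambda>z. F z * G z)"
      by (intro continuous_intros smooth_continuous[OF Suc.prems(1)] smooth_continuous[OF Suc.prems(2)])
    show "((\<lambda>v. F (z(i := v)) * G (z(i := v))) has_real_derivative partial_deriv i F z * G z + partial_deriv i G z * F z)
        (at (z i))" for i z
      using DERIV_mult[OF smooth_has_pd[OF Suc.prems(1), of z i] smooth_has_pd[OF Suc.prems(2), of z i]]
      by (simp only: fun_upd_triv)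
    show "smooth r (\<lambda>z. partial_deriv i F z * G z + partial_deriv i G z * F z)" for i
      using Suc.prems by (intro smooth_add Suc.IH smooth_pd) (auto intro: smooth_Suc_imp simp del: smooth.simps(2))
  qed
qed (auto intro: continuous_intros)

lemma smooth_cmult: "smooth r F \<Longrightarrow> smooth r (\<lambda>z. c * F z)"
  by (intro smooth_mult smooth_const)

lemma smooth_minus: "smooth r F \<Longrightarrow> smooth r (\<lambda>z. - F z)"
  using smooth_cmult[of r F "- 1"] by simp

lemma smooth_diff: "smooth r F \<Longrightarrow> smooth r G \<Longrightarrow> smooth r (\<lambda>z. F z - G z)"
  using smooth_add[OF _ smooth_minus] by fastforce

lemma smooth_sum: "(\<And>k. k \<in> K \<Longrightarrow> smooth r (F k)) \<Longrightarrow> smooth r (\<lambda>z. \<Sum>k\<in>K. F k z)"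
  by (induction K rule: infinite_finite_induct) (auto intro!: smooth_add)

lemma fun_upd_reindex: "inj \<sigma> \<Longrightarrow> (z(\<sigma> i := v)) \<circ> \<sigma> = (z \<circ> \<sigma>)(i := v)"
  by (auto simp: fun_eq_iff inj_eq)

text \<open>Lifts a function of one block of variables to all blocks of a sum type. By injectivity
  an update at \<open>\<sigma> i\<close> changes just coordinate \<open>i\<close> of
  \<open>z \<circ> \<sigma>\<close>, so each partial derivative is a reindexed one or zero.\<close>

lemma smooth_reindex:
  fixes \<sigma> :: "'i \<Rightarrow> 'j"
  assumes "inj \<sigma>"
  shows "smooth r F \<Longrightarrow> smooth r (\<lambda>z. F (z \<circ> \<sigma>))"
proof -
  have cont: "continuous_on UNIV (\<lambda>z. F (z \<circ> \<sigma>))" if "continuous_on UNIV F" for F :: "('i \<Rightarrow> real) \<Rightarrow> real"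
    by (rule continuous_on_compose2[OF that])
      (auto simp: comp_def intro!: continuous_on_coordinatewise_then_product continuous_on_product_coordinates)
  show "smooth r F \<Longrightarrow> smooth r (\<lambda>z. F (z \<circ> \<sigma>))"
  proof (induction r arbitrary: F)
    case (Suc r)
    show ?case
    proof (rule smooth_SucI[where F' = "\<lambda>j z. if j \<in> range \<sigma> then partial_deriv (inv \<sigma> j) F (z \<circ> \<sigma>) else 0"])
      show "continuous_on UNIV (\<lambda>z. F (z \<circ> \<sigma>))"
        by (intro cont smooth_continuous[OF Suc.prems])
      show "smooth r (\<lambda>z. if j \<in> range \<sigma> then partial_deriv (inv \<sigma> j) F (z \<circ> \<sigma>) else 0)" for j
        using Suc.IH[OF smooth_pd[OF Suc.prems, of "inv \<sigma> j"]] by (cases "j \<in> range \<sigma>") (simp_all only: if_True if_False smooth_const)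
      show "((\<lambda>v. F (z(j := v) \<circ> \<sigma>)) has_real_derivative
          (if j \<in> range \<sigma> then partial_deriv (inv \<sigma> j) F (z \<circ> \<sigma>) else 0)) (at (z j))" for j z
      proof (cases "j \<in> range \<sigma>")
        case True
        then obtain i where "j = \<sigma> i" by auto
        then show ?thesis
          using smooth_has_pd[OF Suc.prems, of "z \<circ> \<sigma>" i]
          by (simp only: fun_upd_reindex[OF assms] inv_f_f[OF assms] rangeI if_True comp_apply)
      next
        case False
        then have "z(j := v) \<circ> \<sigma> = z \<circ> \<sigma>" for v by (auto simp: fun_eq_iff)
        then show ?thesis using False by simp
      qed
    qed
  qed (simp add: cont)
qed

section \<open>Dependence on a set of coordinates\<close>

definition depends_on :: "'i set \<Rightarrow> (('i \<Rightarrow> real) \<Rightarrow> real) \<Rightarrow> bool" where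
  "depends_on I F \<longleftrightarrow> (\<forall>z z'. (\<forall>i\<in>I. z i = z' i) \<longrightarrow> F z = F z')"

lemma depends_onD: "depends_on I F \<Longrightarrow> (\<And>i. i \<in> I \<Longrightarrow> z i = z' i) \<Longrightarrow> F z = F z'"
  unfolding depends_on_def by blast

lemma depends_on_pd:
  assumes "depends_on I F"
  shows "depends_on I (partial_deriv i F)"
  unfolding depends_on_def
proof (intro allI impI)
  fix z z' :: "'a \<Rightarrow> real" assume eq: "\<forall>i\<in>I. z i = z' i"
  then have *: "F (z(i := v)) = F (z'(i := v))" for v
    by (intro depends_onD[OF assms]) auto
  show "partial_deriv i F z = partial_deriv i F z'"
  proof (cases "i \<in> I")
    case True
    then show ?thesis using eq by (simp add: partial_deriv_def *)
  next
    case False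
    then have "F (z'(i := v)) = F z'" for v
      by (intro depends_onD[OF assms]) auto
    then show ?thesis by (simp add: partial_deriv_def *)
  qed
qed

lemma pd_eq_0:
  assumes "depends_on I F" "i \<notin> I"
  shows "partial_deriv i F z = 0"
proof -
  have "F (z(i := v)) = F z" for v
    by (rule depends_onD[OF assms(1)]) (use assms(2) in auto)
  then show ?thesis by (simp add: partial_deriv_def)
qed

text \<open>\<open>Ck\<close> speaks of the first \<open>N\<close> partial derivatives only; in the
  other coordinates \<open>F\<close> is constant, so those derivatives exist and vanish.\<close>

lemma Ck_imp_smooth:
  "depends_on {1..N} F \<Longrightarrow> Ck N r F \<Longrightarrow> smooth r F"
proof (induction r arbitrary: F)
  case (Suc r)
  have part: "partial i F = partial_deriv i F" for i by (simp add: partial_def partial_deriv_def fun_eq_iff)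
  show ?case unfolding smooth.simps
  proof (intro conjI allI)
    show "continuous_on UNIV F" using Suc.prems by simp
    fix i
    show "(\<lambda>v. F (z(i := v))) differentiable at (z i)" for z
    proof (cases "i \<in> {1..N}")
      case False
      then have "F (z(i := v)) = F z" for v
        by (intro depends_onD[OF Suc.prems(1)]) auto
      then show ?thesis by simp
    qed (use Suc.prems in auto)
    show "smooth r (partial_deriv i F)"
    proof (cases "i \<in> {1..N}")
      case True
      then show ?thesis
        using Suc.prems by (intro Suc.IH depends_on_pd) (auto simp flip: part)
    next
      case False
      then have "partial_deriv i F = (\<lambda>z. 0)" using pd_eq_0[OF Suc.prems(1)] by auto
      then show ?thesis by simp
    qed
  qed
qed simp

section \<open>Chain rule, boundedness and Lipschitz estimates from partial derivatives\<close>

lemma tendsto_product: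
  fixes c :: "'a \<Rightarrow> 'i \<Rightarrow> real"
  assumes "\<And>i. ((\<lambda>s. c s i) \<longlongrightarrow> l i) F"
  shows "(c \<longlongrightarrow> l) F"
proof -
  have "limitin (product_topology (\<lambda>i. euclidean) UNIV) c l F"
    using assms by (simp add: limitin_componentwise)
  then show ?thesis by (simp add: euclidean_product_topology)
qed

text \<open>A mean value theorem blind to the order of \<open>x\<close> and \<open>y\<close>; the
  recorded distance of \<open>\<xi>\<close> from \<open>x\<close> feeds the squeeze in the chain
  rule.\<close>

lemma mvt_between:
  fixes G :: "real \<Rightarrow> real"
  assumes "\<And>v. (G has_real_derivative G' v) (at v)"
  obtains \<xi> where "\<bar>\<xi> - x\<bar> \<le> \<bar>y - x\<bar>" "G y - G x = G' \<xi> * (y - x)"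
proof (cases x y rule: linorder_cases)
  case less
  then obtain z where z: "z > x" "z < y" "G y - G x = (y - x) * G' z"
    using MVT2[of x y G G'] assms by blast
  then show ?thesis using that[of z] by (simp add: mult.commute)
next
  case equal
  then show ?thesis using that[of x] by simp
next
  case greater
  then obtain z where z: "z > y" "z < x" "G x - G y = (x - y) * G' z"
    using MVT2[of y x G G'] assms by blast
  then show ?thesis using that[of z] by (simp add: algebra_simps)
qed

text \<open>Coordinates are released one at a time: the increment in coordinate \<open>j\<close> is
  a mean value of one partial derivative, whose continuity gives the limit. Generalising over the
  background \<open>z\<close> lets the induction hypothesis freeze coordinate \<open>j\<close> at
  \<open>c t j\<close>.\<close>

lemma chain_rule_aux:
  fixes F :: "('i \<Rightarrow> real) \<Rightarrow> real"
  assumes "finite I" and F: "smooth (Suc 0) F"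
    and "\<And>i. i \<in> I \<Longrightarrow> ((\<lambda>s. c s i) has_real_derivative c' i) (at t)"
  shows "((\<lambda>s. F (\<lambda>i. if i \<in> I then c s i else z i)) has_real_derivative
      (\<Sum>i\<in>I. partial_deriv i F (\<lambda>i. if i \<in> I then c t i else z i) * c' i)) (at t)"
  using assms(1,3)
proof (induction I arbitrary: z rule: finite_induct)
  case empty
  then show ?case by simp
next
  case (insert j I)
  define m where "m z s = (\<lambda>i. if i \<in> I then c s i else z i)" for z s
  have ins: "(\<lambda>i. if i \<in> insert j I then c s i else z i) = (m z s)(j := c s j)" for s
    by (auto simp: m_def)
  have old: "m (z(j := c t j)) s = (m z s)(j := c t j)" for s
    using insert.hyps by (auto simp: m_def)
  have "\<exists>\<xi>. \<bar>\<xi> - c t j\<bar> \<le> \<bar>c s j - c t j\<bar> \<and>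
      F ((m z s)(j := c s j)) - F ((m z s)(j := c t j)) = partial_deriv j F ((m z s)(j := \<xi>)) * (c s j - c t j)" for s
    by (rule mvt_between[of "\<lambda>v. F ((m z s)(j := v))" "\<lambda>v. partial_deriv j F ((m z s)(j := v))"])
      (use smooth_has_pd_upd[OF F] in auto)
  then obtain \<xi> where \<xi>: "\<And>s. \<bar>\<xi> s - c t j\<bar> \<le> \<bar>c s j - c t j\<bar>"
    "\<And>s. F ((m z s)(j := c s j)) - F ((m z s)(j := c t j)) = partial_deriv j F ((m z s)(j := \<xi> s)) * (c s j - c t j)"
    by metis
  have dj: "((\<lambda>s. c s j) has_real_derivative c' j) (at t)" using insert.prems by simp
  \<comment> \<open>Caratheodory's form of the derivative avoids dividing by
    \<open>c s j - c t j\<close>, which may vanish.\<close>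
  then obtain g where g: "\<And>s. c s j - c t j = g s * (s - t)" "isCont g t" "g t = c' j"
    unfolding CARAT_DERIV by blast
  have "(\<xi> \<longlongrightarrow> c t j) (at t)"
  proof -
    have "((\<lambda>s. c s j - c t j) \<longlongrightarrow> 0) (at t)"
      using DERIV_isCont[OF dj] by (simp add: isCont_def LIM_zero)
    then have "((\<lambda>s. \<xi> s - c t j) \<longlongrightarrow> 0) (at t)"
      by (rule Lim_null_comparison[rotated, OF tendsto_rabs_zero]) (use \<xi>(1) in auto)
    then show ?thesis by (simp add: LIM_zero_iff)
  qed
  moreover have "((\<lambda>s. m z s i) \<longlongrightarrow> m z t i) (at t)" for i
    using insert.prems by (cases "i \<in> I") (auto simp: m_def intro!: DERIV_isCont[unfolded isCont_def])
  ultimately have "((\<lambda>s. (m z s)(j := \<xi> s)) \<longlongrightarrow> (m z t)(j := c t j)) (at t)"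
    by (intro tendsto_product) auto
  then have "((\<lambda>s. partial_deriv j F ((m z s)(j := \<xi> s))) \<longlongrightarrow> partial_deriv j F ((m z t)(j := c t j))) (at t)"
    by (rule continuous_on_tendsto_compose[OF smooth_continuous[OF smooth_pd[OF F]]]) auto
  moreover have "\<xi> t = c t j" using \<xi>(1)[of t] by simp
  ultimately have "isCont (\<lambda>s. partial_deriv j F ((m z s)(j := \<xi> s)) * g s) t"
    using g(2) by (auto simp: isCont_def intro!: tendsto_mult)
  moreover have "F ((m z s)(j := c s j)) - F ((m z s)(j := c t j)) -
      (F ((m z t)(j := c t j)) - F ((m z t)(j := c t j))) = (partial_deriv j F ((m z s)(j := \<xi> s)) * g s) * (s - t)" for s
    unfolding \<xi>(2) g(1) by simp
  ultimately have "((\<lambda>s. F ((m z s)(j := c s j)) - F ((m z s)(j := c t j))) has_real_derivative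
      partial_deriv j F ((m z t)(j := \<xi> t)) * g t) (at t)"
    unfolding CARAT_DERIV by (intro exI[of _ "\<lambda>s. partial_deriv j F ((m z s)(j := \<xi> s)) * g s"]) simp
  moreover have "((\<lambda>s. F ((m z s)(j := c t j))) has_real_derivative
      (\<Sum>i\<in>I. partial_deriv i F ((m z t)(j := c t j)) * c' i)) (at t)"
    using insert.IH[of "z(j := c t j)", folded m_def, unfolded old] insert.prems by blast
  ultimately have "((\<lambda>s. F ((m z s)(j := c s j))) has_real_derivative
     partial_deriv j F ((m z t)(j := c t j)) * c' j + (\<Sum>i\<in>I. partial_deriv i F ((m z t)(j := c t j)) * c' i)) (at t)"
    using \<open>\<xi> t = c t j\<close> g(3) DERIV_add by fastforce
  then show ?case
    unfolding ins using insert.hyps by simp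
qed

lemma chain_rule:
  assumes "finite I" "smooth (Suc 0) F" and dep: "depends_on I F"
    and "\<And>i. i \<in> I \<Longrightarrow> ((\<lambda>s. c s i) has_real_derivative c' i) (at t)"
  shows "((\<lambda>s. F (c s)) has_real_derivative (\<Sum>i\<in>I. partial_deriv i F (c t) * c' i)) (at t)"
proof -
  have "F (\<lambda>i. if i \<in> I then c s i else 0) = F (c s)" for s
    by (rule depends_onD[OF dep]) auto
  moreover have "partial_deriv j F (\<lambda>i. if i \<in> I then c t i else 0) = partial_deriv j F (c t)" for j
    by (rule depends_onD[OF depends_on_pd[OF dep]]) auto
  ultimately show ?thesis
    using chain_rule_aux[OF assms(1,2), of c c' t, OF assms(4), where z = "\<lambda>_. 0"] by (simp only:)
qed

lemma continuous_on_depends: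
  assumes F: "continuous_on UNIV F" and dep: "depends_on I F"
    and c: "\<And>i. i \<in> I \<Longrightarrow> continuous_on S (\<lambda>s. c s i)"
  shows "continuous_on S (\<lambda>s. F (c s))"
proof -
  have "continuous_on S (\<lambda>s i. if i \<in> I then c s i else 0)"
  proof (rule continuous_on_coordinatewise_then_product)
    show "continuous_on S (\<lambda>s. if i \<in> I then c s i else 0)" for i
      using c by (cases "i \<in> I") auto
  qed
  then have "continuous_on S (\<lambda>s. F (\<lambda>i. if i \<in> I then c s i else 0))"
    by (intro continuous_on_compose2[OF F]) auto
  moreover have "F (\<lambda>i. if i \<in> I then c s i else 0) = F (c s)" for s
    by (rule depends_onD[OF dep]) auto
  ultimately show ?thesis by simp
qed

text \<open>Tychonoff makes the box compact even over an infinite index type; coordinates outside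
  \<open>I\<close> can be set to zero without changing \<open>F\<close>.\<close>

lemma bounded_on_box:
  fixes F :: "('i \<Rightarrow> real) \<Rightarrow> real"
  assumes F: "continuous_on UNIV F" and dep: "depends_on I F"
  obtains B where "B \<ge> 0" "\<And>z. (\<forall>i\<in>I. \<bar>z i\<bar> \<le> R) \<Longrightarrow> \<bar>F z\<bar> \<le> B"
proof -
  \<comment> \<open>\<open>\<bar>R\<bar>\<close> keeps zero, the value given to the coordinates
    outside \<open>I\<close>, in the box whatever the sign of \<open>R\<close>.\<close>
  define K where "K = (Pi\<^sub>E UNIV (\<lambda>i::'i. {-\<bar>R\<bar>..\<bar>R\<bar>}))"
  have "compactin (product_topology (\<lambda>i. euclidean) UNIV) K"
    unfolding K_def compactin_PiE by simp
  then have "compact K" by (simp add: euclidean_product_topology)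
  then have "compact (F ` K)"
    by (intro compact_continuous_image continuous_on_subset[OF F]) auto
  then have "bounded (F ` K)" by (rule compact_imp_bounded)
  then obtain B where B: "\<And>z. z \<in> K \<Longrightarrow> \<bar>F z\<bar> \<le> B"
    unfolding bounded_iff by auto
  show ?thesis
  proof (rule that)
    show "max B 0 \<ge> 0" by simp
    fix z assume z: "\<forall>i\<in>I. \<bar>z i\<bar> \<le> R"
    have "F (\<lambda>i. if i \<in> I then z i else 0) = F z"
      by (rule depends_onD[OF dep]) auto
    moreover have "(\<lambda>i. if i \<in> I then z i else 0) \<in> K"
      using z by (fastforce simp: K_def abs_le_iff)
    ultimately show "\<bar>F z\<bar> \<le> max B 0" using B by fastforce
  qed
qed

text \<open>Mean value theorem along the segment from \<open>z'\<close> to \<open>z\<close>, which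
  stays in the box by convexity; there all partial derivatives are bounded.\<close>

lemma lipschitz_on_box:
  fixes F :: "('i \<Rightarrow> real) \<Rightarrow> real"
  assumes "finite I" and F: "smooth (Suc 0) F" and dep: "depends_on I F"
  obtains L where "L \<ge> 0"
    "\<And>z z'. (\<forall>i\<in>I. \<bar>z i\<bar> \<le> R) \<Longrightarrow> (\<forall>i\<in>I. \<bar>z' i\<bar> \<le> R) \<Longrightarrow> \<bar>F z - F z'\<bar> \<le> L * (\<Sum>i\<in>I. \<bar>z i - z' i\<bar>)"
proof -
  have "\<exists>B\<ge>0. \<forall>z. (\<forall>i\<in>I. \<bar>z i\<bar> \<le> R) \<longrightarrow> \<bar>partial_deriv k F z\<bar> \<le> B" for k
    by (rule bounded_on_box[OF smooth_continuous[OF smooth_pd[OF F]] depends_on_pd[OF dep], where R = R]) blast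
  then obtain B where B: "\<And>k. B k \<ge> 0" "\<And>k z. (\<forall>i\<in>I. \<bar>z i\<bar> \<le> R) \<Longrightarrow> \<bar>partial_deriv k F z\<bar> \<le> B k"
    by metis
  define L where "L = (\<Sum>k\<in>I. B k)"
  have BL: "B k \<le> L" if "k \<in> I" for k
    unfolding L_def using \<open>finite I\<close> that B(1) by (intro member_le_sum) auto
  show ?thesis
  proof (rule that)
    show "L \<ge> 0" unfolding L_def using B(1) by (intro sum_nonneg)
    fix z z' :: "'i \<Rightarrow> real" assume z: "\<forall>i\<in>I. \<bar>z i\<bar> \<le> R" "\<forall>i\<in>I. \<bar>z' i\<bar> \<le> R"
    define c where "c s = (\<lambda>i. z' i + s * (z i - z' i))" for s
    have der: "((\<lambda>s. F (c s)) has_real_derivative (\<Sum>i\<in>I. partial_deriv i F (c s) * (z i - z' i))) (at s)" for s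
      by (rule chain_rule[OF \<open>finite I\<close> F dep]) (auto simp: c_def intro!: derivative_eq_intros)
    obtain \<xi> where \<xi>: "0 < \<xi>" "\<xi> < 1" "F (c 1) - F (c 0) = (\<Sum>i\<in>I. partial_deriv i F (c \<xi>) * (z i - z' i))"
      using MVT2[of 0 1 "\<lambda>s. F (c s)"] der by force
    have "\<bar>c \<xi> i\<bar> \<le> R" if "i \<in> I" for i
    proof -
      have "c \<xi> i = (1 - \<xi>) * z' i + \<xi> * z i" by (simp add: c_def algebra_simps)
      also have "\<bar>\<dots>\<bar> \<le> (1 - \<xi>) * \<bar>z' i\<bar> + \<xi> * \<bar>z i\<bar>"
        using \<xi> by (intro order.trans[OF abs_triangle_ineq]) (simp add: abs_mult)
      also have "\<dots> \<le> (1 - \<xi>) * R + \<xi> * R"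
        using \<xi> z that by (intro add_mono mult_left_mono) auto
      finally show ?thesis by (simp add: algebra_simps)
    qed
    then have "\<bar>partial_deriv i F (c \<xi>)\<bar> \<le> L" if "i \<in> I" for i
      using B(2)[of "c \<xi>" i] BL[OF that] by force
    then have "\<bar>\<Sum>i\<in>I. partial_deriv i F (c \<xi>) * (z i - z' i)\<bar> \<le> (\<Sum>i\<in>I. L * \<bar>z i - z' i\<bar>)"
      by (intro order.trans[OF sum_abs] sum_mono) (auto simp: abs_mult intro: mult_right_mono)
    then show "\<bar>F z - F z'\<bar> \<le> L * (\<Sum>i\<in>I. \<bar>z i - z' i\<bar>)"
      using \<xi>(3) by (simp add: c_def sum_distrib_left)
  qed
qed

section \<open>Scalar linear differential equations\<close>

text \<open>The integrating factor \<open>exp (k * t)\<close> turns the inequality into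
  monotonicity. The sign of \<open>k\<close> is free: the cascade uses positive gains, the Gronwall
  argument takes \<open>k = - L\<close>.\<close>

lemma nonneg_of_linear_ode:
  fixes z :: "real \<Rightarrow> real"
  assumes "a \<le> b" "continuous_on {a..b} z" "countable E" "z a \<ge> 0"
    and "\<And>t. a < t \<Longrightarrow> t < b \<Longrightarrow> t \<notin> E \<Longrightarrow> \<exists>D. (z has_real_derivative D) (at t) \<and> D \<ge> - k * z t"
  shows "z b \<ge> 0"
proof -
  have "exp (k * a) * z a \<le> exp (k * b) * z b"
  proof (rule le_off_countable[OF assms(1) _ assms(3)])
    show "continuous_on {a..b} (\<lambda>t. exp (k * t) * z t)"
      by (intro continuous_intros assms)
    fix t assume "a < t" "t < b" "t \<notin> E"
    then obtain D where D: "(z has_real_derivative D) (at t)" "D \<ge> - k * z t" using assms(5) by blast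
    have "((\<lambda>t. exp (k * t) * z t) has_real_derivative exp (k * t) * (D + k * z t)) (at t)"
      by (auto intro!: derivative_eq_intros D(1) simp: algebra_simps)
    moreover have "exp (k * t) * (D + k * z t) \<ge> 0" using D(2) by simp
    ultimately show "\<exists>D\<ge>0. ((\<lambda>t. exp (k * t) * z t) has_real_derivative D) (at t)" by blast
  qed
  moreover have "0 \<le> exp (k * a) * z a" using assms(4) by simp
  ultimately have "0 \<le> exp (k * b) * z b" by linarith
  then show ?thesis by (simp add: zero_le_mult_iff)
qed

section \<open>Calculus of exponential decay\<close>

lemma decays_exponentiallyE:
  assumes "decays_exponentially g" "\<kappa>0 > 0"
  obtains C \<kappa> where "C \<ge> 0" "\<kappa> > 0" "\<kappa> < \<kappa>0" "\<And>t. t \<ge> 0 \<Longrightarrow> \<bar>g t\<bar> \<le> C * exp (- \<kappa> * t)"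
proof -
  obtain C \<kappa> where C: "\<kappa> > 0" "\<And>t. t \<ge> 0 \<Longrightarrow> \<bar>g t\<bar> \<le> C * exp (- \<kappa> * t)"
    using assms unfolding decays_exponentially_def by blast
  have "C \<ge> 0" using C(2)[of 0] by simp
  \<comment> \<open>Lowering the rate below \<open>\<kappa>0\<close> lets sums share one rate and
    keeps the rate of a forcing term off the gain of a linear equation, where resonance would
    produce a factor \<open>t\<close>.\<close>
  define \<kappa>' where "\<kappa>' = min \<kappa> (\<kappa>0 / 2)"
  have k: "\<kappa>' > 0" "\<kappa>' < \<kappa>0" "\<kappa>' \<le> \<kappa>" using C(1) assms(2) by (auto simp: \<kappa>'_def)
  have "\<bar>g t\<bar> \<le> C * exp (- \<kappa>' * t)" if "t \<ge> 0" for t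
  proof -
    have "- \<kappa> * t \<le> - \<kappa>' * t" using k that by (simp add: mult_right_mono)
    then show ?thesis using C(2)[OF that] \<open>C \<ge> 0\<close>
      by (meson exp_le_cancel_iff mult_left_mono order.trans)
  qed
  then show ?thesis using that \<open>C \<ge> 0\<close> k by blast
qed

lemma decays_exponentiallyI:
  "\<kappa> > 0 \<Longrightarrow> (\<And>t. t \<ge> 0 \<Longrightarrow> \<bar>g t\<bar> \<le> C * exp (- \<kappa> * t)) \<Longrightarrow> decays_exponentially g"
  unfolding decays_exponentially_def by blast

lemma decays_exponentially_dominated:
  assumes "decays_exponentially g" "\<And>t. t \<ge> 0 \<Longrightarrow> \<bar>f t\<bar> \<le> L * \<bar>g t\<bar>" "L \<ge> 0"
  shows "decays_exponentially f"
proof -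
  obtain C \<kappa> where C: "\<kappa> > 0" "\<And>t. t \<ge> 0 \<Longrightarrow> \<bar>g t\<bar> \<le> C * exp (- \<kappa> * t)"
    using assms(1) unfolding decays_exponentially_def by blast
  have "\<bar>f t\<bar> \<le> (L * C) * exp (- \<kappa> * t)" if "t \<ge> 0" for t
    using assms(2)[OF that] mult_left_mono[OF C(2)[OF that] assms(3)] by (simp add: mult.assoc)
  then show ?thesis using C(1) by (rule decays_exponentiallyI[rotated])
qed

lemma decays_exponentially_zero: "(\<And>t. t \<ge> 0 \<Longrightarrow> g t = 0) \<Longrightarrow> decays_exponentially g"
  by (rule decays_exponentiallyI[of 1 _ 0]) auto

lemma decays_exponentially_add:
  assumes "decays_exponentially f" "decays_exponentially g"
  shows "decays_exponentially (\<lambda>t. f t + g t)"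
proof -
  obtain C \<kappa> where C: "C \<ge> 0" "\<kappa> > 0" "\<And>t. t \<ge> 0 \<Longrightarrow> \<bar>f t\<bar> \<le> C * exp (- \<kappa> * t)"
    using decays_exponentiallyE[OF assms(1) zero_less_one] by metis
  obtain C' \<kappa>' where C': "C' \<ge> 0" "\<kappa>' > 0" "\<kappa>' < \<kappa>" "\<And>t. t \<ge> 0 \<Longrightarrow> \<bar>g t\<bar> \<le> C' * exp (- \<kappa>' * t)"
    using decays_exponentiallyE[OF assms(2) C(2)] by metis
  show ?thesis
  proof (rule decays_exponentiallyI[OF C'(2)])
    fix t :: real assume t: "t \<ge> 0"
    have "- \<kappa> * t \<le> - \<kappa>' * t" using C' t by (simp add: mult_right_mono)
    then have "C * exp (- \<kappa> * t) \<le> C * exp (- \<kappa>' * t)" using C(1) by (intro mult_left_mono) auto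
    then show "\<bar>f t + g t\<bar> \<le> (C + C') * exp (- \<kappa>' * t)"
      using C(3)[OF t] C'(4)[OF t] by (simp add: distrib_right)
  qed
qed

lemma decays_exponentially_cmult:
  "decays_exponentially f \<Longrightarrow> decays_exponentially (\<lambda>t. c * f t)"
  by (erule decays_exponentially_dominated[where L = "\<bar>c\<bar>"]) (auto simp: abs_mult)

lemma decays_exponentially_abs:
  "decays_exponentially f \<Longrightarrow> decays_exponentially (\<lambda>t. \<bar>f t\<bar>)"
  by (erule decays_exponentially_dominated[where L = 1]) auto

lemma decays_exponentially_sum:
  "(\<And>i. i \<in> I \<Longrightarrow> decays_exponentially (f i)) \<Longrightarrow> decays_exponentially (\<lambda>t. \<Sum>i\<in>I. f i t)"
  by (induction I rule: infinite_finite_induct)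
    (auto intro: decays_exponentially_zero decays_exponentially_add)

lemma decays_exponentially_tendsto:
  assumes "decays_exponentially g" shows "(g \<longlongrightarrow> 0) at_top"
proof -
  obtain C \<kappa> where C: "\<kappa> > 0" "\<And>t. t \<ge> 0 \<Longrightarrow> \<bar>g t\<bar> \<le> C * exp (- \<kappa> * t)"
    using assms unfolding decays_exponentially_def by blast
  have "filterlim (\<lambda>t. - \<kappa> * t) at_bot at_top"
    using C(1) by (intro filterlim_tendsto_neg_mult_at_bot[OF tendsto_const]) (auto intro: filterlim_ident)
  then have "((\<lambda>t. exp (- \<kappa> * t)) \<longlongrightarrow> 0) at_top"
    by (rule filterlim_compose[OF exp_at_bot])
  then have "((\<lambda>t. C * exp (- \<kappa> * t)) \<longlongrightarrow> 0) at_top" by (rule tendsto_mult_right_zero)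
  then show ?thesis
    by (rule Lim_null_comparison[rotated])
      (use C(2) in \<open>auto intro!: eventually_mono[OF eventually_ge_at_top[of 0]]\<close>)
qed

text \<open>By continuity \<open>g\<close> is bounded on the compact initial interval, and a larger
  constant absorbs that bound.\<close>

lemma decays_exponentially_eventually_imp:
  assumes cont: "continuous_on {0..} g" and "\<kappa> > 0"
    and bd: "\<And>t. t \<ge> a \<Longrightarrow> \<bar>g t\<bar> \<le> C * exp (- \<kappa> * t)"
  shows "decays_exponentially g"
proof -
  have "compact (g ` {0..max a 0})"
    by (intro compact_continuous_image continuous_on_subset[OF cont]) auto
  then have "bounded (g ` {0..max a 0})" by (rule compact_imp_bounded)
  then obtain M where M: "\<And>t. t \<in> {0..max a 0} \<Longrightarrow> \<bar>g t\<bar> \<le> M"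
    by (auto simp: bounded_iff simp del: atLeastAtMost_iff)
  have M0: "M \<ge> 0" using M[of 0] by auto
  define C' where "C' = max C (M * exp (\<kappa> * max a 0))"
  show ?thesis
  proof (rule decays_exponentiallyI[OF \<open>\<kappa> > 0\<close>])
    fix t :: real assume t: "t \<ge> 0"
    show "\<bar>g t\<bar> \<le> C' * exp (- \<kappa> * t)"
    proof (cases "t \<ge> a")
      case True
      have "C * exp (- \<kappa> * t) \<le> C' * exp (- \<kappa> * t)" by (simp add: C'_def)
      then show ?thesis using bd[OF True] by linarith
    next
      case False
      then have "\<bar>g t\<bar> \<le> M" using M t by auto
      also have "M \<le> M * exp (\<kappa> * max a 0) * exp (- \<kappa> * t)"
      proof -
        have "0 \<le> \<kappa> * max a 0 + - \<kappa> * t" using False \<open>\<kappa> > 0\<close> by auto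
        then have "1 \<le> exp (\<kappa> * max a 0) * exp (- \<kappa> * t)" by (simp flip: exp_add)
        then show ?thesis using M0 by (metis mult.assoc mult.right_neutral mult_left_mono)
      qed
      also have "\<dots> \<le> C' * exp (- \<kappa> * t)" by (intro mult_right_mono) (auto simp: C'_def)
      finally show ?thesis .
    qed
  qed
qed

text \<open>After multiplication by \<open>exp (k * t)\<close> only the forcing remains, at most
  \<open>C * exp ((k - \<kappa>) * t)\<close>, and a primitive of this bound serves as a barrier.
  The sign \<open>\<sigma>\<close> treats both bounds at once. For the last error of the loop
  \<open>a\<close> is \<open>tf\<close>.\<close>

lemma decays_exponentially_linear_ode:
  fixes z :: "real \<Rightarrow> real"
  assumes cont: "continuous_on {0..} z" and E: "countable E" and k: "k > 0" and "a \<ge> 0"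
    and g: "decays_exponentially g"
    and der: "\<And>t. t > a \<Longrightarrow> t \<notin> E \<Longrightarrow> (z has_real_derivative - k * z t + g t) (at t)"
  shows "decays_exponentially z"
proof -
  obtain C \<kappa> where C: "C \<ge> 0" "\<kappa> > 0" "\<kappa> < k" "\<And>t. t \<ge> 0 \<Longrightarrow> \<bar>g t\<bar> \<le> C * exp (- \<kappa> * t)"
    using decays_exponentiallyE[OF g k] by metis
  \<comment> \<open>Makes the derivative of the barrier \<open>A * exp ((k - \<kappa>) * t)\<close>
    exactly the bound on the forcing.\<close>
  define A where "A = C / (k - \<kappa>)"
  have A: "A \<ge> 0" "A * (k - \<kappa>) = C" using C by (auto simp: A_def)
  have contab: "continuous_on {a..b} z" for b
    using \<open>a \<ge> 0\<close> by (intro continuous_on_subset[OF cont]) auto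
  have "\<sigma> * exp (k * t) * z t \<le> \<sigma> * exp (k * a) * z a + A * exp ((k - \<kappa>) * t)"
    if t: "t \<ge> a" and \<sigma>: "\<bar>\<sigma>\<bar> = 1" for t \<sigma>
  proof -
    have "A * exp ((k - \<kappa>) * a) - \<sigma> * exp (k * a) * z a \<le> A * exp ((k - \<kappa>) * t) - \<sigma> * exp (k * t) * z t"
    proof (rule le_off_countable[OF t _ E])
      show "continuous_on {a..t} (\<lambda>t. A * exp ((k - \<kappa>) * t) - \<sigma> * exp (k * t) * z t)"
        by (intro continuous_intros contab)
      fix r assume r: "a < r" "r < t" "r \<notin> E"
      have "((\<lambda>t. A * exp ((k - \<kappa>) * t) - \<sigma> * exp (k * t) * z t) has_real_derivative
          C * exp ((k - \<kappa>) * r) - \<sigma> * (exp (k * r) * g r)) (at r)"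
        by (auto intro!: derivative_eq_intros der r simp: algebra_simps simp flip: A(2))
      moreover have "\<sigma> * (exp (k * r) * g r) \<le> C * exp ((k - \<kappa>) * r)"
      proof -
        have "\<sigma> * (exp (k * r) * g r) \<le> \<bar>\<sigma> * (exp (k * r) * g r)\<bar>" by simp
        also have "\<dots> = exp (k * r) * \<bar>g r\<bar>" using \<sigma> by (simp add: abs_mult)
        also have "\<dots> \<le> exp (k * r) * (C * exp (- \<kappa> * r))"
          using C(4)[of r] r \<open>a \<ge> 0\<close> by (intro mult_left_mono) auto
        also have "\<dots> = C * exp ((k - \<kappa>) * r)" by (simp add: left_diff_distrib exp_diff exp_minus divide_inverse)
        finally show ?thesis .
      qed
      ultimately show "\<exists>D\<ge>0. ((\<lambda>t. A * exp ((k - \<kappa>) * t) - \<sigma> * exp (k * t) * z t) has_real_derivative D) (at r)"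
        by (metis diff_ge_0_iff_ge)
    qed
    moreover have "0 \<le> A * exp ((k - \<kappa>) * a)" using A by simp
    ultimately show ?thesis by linarith
  qed
  note bound = this
  have *: "exp (k * t) * \<bar>z t\<bar> \<le> exp (k * a) * \<bar>z a\<bar> + A * exp ((k - \<kappa>) * t)" if "t \<ge> a" for t
  proof -
    define \<sigma> where "\<sigma> = (if z t \<ge> 0 then 1 else - 1 :: real)"
    have "exp (k * t) * (\<sigma> * z t) = exp (k * t) * \<bar>z t\<bar>" by (auto simp: \<sigma>_def)
    moreover have "exp (k * a) * (\<sigma> * z a) \<le> exp (k * a) * \<bar>z a\<bar>"
      by (intro mult_left_mono) (auto simp: \<sigma>_def)
    moreover have "\<bar>\<sigma>\<bar> = 1" by (simp add: \<sigma>_def)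
    from bound[OF that this]
    have "exp (k * t) * (\<sigma> * z t) \<le> exp (k * a) * (\<sigma> * z a) + A * exp ((k - \<kappa>) * t)"
      by (simp only: mult.assoc mult.left_commute[of \<sigma>])
    ultimately show ?thesis by linarith
  qed
  show ?thesis
  proof (rule decays_exponentially_eventually_imp[OF cont \<open>\<kappa> > 0\<close>])
    fix t assume t: "t \<ge> a"
    have "\<bar>z t\<bar> = exp (- k * t) * (exp (k * t) * \<bar>z t\<bar>)" by (simp add: exp_minus)
    also have "\<dots> \<le> exp (- k * t) * (exp (k * a) * \<bar>z a\<bar> + A * exp ((k - \<kappa>) * t))"
      using *[OF t] by (intro mult_left_mono) auto
    also have "\<dots> = exp (k * a) * \<bar>z a\<bar> * exp (- k * t) + A * exp (- \<kappa> * t)"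
      by (simp add: distrib_left left_diff_distrib exp_diff exp_minus field_simps)
    also have "\<dots> \<le> exp (k * a) * \<bar>z a\<bar> * exp (- \<kappa> * t) + A * exp (- \<kappa> * t)"
      using C t \<open>a \<ge> 0\<close> by (intro add_right_mono mult_left_mono) (auto intro: mult_right_mono)
    finally show "\<bar>z t\<bar> \<le> (exp (k * a) * \<bar>z a\<bar> + A) * exp (- \<kappa> * t)"
      by (simp add: distrib_right)
  qed
qed

section \<open>Closure properties of dependence, and decay under composition\<close>

lemma depends_on_mono: "depends_on I F \<Longrightarrow> I \<subseteq> J \<Longrightarrow> depends_on J F"
  unfolding depends_on_def by blast

lemma depends_on_const [simp]: "depends_on I (\<lambda>z. c)"
  unfolding depends_on_def by simp

lemma depends_on_coord: "i \<in> I \<Longrightarrow> depends_on I (\<lambda>z. z i)"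
  unfolding depends_on_def by simp

lemma depends_on_add: "depends_on I F \<Longrightarrow> depends_on I G \<Longrightarrow> depends_on I (\<lambda>z. F z + G z)"
  unfolding depends_on_def by metis

lemma depends_on_diff: "depends_on I F \<Longrightarrow> depends_on I G \<Longrightarrow> depends_on I (\<lambda>z. F z - G z)"
  unfolding depends_on_def by metis

lemma depends_on_mult: "depends_on I F \<Longrightarrow> depends_on I G \<Longrightarrow> depends_on I (\<lambda>z. F z * G z)"
  unfolding depends_on_def by metis

lemma depends_on_sum:
  "(\<And>k. k \<in> K \<Longrightarrow> depends_on I (F k)) \<Longrightarrow> depends_on I (\<lambda>z. \<Sum>k\<in>K. F k z)"
  unfolding depends_on_def by (intro allI impI sum.cong) blast+

lemma depends_on_reindex:
  "depends_on A F \<Longrightarrow> \<sigma> ` A \<subseteq> I \<Longrightarrow> depends_on I (\<lambda>z. F (z \<circ> \<sigma>))"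
  unfolding depends_on_def by (auto simp: image_subset_iff)

lemmas depends_on_intros = depends_on_const depends_on_add depends_on_diff depends_on_mult depends_on_sum
lemmas smooth_intros = smooth_const smooth_coord smooth_add smooth_diff smooth_mult smooth_sum

text \<open>A decaying curve stays in some box, where \<open>F\<close> is Lipschitz; since
  \<open>F\<close> vanishes at the origin, its values are dominated by the sum of the
  components.\<close>

lemma decays_exponentially_compose:
  assumes "finite I" and F: "smooth (Suc 0) F" and dep: "depends_on I F" and "F (\<lambda>_. 0) = 0"
    and c: "\<And>i. i \<in> I \<Longrightarrow> decays_exponentially (\<lambda>t. c t i)"
  shows "decays_exponentially (\<lambda>t. F (c t))"
proof -
  have "\<exists>C\<ge>0. \<forall>t\<ge>0. \<bar>c t i\<bar> \<le> C" if i: "i \<in> I" for i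
  proof -
    obtain C \<kappa> where C: "C \<ge> 0" "\<kappa> > 0" "\<And>t. t \<ge> 0 \<Longrightarrow> \<bar>c t i\<bar> \<le> C * exp (- \<kappa> * t)"
      using decays_exponentiallyE[OF c[OF i] zero_less_one] by metis
    have "\<bar>c t i\<bar> \<le> C" if "t \<ge> 0" for t
      using C(3)[OF that] mult_left_mono[of "exp (- \<kappa> * t)" 1 C] C(1,2) that by (auto intro: order.trans)
    then show ?thesis using C(1) by blast
  qed
  then obtain C where C: "\<And>i. i \<in> I \<Longrightarrow> C i \<ge> 0" "\<And>i t. i \<in> I \<Longrightarrow> t \<ge> 0 \<Longrightarrow> \<bar>c t i\<bar> \<le> C i"
    by metis
  define R where "R = (\<Sum>i\<in>I. C i)"
  have R: "C i \<le> R" if "i \<in> I" for i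
    unfolding R_def using \<open>finite I\<close> that C(1) by (intro member_le_sum) auto
  have R': "\<bar>c t i\<bar> \<le> R" if "i \<in> I" "t \<ge> 0" for i t
    using R[OF that(1)] C(2)[OF that] by linarith
  have R0: "R \<ge> 0" unfolding R_def using C(1) by (intro sum_nonneg)
  obtain L where L: "L \<ge> 0" "\<And>z z'. (\<forall>i\<in>I. \<bar>z i\<bar> \<le> R) \<Longrightarrow> (\<forall>i\<in>I. \<bar>z' i\<bar> \<le> R)
      \<Longrightarrow> \<bar>F z - F z'\<bar> \<le> L * (\<Sum>i\<in>I. \<bar>z i - z' i\<bar>)"
    using lipschitz_on_box[OF assms(1) F dep, where R = R] by metis
  show ?thesis
  proof (rule decays_exponentially_dominated[where g = "\<lambda>t. \<Sum>i\<in>I. \<bar>c t i\<bar>" and L = L])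
    show "decays_exponentially (\<lambda>t. \<Sum>i\<in>I. \<bar>c t i\<bar>)"
      by (intro decays_exponentially_sum decays_exponentially_abs c)
    fix t :: real assume "t \<ge> 0"
    then have "\<bar>F (c t) - F (\<lambda>_. 0)\<bar> \<le> L * (\<Sum>i\<in>I. \<bar>c t i - 0\<bar>)"
      using R' R0 by (intro L(2)) auto
    then show "\<bar>F (c t)\<bar> \<le> L * \<bar>\<Sum>i\<in>I. \<bar>c t i\<bar>\<bar>" using assms(4) by simp
  qed (rule L(1))
qed

section \<open>One backstepping chain\<close>

definition uncurry2 :: "((nat \<Rightarrow> real) \<Rightarrow> (nat \<Rightarrow> real) \<Rightarrow> real) \<Rightarrow> (nat + nat \<Rightarrow> real) \<Rightarrow> real" where
  "uncurry2 H z = H (z \<circ> Inl) (z \<circ> Inr)"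

lemma uncurry2_case_sum [simp]: "uncurry2 H (case_sum y w) = H y w"
  by (simp add: uncurry2_def case_sum_o_inj)

lemma upd_Inl_Inl: "(z(Inl k := v)) \<circ> Inl = (z \<circ> Inl)(k := v)"
  and upd_Inl_Inr: "(z(Inl k := v)) \<circ> Inr = z \<circ> Inr"
  and upd_Inr_Inr: "(z(Inr k := v)) \<circ> Inr = (z \<circ> Inr)(k := v)"
  and upd_Inr_Inl: "(z(Inr k := v)) \<circ> Inl = z \<circ> Inl"
  by (auto simp: fun_eq_iff)

lemma partial_Inl: "partial k (\<lambda>y. H y (z \<circ> Inr)) (z \<circ> Inl) = partial_deriv (Inl k) (uncurry2 H) z"
  and partial_Inr: "partial k (\<lambda>w. H (z \<circ> Inl) w) (z \<circ> Inr) = partial_deriv (Inr k) (uncurry2 H) z"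
  by (simp_all add: partial_def partial_deriv_def uncurry2_def upd_Inl_Inl upd_Inl_Inr upd_Inr_Inr upd_Inr_Inl)

lemma along_uncurry2:
  "along g i H (z \<circ> Inl) (z \<circ> Inr) =
    (\<Sum>k=1..i. partial_deriv (Inl k) (uncurry2 H) z * (z (Inl (k + 1)) + g k (z \<circ> Inl))
       + partial_deriv (Inr (k - 1)) (uncurry2 H) z * z (Inr k))"
  by (simp add: along_def partial_Inl partial_Inr)

text \<open>
  The common recursion behind \<open>hfun\<close> (with \<open>\<beta> = 1\<close>) and \<open>tau\<close> (with \<open>\<beta>\<close> the input coefficient).
\<close>

primrec virtual_control :: "(nat \<Rightarrow> real) \<Rightarrow> real \<Rightarrow> (nat \<Rightarrow> (nat \<Rightarrow> real) \<Rightarrow> real) \<Rightarrow> nat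
    \<Rightarrow> (nat \<Rightarrow> real) \<Rightarrow> (nat \<Rightarrow> real) \<Rightarrow> real" where
  "virtual_control \<kappa> \<beta> g 0 = (\<lambda>y w. 0)"
| "virtual_control \<kappa> \<beta> g (Suc i) = (\<lambda>y w.
     - \<kappa> (Suc i) * (\<beta> * y (Suc i) - virtual_control \<kappa> \<beta> g i y w - w i)
     - \<beta> * g (Suc i) y + along g i (virtual_control \<kappa> \<beta> g i) y w)"

lemma hfun_virt: "hfun p d i = virtual_control (kgain d) 1 (psi p) i"
  by (induction i) auto

lemma tau_virt: "tau p d j = virtual_control (cgain d) (bcoef p) (phi p) j"
  by (induction j) auto

text \<open>
  The Y-chain has \<open>e\<close> = number of X-states, because its virtual controls are differentiated further
  along the X-chain, which itself has \<open>e = 0\<close>.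
\<close>

locale chain =
  fixes \<kappa> :: "nat \<Rightarrow> real" and \<beta> :: real and g :: "nat \<Rightarrow> (nat \<Rightarrow> real) \<Rightarrow> real" and N e :: nat
  assumes \<beta>: "\<beta> \<noteq> 0"
    and g_depends: "\<And>i. i \<in> {1..N} \<Longrightarrow> depends_on {1..i} (g i)"
    and g_smooth: "\<And>i. i \<in> {1..N} \<Longrightarrow> smooth (N + e - i) (g i)"
    and g_zero: "\<And>i. i \<in> {1..N} \<Longrightarrow> g i (\<lambda>_. 0) = 0"
begin

abbreviation "H i \<equiv> virtual_control \<kappa> \<beta> g i"

text \<open>This is z_i for the Y-chain, with \<open>w\<close> the jet of \<open>s\<close>, and r_j
  for the X-chain, with \<open>w\<close> the jet of Delta.\<close>

definition err :: "nat \<Rightarrow> (nat \<Rightarrow> real) \<Rightarrow> (nat \<Rightarrow> real) \<Rightarrow> real" where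
  "err i y w = \<beta> * y i - H (i - 1) y w - w (i - 1)"

lemma uncurry2_virt_Suc:
  "uncurry2 (H (Suc i)) = (\<lambda>z.
     - \<kappa> (Suc i) * (\<beta> * z (Inl (Suc i)) - uncurry2 (H i) z - z (Inr i))
     - \<beta> * g (Suc i) (z \<circ> Inl)
     + (\<Sum>k=1..i. partial_deriv (Inl k) (uncurry2 (H i)) z * (z (Inl (k + 1)) + g k (z \<circ> Inl))
       + partial_deriv (Inr (k - 1)) (uncurry2 (H i)) z * z (Inr k)))"
proof
  fix z
  note al = along_uncurry2[of g i "H i" z]
  show "uncurry2 (H (Suc i)) z =
     - \<kappa> (Suc i) * (\<beta> * z (Inl (Suc i)) - uncurry2 (H i) z - z (Inr i))
     - \<beta> * g (Suc i) (z \<circ> Inl)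
     + (\<Sum>k=1..i. partial_deriv (Inl k) (uncurry2 (H i)) z * (z (Inl (k + 1)) + g k (z \<circ> Inl))
       + partial_deriv (Inr (k - 1)) (uncurry2 (H i)) z * z (Inr k))"
    unfolding al[symmetric] by (simp add: uncurry2_def)
qed

text \<open>Each step differentiates the previous virtual control once, so exactly one order is lost
  per index, in pace with the decreasing orders granted to \<open>g\<close>. The \<open>e\<close>
  orders left at \<open>i = N\<close> are reserved for the derivatives of Delta.\<close>

lemma virt_regular:
  "i \<le> N \<Longrightarrow> smooth (N + e - i) (uncurry2 (H i)) \<and> depends_on ({1..i} <+> {..<i}) (uncurry2 (H i))"
proof (induction i)
  case 0
  then show ?case by (simp add: uncurry2_def[abs_def])
next
  case (Suc i)
  have le: "N + e - i = Suc (N + e - Suc i)" using Suc.prems by simp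
  have sm: "smooth (Suc (N + e - Suc i)) (uncurry2 (H i))"
    and dep: "depends_on ({1..i} <+> {..<i}) (uncurry2 (H i))" using Suc le by auto
  have dep': "depends_on ({1..Suc i} <+> {..<Suc i}) (uncurry2 (H i))"
    by (rule depends_on_mono[OF dep]) auto
  have gs: "smooth (N + e - Suc i) (\<lambda>z. g k (z \<circ> Inl))" if "k \<in> {1..Suc i}" for k
    using that Suc.prems by (intro smooth_reindex smooth_mono[OF g_smooth]) auto
  have gd: "depends_on ({1..Suc i} <+> {..<Suc i}) (\<lambda>z. g k (z \<circ> Inl))" if "k \<in> {1..Suc i}" for k
    using that Suc.prems by (intro depends_on_reindex[OF g_depends]) auto
  have "smooth (N + e - Suc i) (uncurry2 (H (Suc i)))"
    unfolding uncurry2_virt_Suc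
    by (intro smooth_intros gs smooth_Suc_imp[OF sm] smooth_pd[OF sm]) auto
  moreover have "depends_on ({1..Suc i} <+> {..<Suc i}) (uncurry2 (H (Suc i)))"
    unfolding uncurry2_virt_Suc
    by (intro depends_on_intros depends_on_coord gd dep' depends_on_pd[OF dep']) auto
  ultimately show ?case by blast
qed

lemma virt_zero: "i \<le> N \<Longrightarrow> H i (\<lambda>_. 0) (\<lambda>_. 0) = 0"
proof (induction i)
  case (Suc i)
  have "along g i (H i) (\<lambda>_. 0) (\<lambda>_. 0) = 0"
    unfolding along_def using Suc.prems g_zero by (intro sum.neutral) auto
  then show ?case using Suc g_zero[of "Suc i"] by simp
qed simp

lemma virt_has_derivative:
  assumes i: "i < N + e" "i \<le> N"
    and y: "\<And>k. k \<in> {1..i} \<Longrightarrow> ((\<lambda>t. y t k) has_real_derivative y t (k + 1) + g k (y t)) (at t)"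
    and w: "\<And>k. k < i \<Longrightarrow> ((\<lambda>t. w t k) has_real_derivative w t (k + 1)) (at t)"
  shows "((\<lambda>t. H i (y t) (w t)) has_real_derivative along g i (H i) (y t) (w t)) (at t)"
proof -
  have sm: "smooth (Suc 0) (uncurry2 (H i))" and dep: "depends_on ({1..i} <+> {..<i}) (uncurry2 (H i))"
    using virt_regular[OF i(2)] i(1) by (auto intro: smooth_mono simp del: smooth.simps(2))
  let ?c = "\<lambda>t. case_sum (y t) (w t)"
  let ?c' = "case_sum (\<lambda>k. y t (k + 1) + g k (y t)) (\<lambda>k. w t (k + 1))"
  have "((\<lambda>t. uncurry2 (H i) (?c t)) has_real_derivative
      (\<Sum>k\<in>{1..i} <+> {..<i}. partial_deriv k (uncurry2 (H i)) (?c t) * ?c' k)) (at t)"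
    by (rule chain_rule[OF _ sm dep]) (use y w in auto)
  moreover have "along g i (H i) (?c t \<circ> Inl) (?c t \<circ> Inr) =
      (\<Sum>k\<in>{1..i} <+> {..<i}. partial_deriv k (uncurry2 (H i)) (?c t) * ?c' k)"
    unfolding along_uncurry2
    by (simp add: sum.Plus sum.distrib comp_def sum.atLeast1_atMost_eq)
  ultimately show ?thesis by (simp add: case_sum_o_inj)
qed

text \<open>\<open>virtual_control\<close> is designed for this: in
  \<open>\<beta> * y (i + 1)\<close>, written as next error plus \<open>H i\<close> plus
  \<open>w i\<close>, the terms with \<open>g\<close> and \<open>along\<close> cancel the drift and
  the derivative of the previous virtual control.\<close>

lemma err_has_derivative:
  assumes i: "1 \<le> i" "i < N"
    and y: "\<And>k. k \<in> {1..i} \<Longrightarrow> ((\<lambda>t. y t k) has_real_derivative y t (k + 1) + g k (y t)) (at t)"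
    and w: "\<And>k. k < i \<Longrightarrow> ((\<lambda>t. w t k) has_real_derivative w t (k + 1)) (at t)"
  shows "((\<lambda>t. err i (y t) (w t)) has_real_derivative
      - \<kappa> i * err i (y t) (w t) + err (Suc i) (y t) (w t)) (at t)"
proof -
  obtain j where j: "i = Suc j" using i by (cases i) auto
  have "((\<lambda>t. err i (y t) (w t)) has_real_derivative
      \<beta> * (y t (i + 1) + g i (y t)) - along g j (H j) (y t) (w t) - w t i) (at t)"
    unfolding err_def j diff_Suc_1
    by (intro DERIV_diff DERIV_cmult virt_has_derivative) (use y w i j in force)+
  moreover have "- \<kappa> i * err i (y t) (w t) + err (Suc i) (y t) (w t) =
      \<beta> * (y t (i + 1) + g i (y t)) - along g j (H j) (y t) (w t) - w t i"
    unfolding err_def j by (simp add: algebra_simps)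
  ultimately show ?thesis by (simp only:)
qed

text \<open>The input \<open>v\<close> stays arbitrary, so a mismatch remains. For the Y-chain it is
  the first error of the X-chain; for the X-chain it measures the deviation of the applied law from
  the nominal one.\<close>

lemma err_last_has_derivative:
  assumes N: "1 \<le> N"
    and y: "\<And>k. k \<in> {1..<N} \<Longrightarrow> ((\<lambda>t. y t k) has_real_derivative y t (k + 1) + g k (y t)) (at t)"
    and yN: "((\<lambda>t. y t N) has_real_derivative g N (y t) + v) (at t)"
    and w: "\<And>k. k < N \<Longrightarrow> ((\<lambda>t. w t k) has_real_derivative w t (k + 1)) (at t)"
  shows "((\<lambda>t. err N (y t) (w t)) has_real_derivative
      - \<kappa> N * err N (y t) (w t) + (\<beta> * v - H N (y t) (w t) - w t N)) (at t)"
proof -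
  obtain j where j: "N = Suc j" using N by (cases N) auto
  have "((\<lambda>t. err N (y t) (w t)) has_real_derivative
      \<beta> * (g N (y t) + v) - along g j (H j) (y t) (w t) - w t N) (at t)"
    unfolding err_def j diff_Suc_1
    using y yN w by (intro DERIV_diff DERIV_cmult virt_has_derivative) (use j in force)+
  moreover have "- \<kappa> N * err N (y t) (w t) + (\<beta> * v - H N (y t) (w t) - w t N) =
      \<beta> * (g N (y t) + v) - along g j (H j) (y t) (w t) - w t N"
    unfolding err_def j by (simp add: algebra_simps)
  ultimately show ?thesis by (simp only:)
qed

text \<open>The next error equals \<open>\<kappa> i * err i y w\<close> minus the numerator of the
  threshold, so the threshold is the gain at which it would vanish.\<close>

lemma err_Suc_pos:
  assumes "1 \<le> i" "err i y w > 0"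
    and "\<kappa> i > (- \<beta> * y (i + 1) - \<beta> * g i y + w i + along g (i - 1) (H (i - 1)) y w) / err i y w"
  shows "err (Suc i) y w > 0"
proof -
  obtain j where j: "i = Suc j" using assms by (cases i) auto
  have "- \<beta> * y (i + 1) - \<beta> * g i y + w i + along g (i - 1) (H (i - 1)) y w < \<kappa> i * err i y w"
    using assms(2,3) by (simp add: divide_less_eq)
  then show ?thesis by (simp add: err_def j algebra_simps)
qed

lemma virt_continuous:
  assumes "i \<le> N" "\<And>k. k \<in> {1..i} \<Longrightarrow> continuous_on S (\<lambda>t. y t k)" "\<And>k. k < i \<Longrightarrow> continuous_on S (\<lambda>t. w t k)"
  shows "continuous_on S (\<lambda>t. H i (y t) (w t))"
proof -
  have "continuous_on S (\<lambda>t. uncurry2 (H i) (case_sum (y t) (w t)))"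
  proof (rule continuous_on_depends[where F = "uncurry2 (H i)" and c = "\<lambda>t. case_sum (y t) (w t)"
        and I = "{1..i} <+> {..<i}"])
    show "continuous_on UNIV (uncurry2 (H i))"
      by (rule smooth_continuous[OF conjunct1[OF virt_regular[OF assms(1)]]])
    show "depends_on ({1..i} <+> {..<i}) (uncurry2 (H i))"
      by (rule conjunct2[OF virt_regular[OF assms(1)]])
    show "continuous_on S (\<lambda>t. case_sum (y t) (w t) k)" if "k \<in> {1..i} <+> {..<i}" for k
      using that assms(2,3) by (cases k) auto
  qed
  then show ?thesis by simp
qed

lemma err_continuous:
  assumes "1 \<le> i" "i \<le> N" "\<And>k. k \<in> {1..i} \<Longrightarrow> continuous_on S (\<lambda>t. y t k)"
    "\<And>k. k < i \<Longrightarrow> continuous_on S (\<lambda>t. w t k)"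
  shows "continuous_on S (\<lambda>t. err i (y t) (w t))"
  unfolding err_def
  by (intro continuous_on_diff continuous_on_mult continuous_on_const virt_continuous assms) (use assms in auto)

lemma state_eq: "y i = (err i y w + H (i - 1) y w + w (i - 1)) / \<beta>"
  using \<beta> by (simp add: err_def)

text \<open>The change of variables is triangular: \<open>y i\<close> is recovered from its error
  and a virtual control of the earlier components. \<open>B\<close> is chosen before
  \<open>y\<close> and \<open>w\<close>, hence depends on the radius only.\<close>

lemma state_bounded:
  "n \<le> N \<Longrightarrow> \<exists>B\<ge>0. \<forall>y w. (\<forall>i\<in>{1..n}. \<bar>err i y w\<bar> \<le> R) \<longrightarrow> (\<forall>k<n. \<bar>w k\<bar> \<le> R)
     \<longrightarrow> (\<forall>i\<in>{1..n}. \<bar>y i\<bar> \<le> B)"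
proof (induction n)
  case 0
  show ?case by (rule exI[of _ 0]) simp
next
  case (Suc n)
  then obtain B where B: "B \<ge> 0" "\<And>y w i. (\<forall>i\<in>{1..n}. \<bar>err i y w\<bar> \<le> R) \<Longrightarrow> (\<forall>k<n. \<bar>w k\<bar> \<le> R)
      \<Longrightarrow> i \<in> {1..n} \<Longrightarrow> \<bar>y i\<bar> \<le> B" by (auto 0 3)
  obtain M where M: "M \<ge> 0"
    "\<And>z. (\<forall>i\<in>{1..n} <+> {..<n}. \<bar>z i\<bar> \<le> max B R) \<Longrightarrow> \<bar>uncurry2 (H n) z\<bar> \<le> M"
    by (rule bounded_on_box[where F = "uncurry2 (H n)" and R = "max B R"])
      (use virt_regular[of n] Suc.prems in \<open>auto intro: smooth_continuous\<close>)
  define B' where "B' = max B ((\<bar>R\<bar> + M + \<bar>R\<bar>) / \<bar>\<beta>\<bar>)"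
  show ?case
  proof (intro exI[of _ B'] conjI allI impI ballI)
    show "B' \<ge> 0" using B(1) by (simp add: B'_def)
    fix y w i assume yw: "\<forall>i\<in>{1..Suc n}. \<bar>err i y w\<bar> \<le> R" "\<forall>k<Suc n. \<bar>w k\<bar> \<le> R" and i: "i \<in> {1..Suc n}"
    then have yw': "\<forall>i\<in>{1..n}. \<bar>err i y w\<bar> \<le> R" "\<forall>k<n. \<bar>w k\<bar> \<le> R" by auto
    show "\<bar>y i\<bar> \<le> B'"
    proof (cases "i = Suc n")
      case True
      have "\<bar>uncurry2 (H n) (case_sum y w)\<bar> \<le> M"
      proof (rule M(2), rule ballI)
        fix k assume "k \<in> {1..n} <+> {..<n}"
        then show "\<bar>case_sum y w k\<bar> \<le> max B R"
          using B(2)[OF yw'] yw' by (auto simp: le_max_iff_disj)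
      qed
      moreover have "\<bar>err i y w\<bar> \<le> R" "\<bar>w n\<bar> \<le> R" using yw True by auto
      ultimately have "\<bar>err i y w + H n y w + w n\<bar> \<le> \<bar>R\<bar> + M + \<bar>R\<bar>" by simp
      then have "\<bar>(err i y w + H n y w + w n) / \<beta>\<bar> \<le> (\<bar>R\<bar> + M + \<bar>R\<bar>) / \<bar>\<beta>\<bar>"
        by (simp add: divide_right_mono abs_divide)
      then show ?thesis using state_eq[of y i w] True by (simp add: B'_def)
    next
      case False
      then have "\<bar>y i\<bar> \<le> B" using i by (intro B(2)[OF yw']) auto
      then show ?thesis by (simp add: B'_def)
    qed
  qed
qed

text \<open>The same triangular inversion; at index \<open>i\<close> the virtual control of order
  \<open>i - 1\<close> still has a derivative left and vanishes at the origin, so decay passes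
  through it.\<close>

lemma state_decays:
  "n \<le> N \<Longrightarrow> (\<And>i. i \<in> {1..n} \<Longrightarrow> decays_exponentially (\<lambda>t. err i (y t) (w t)))
    \<Longrightarrow> (\<And>k. k < n \<Longrightarrow> decays_exponentially (\<lambda>t. w t k))
    \<Longrightarrow> i \<in> {1..n} \<Longrightarrow> decays_exponentially (\<lambda>t. y t i)"
proof (induction i rule: less_induct)
  case (less i)
  then obtain j where j: "i = Suc j" by (cases i) auto
  have "decays_exponentially (\<lambda>t. uncurry2 (H j) (case_sum (y t) (w t)))"
  proof (rule decays_exponentially_compose[where I = "{1..j} <+> {..<j}" and F = "uncurry2 (H j)"
        and c = "\<lambda>t. case_sum (y t) (w t)"])
    show "smooth (Suc 0) (uncurry2 (H j))"
      using virt_regular[of j] less.prems j by (auto intro: smooth_mono simp del: smooth.simps(2))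
    show "depends_on ({1..j} <+> {..<j}) (uncurry2 (H j))" using virt_regular[of j] less.prems j by auto
    show "uncurry2 (H j) (\<lambda>_. 0) = 0" using virt_zero[of j] less.prems j by (simp add: uncurry2_def comp_def)
    show "decays_exponentially (\<lambda>t. case_sum (y t) (w t) k)" if "k \<in> {1..j} <+> {..<j}" for k
      using that less j by auto
  qed auto
  then have "decays_exponentially (\<lambda>t. (1 / \<beta>) * (err i (y t) (w t) + H j (y t) (w t) + w t j))"
    using less.prems j by (intro decays_exponentially_cmult decays_exponentially_add) auto
  then show ?case using state_eq[of "y _" i "w _"] j by simp
qed

end

section \<open>The derivatives of Delta\<close>

lemma Ck_regular:
  "function_of_first N F \<Longrightarrow> Ck N r F \<Longrightarrow> smooth r F \<and> depends_on {1..N} F"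
  using Ck_imp_smooth unfolding function_of_first_def depends_on_def by blast

definition uncurry3 ::
  "((nat \<Rightarrow> real) \<Rightarrow> (nat \<Rightarrow> real) \<Rightarrow> (nat \<Rightarrow> real) \<Rightarrow> real) \<Rightarrow> (nat + nat + nat \<Rightarrow> real) \<Rightarrow> real" where
  "uncurry3 H z = H (z \<circ> Inl) (z \<circ> (Inr \<circ> Inl)) (z \<circ> (Inr \<circ> Inr))"

lemma uncurry3_case_sum [simp]: "uncurry3 H (case_sum P (case_sum X w)) = H P X w"
  by (simp add: uncurry3_def comp_def)

lemma partial3:
  "partial k (\<lambda>P. H P (z \<circ> (Inr \<circ> Inl)) (z \<circ> (Inr \<circ> Inr))) (z \<circ> Inl) = partial_deriv (Inl k) (uncurry3 H) z"
  "partial k (\<lambda>X. H (z \<circ> Inl) X (z \<circ> (Inr \<circ> Inr))) (z \<circ> (Inr \<circ> Inl)) = partial_deriv (Inr (Inl k)) (uncurry3 H) z"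
  "partial k (\<lambda>w. H (z \<circ> Inl) (z \<circ> (Inr \<circ> Inl)) w) (z \<circ> (Inr \<circ> Inr)) = partial_deriv (Inr (Inr k)) (uncurry3 H) z"
proof -
  have "(z(Inl k := v)) \<circ> Inl = (z \<circ> Inl)(k := v)" "(z(Inl k := v)) \<circ> (Inr \<circ> Inl) = z \<circ> (Inr \<circ> Inl)"
    "(z(Inl k := v)) \<circ> (Inr \<circ> Inr) = z \<circ> (Inr \<circ> Inr)"
    "(z(Inr (Inl k) := v)) \<circ> Inl = z \<circ> Inl"
    "(z(Inr (Inl k) := v)) \<circ> (Inr \<circ> Inl) = (z \<circ> (Inr \<circ> Inl))(k := v)"
    "(z(Inr (Inl k) := v)) \<circ> (Inr \<circ> Inr) = z \<circ> (Inr \<circ> Inr)"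
    "(z(Inr (Inr k) := v)) \<circ> Inl = z \<circ> Inl"
    "(z(Inr (Inr k) := v)) \<circ> (Inr \<circ> Inl) = z \<circ> (Inr \<circ> Inl)"
    "(z(Inr (Inr k) := v)) \<circ> (Inr \<circ> Inr) = (z \<circ> (Inr \<circ> Inr))(k := v)" for v
    by (auto simp: fun_eq_iff)
  then show
    "partial k (\<lambda>P. H P (z \<circ> (Inr \<circ> Inl)) (z \<circ> (Inr \<circ> Inr))) (z \<circ> Inl) = partial_deriv (Inl k) (uncurry3 H) z"
    "partial k (\<lambda>X. H (z \<circ> Inl) X (z \<circ> (Inr \<circ> Inr))) (z \<circ> (Inr \<circ> Inl)) = partial_deriv (Inr (Inl k)) (uncurry3 H) z"
    "partial k (\<lambda>w. H (z \<circ> Inl) (z \<circ> (Inr \<circ> Inl)) w) (z \<circ> (Inr \<circ> Inr)) = partial_deriv (Inr (Inr k)) (uncurry3 H) z"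
    unfolding partial_def partial_deriv_def uncurry3_def by (simp_all only: comp_apply)
qed

locale backstepping =
  fixes p :: plant and d :: design
  assumes ny: "1 \<le> ny p" and nx: "1 \<le> nx p" and bcoef: "bcoef p \<noteq> 0" and smooth_p: "smooth_plant p"
begin

lemma psi_regular:
  assumes "i \<in> {1..ny p}"
  shows "smooth (ny p + nx p - i) (psi p i)" "depends_on {1..i} (psi p i)" "psi p i (\<lambda>_. 0) = 0"
  using smooth_p assms Ck_regular unfolding smooth_plant_def by blast+

lemma phi_regular:
  assumes "j \<in> {1..nx p}"
  shows "smooth (nx p - j) (phi p j)" "depends_on {1..j} (phi p j)" "phi p j (\<lambda>_. 0) = 0"
  using smooth_p assms Ck_regular unfolding smooth_plant_def by blast+

sublocale Y: chain "kgain d" 1 "psi p" "ny p" "nx p"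
  by standard (use psi_regular in auto)

sublocale X: chain "cgain d" "bcoef p" "phi p" "nx p" 0
  by standard (use phi_regular bcoef in auto)

lemma uncurry3_Delta_0:
  "uncurry3 (Delta p d 0) = (\<lambda>z. uncurry2 (Y.H (ny p)) (z \<circ> case_sum Inl (Inr \<circ> Inr)) + z (Inr (Inr (ny p))))"
  by (simp add: fun_eq_iff uncurry3_def uncurry2_def hfun_virt comp_assoc case_sum_o_inj)

lemma uncurry3_Delta_Suc:
  "uncurry3 (Delta p d (Suc j)) = (\<lambda>z.
     (\<Sum>i=1..ny p. partial_deriv (Inl i) (uncurry3 (Delta p d j)) z *
        (if i < ny p then z (Inl (i + 1)) + psi p i (z \<circ> Inl) else psi p i (z \<circ> Inl) + bcoef p * z (Inr (Inl 1))))
   + (\<Sum>l=1..j. partial_deriv (Inr (Inl l)) (uncurry3 (Delta p d j)) z * (z (Inr (Inl (l + 1))) + phi p l (z \<circ> (Inr \<circ> Inl))))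
   + (\<Sum>k=0..ny p + j. partial_deriv (Inr (Inr k)) (uncurry3 (Delta p d j)) z * z (Inr (Inr (k + 1)))))"
proof
  fix z
  show "uncurry3 (Delta p d (Suc j)) z =
     (\<Sum>i=1..ny p. partial_deriv (Inl i) (uncurry3 (Delta p d j)) z *
        (if i < ny p then z (Inl (i + 1)) + psi p i (z \<circ> Inl) else psi p i (z \<circ> Inl) + bcoef p * z (Inr (Inl 1))))
   + (\<Sum>l=1..j. partial_deriv (Inr (Inl l)) (uncurry3 (Delta p d j)) z * (z (Inr (Inl (l + 1))) + phi p l (z \<circ> (Inr \<circ> Inl))))
   + (\<Sum>k=0..ny p + j. partial_deriv (Inr (Inr k)) (uncurry3 (Delta p d j)) z * z (Inr (Inr (k + 1))))"
    unfolding partial3[where H = "Delta p d j" and z = z, symmetric] by (simp add: uncurry3_def fY_def cong: if_cong)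
qed

text \<open>Delta starts with the \<open>nx p\<close> orders that the Y-chain leaves over, and every
  time derivative costs one, so order \<open>nx p\<close> is still continuous. Each differentiation
  along the dynamics also brings in one more component of \<open>X\<close> and of the jet.\<close>

lemma Delta_regular:
  "j \<le> nx p \<Longrightarrow> smooth (nx p - j) (uncurry3 (Delta p d j)) \<and>
     depends_on ({1..ny p} <+> {1..j} <+> {..ny p + j}) (uncurry3 (Delta p d j))"
proof (induction j)
  case 0
  have inj: "inj (case_sum Inl (Inr \<circ> Inr) :: nat + nat \<Rightarrow> nat + nat + nat)"
    by (auto simp: inj_def split: sum.splits)
  have "smooth (nx p) (uncurry2 (Y.H (ny p)))"
    and "depends_on ({1..ny p} <+> {..<ny p}) (uncurry2 (Y.H (ny p)))"
    using Y.virt_regular[of "ny p"] by simp_all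
  then show ?case
    unfolding uncurry3_Delta_0 diff_zero
    by (intro conjI smooth_intros smooth_reindex inj depends_on_intros depends_on_coord
        depends_on_reindex[where A = "{1..ny p} <+> {..<ny p}"]) auto
next
  case (Suc j)
  let ?I = "{1..ny p} <+> {1..Suc j} <+> {..ny p + Suc j}"
  let ?r = "nx p - Suc j"
  have le: "nx p - j = Suc ?r" using Suc.prems by simp
  have sm: "smooth (Suc ?r) (uncurry3 (Delta p d j))" using Suc le by simp
  have dep: "depends_on ?I (uncurry3 (Delta p d j))"
    by (rule depends_on_mono[of "{1..ny p} <+> {1..j} <+> {..ny p + j}"]) (use Suc in auto)
  have sp: "smooth ?r (\<lambda>z. psi p i (z \<circ> Inl))" if "i \<in> {1..ny p}" for i
    using that by (intro smooth_reindex smooth_mono[OF psi_regular(1)]) auto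
  have dp: "depends_on ?I (\<lambda>z. psi p i (z \<circ> Inl))" if "i \<in> {1..ny p}" for i
    using that by (intro depends_on_reindex[OF psi_regular(2)]) auto
  have inj: "inj (Inr \<circ> Inl :: nat \<Rightarrow> nat + nat + nat)" by (auto simp: inj_def)
  have sf: "smooth ?r (\<lambda>z. phi p l (z \<circ> (Inr \<circ> Inl :: nat \<Rightarrow> nat + nat + nat)))" if "l \<in> {1..j}" for l
    using that Suc.prems by (intro smooth_reindex inj smooth_mono[OF phi_regular(1)]) auto
  have df: "depends_on ?I (\<lambda>z. phi p l (z \<circ> (Inr \<circ> Inl)))" if "l \<in> {1..j}" for l
    using that Suc.prems by (intro depends_on_reindex[OF phi_regular(2)]) auto
  have sfY: "smooth ?r (\<lambda>z. if i < ny p then z (Inl (i + 1)) + psi p i (z \<circ> Inl)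
      else psi p i (z \<circ> Inl) + bcoef p * z (Inr (Inl 1)))" if "i \<in> {1..ny p}" for i
    using sp[OF that] by (cases "i < ny p") (auto intro!: smooth_intros)
  have dfY: "depends_on ?I (\<lambda>z. if i < ny p then z (Inl (i + 1)) + psi p i (z \<circ> Inl)
      else psi p i (z \<circ> Inl) + bcoef p * z (Inr (Inl 1)))" if "i \<in> {1..ny p}" for i
    using dp[OF that] by (cases "i < ny p") (auto intro!: depends_on_intros depends_on_coord)
  have "smooth ?r (uncurry3 (Delta p d (Suc j)))"
    unfolding uncurry3_Delta_Suc by (intro smooth_intros sfY sf smooth_pd[OF sm])
  moreover have "depends_on ?I (uncurry3 (Delta p d (Suc j)))"
    unfolding uncurry3_Delta_Suc
    by (intro depends_on_intros dfY df depends_on_pd[OF dep] depends_on_coord) auto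
  ultimately show ?case by blast
qed

lemma Delta_zero: "j \<le> nx p \<Longrightarrow> Delta p d j (\<lambda>_. 0) (\<lambda>_. 0) (\<lambda>_. 0) = 0"
proof (cases j)
  case 0
  then show ?thesis using Y.virt_zero[of "ny p"] by (simp add: hfun_virt)
next
  case (Suc i)
  assume "j \<le> nx p"
  then show ?thesis
    using psi_regular(3) phi_regular(3) Suc by (auto simp: fY_def intro!: sum.neutral)
qed

text \<open>For \<open>j < nx p\<close> one order of smoothness is left and the X-equations up to
  index \<open>j\<close> do not contain the input. Hence the formal recursion is the true time
  derivative and a function of the state alone.\<close>

lemma Delta_has_derivative:
  assumes j: "j < nx p"
    and P: "\<And>i. i \<in> {1..ny p} \<Longrightarrow> ((\<lambda>t. P t i) has_real_derivative fY p (P t) (bcoef p * X t 1) i) (at t)"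
    and X: "\<And>l. l \<in> {1..j} \<Longrightarrow> ((\<lambda>t. X t l) has_real_derivative X t (l + 1) + phi p l (X t)) (at t)"
    and w: "\<And>k. k \<le> ny p + j \<Longrightarrow> ((\<lambda>t. w t k) has_real_derivative w t (k + 1)) (at t)"
  shows "((\<lambda>t. Delta p d j (P t) (X t) (w t)) has_real_derivative Delta p d (Suc j) (P t) (X t) (w t)) (at t)"
proof -
  let ?F = "uncurry3 (Delta p d j)"
  let ?I = "{1..ny p} <+> {1..j} <+> {..ny p + j}"
  let ?c = "\<lambda>t. case_sum (P t) (case_sum (X t) (w t))"
  let ?c' = "case_sum (fY p (P t) (bcoef p * X t 1)) (case_sum (\<lambda>l. X t (l + 1) + phi p l (X t)) (\<lambda>k. w t (k + 1)))"
  have sm: "smooth (Suc 0) ?F" and dep: "depends_on ?I ?F"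
    using Delta_regular[of j] j by (auto intro: smooth_mono simp del: smooth.simps(2))
  have "((\<lambda>t. ?F (?c t)) has_real_derivative (\<Sum>k\<in>?I. partial_deriv k ?F (?c t) * ?c' k)) (at t)"
    by (rule chain_rule[OF _ sm dep]) (use P X w in auto)
  moreover have "uncurry3 (Delta p d (Suc j)) (?c t) = (\<Sum>k\<in>?I. partial_deriv k ?F (?c t) * ?c' k)"
    unfolding uncurry3_Delta_Suc
    by (simp add: sum.Plus comp_def fY_def atLeast0AtMost algebra_simps cong: if_cong)
  ultimately show ?thesis by simp
qed

lemma Delta_continuous:
  assumes j: "j \<le> nx p"
    and P: "\<And>i. i \<in> {1..ny p} \<Longrightarrow> continuous_on S (\<lambda>t. P t i)"
    and X: "\<And>l. l \<in> {1..j} \<Longrightarrow> continuous_on S (\<lambda>t. X t l)"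
    and w: "\<And>k. k \<le> ny p + j \<Longrightarrow> continuous_on S (\<lambda>t. w t k)"
  shows "continuous_on S (\<lambda>t. Delta p d j (P t) (X t) (w t))"
proof -
  have "continuous_on S (\<lambda>t. uncurry3 (Delta p d j) (case_sum (P t) (case_sum (X t) (w t))))"
  proof (rule continuous_on_depends[where F = "uncurry3 (Delta p d j)"
        and c = "\<lambda>t. case_sum (P t) (case_sum (X t) (w t))" and I = "{1..ny p} <+> {1..j} <+> {..ny p + j}"])
    show "continuous_on UNIV (uncurry3 (Delta p d j))"
      by (rule smooth_continuous[OF conjunct1[OF Delta_regular[OF j]]])
    show "depends_on ({1..ny p} <+> {1..j} <+> {..ny p + j}) (uncurry3 (Delta p d j))"
      by (rule conjunct2[OF Delta_regular[OF j]])
    show "continuous_on S (\<lambda>t. case_sum (P t) (case_sum (X t) (w t)) k)"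
      if "k \<in> {1..ny p} <+> {1..j} <+> {..ny p + j}" for k
      using that P X w by auto
  qed
  then show ?thesis by simp
qed

lemma Delta_bounded:
  assumes j: "j \<le> nx p"
  shows "\<exists>B\<ge>0. \<forall>P X w. (\<forall>i\<in>{1..ny p}. \<bar>P i\<bar> \<le> R) \<longrightarrow> (\<forall>l\<in>{1..j}. \<bar>X l\<bar> \<le> R) \<longrightarrow>
    (\<forall>k\<le>ny p + j. \<bar>w k\<bar> \<le> R) \<longrightarrow> \<bar>Delta p d j P X w\<bar> \<le> B"
proof -
  obtain B where B: "B \<ge> 0" "\<And>z. (\<forall>i\<in>{1..ny p} <+> {1..j} <+> {..ny p + j}. \<bar>z i\<bar> \<le> R)
      \<Longrightarrow> \<bar>uncurry3 (Delta p d j) z\<bar> \<le> B"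
    by (rule bounded_on_box[OF smooth_continuous[OF conjunct1[OF Delta_regular[OF j]]]
          conjunct2[OF Delta_regular[OF j]], where R = R]) (rule that)
  show ?thesis
  proof (intro exI[of _ B] conjI allI impI)
    fix P X w :: "nat \<Rightarrow> real"
    assume "\<forall>i\<in>{1..ny p}. \<bar>P i\<bar> \<le> R" "\<forall>l\<in>{1..j}. \<bar>X l\<bar> \<le> R" "\<forall>k\<le>ny p + j. \<bar>w k\<bar> \<le> R"
    then have "\<forall>i\<in>{1..ny p} <+> {1..j} <+> {..ny p + j}. \<bar>case_sum P (case_sum X w) i\<bar> \<le> R" by auto
    from B(2)[OF this] show "\<bar>Delta p d j P X w\<bar> \<le> B" by simp
  qed (rule B(1))
qed

lemma Delta_decays:
  assumes j: "j < nx p"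
    and P: "\<And>i. i \<in> {1..ny p} \<Longrightarrow> decays_exponentially (\<lambda>t. P t i)"
    and X: "\<And>l. l \<in> {1..j} \<Longrightarrow> decays_exponentially (\<lambda>t. X t l)"
    and w: "\<And>k. k \<le> ny p + j \<Longrightarrow> decays_exponentially (\<lambda>t. w t k)"
  shows "decays_exponentially (\<lambda>t. Delta p d j (P t) (X t) (w t))"
proof -
  let ?I = "{1..ny p} <+> {1..j} <+> {..ny p + j}"
  have "decays_exponentially (\<lambda>t. uncurry3 (Delta p d j) (case_sum (P t) (case_sum (X t) (w t))))"
  proof (rule decays_exponentially_compose[where F = "uncurry3 (Delta p d j)" and I = ?I
        and c = "\<lambda>t. case_sum (P t) (case_sum (X t) (w t))"])
    show "smooth (Suc 0) (uncurry3 (Delta p d j))"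
      using Delta_regular[of j] j by (auto intro: smooth_mono simp del: smooth.simps(2))
    show "depends_on ?I (uncurry3 (Delta p d j))" using Delta_regular[of j] j by auto
    show "uncurry3 (Delta p d j) (\<lambda>_. 0) = 0" using Delta_zero[of j] j by (simp add: uncurry3_def comp_def)
    show "decays_exponentially (\<lambda>t. case_sum (P t) (case_sum (X t) (w t)) k)" if "k \<in> ?I" for k
      using that P X w by auto
  qed auto
  then show ?thesis by simp
qed

end

section \<open>The delay identifier\<close>

text \<open>
  \<open>sin (\<pi> x)\<close> times a polynomial in \<open>cos (\<pi> x)\<close> is a combination of the functions \<open>sin (\<pi> q x)\<close>, and by
  Weierstrass these polynomials are dense; so a function with vanishing sine coefficients vanishes
  at its points of continuity.
\<close>

lemma sine_moments_zero:
  fixes u :: "real \<Rightarrow> real"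
  assumes int: "\<And>h. continuous_on {0..1} h \<Longrightarrow> (\<lambda>x. u x * h x) integrable_on {0..1}"
    and zero: "\<And>q::nat. q \<ge> 1 \<Longrightarrow> integral {0..1} (\<lambda>x. u x * sin (x * pi * real q)) = 0"
  shows "integral {0..1} (\<lambda>x. u x * (sin (x * pi * real q) * cos (x * pi) ^ k)) = 0"
proof (induction k arbitrary: q)
  case 0
  show ?case using zero[of q] by (cases "q = 0") auto
next
  case (Suc k)
  show ?case
  proof (cases "q = 0")
    case False
    \<comment> \<open>Product-to-sum formula: one factor \<open>cos (x * pi)\<close> is traded for
      the neighbouring frequencies \<open>q + 1\<close> and \<open>q - 1\<close>. This is why
      \<open>q\<close> is arbitrary in the induction; frequency zero contributes nothing.\<close>
    have "sin (x * pi * real q) * cos (x * pi) ^ Suc k =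
        (1 / 2) * (sin (x * pi * real (q + 1)) * cos (x * pi) ^ k)
        + (1 / 2) * (sin (x * pi * real (q - 1)) * cos (x * pi) ^ k)" for x
    proof -
      have "x * pi * real (q + 1) = x * pi * real q + x * pi" "x * pi * real (q - 1) = x * pi * real q - x * pi"
        using False by (simp_all add: algebra_simps of_nat_diff)
      then show ?thesis by (simp only: sin_add sin_diff power_Suc) (simp add: algebra_simps)
    qed
    then have "integral {0..1} (\<lambda>x. u x * (sin (x * pi * real q) * cos (x * pi) ^ Suc k)) =
        integral {0..1} (\<lambda>x. (1 / 2) * (u x * (sin (x * pi * real (q + 1)) * cos (x * pi) ^ k))
          + (1 / 2) * (u x * (sin (x * pi * real (q - 1)) * cos (x * pi) ^ k)))"
      by (intro integral_cong) (simp only: distrib_left mult.left_commute)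
    also have "\<dots> = (1 / 2) * integral {0..1} (\<lambda>x. u x * (sin (x * pi * real (q + 1)) * cos (x * pi) ^ k))
        + (1 / 2) * integral {0..1} (\<lambda>x. u x * (sin (x * pi * real (q - 1)) * cos (x * pi) ^ k))"
      by (subst integral_add) (auto simp del: of_nat_add intro!: integrable_on_mult_right int continuous_intros)
    finally show ?thesis by (simp only: Suc.IH mult_zero_right add_0)
  qed simp
qed

text \<open>A uniform polynomial approximation within \<open>e\<close> costs at most
  \<open>M * e\<close>. The input may jump at time zero, so \<open>u\<close> is not taken to be
  continuous but bounded and integrable against continuous multipliers.\<close>

lemma sine_complete_continuous:
  fixes u f :: "real \<Rightarrow> real"
  assumes int: "\<And>h. continuous_on {0..1} h \<Longrightarrow> (\<lambda>x. u x * h x) integrable_on {0..1}"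
    and bd: "\<And>x. x \<in> {0..1} \<Longrightarrow> \<bar>u x\<bar> \<le> M"
    and zero: "\<And>q::nat. q \<ge> 1 \<Longrightarrow> integral {0..1} (\<lambda>x. u x * sin (x * pi * real q)) = 0"
    and f: "continuous_on {-1..1} f"
  shows "integral {0..1} (\<lambda>x. u x * (sin (x * pi) * f (cos (x * pi)))) = 0"
proof -
  have M: "M \<ge> 0" using bd[of 0] by auto
  have contf: "continuous_on {0..1} (\<lambda>x. f (cos (x * pi)))"
    by (rule continuous_on_compose2[OF f]) (auto intro!: continuous_intros)
  let ?I = "integral {0..1} (\<lambda>x. u x * (sin (x * pi) * f (cos (x * pi))))"
  have "\<bar>?I\<bar> \<le> M * e" if e: "e > 0" for e
  proof -
    obtain g where g: "real_polynomial_function g" "\<And>y. y \<in> {-1..1} \<Longrightarrow> \<bar>f y - g y\<bar> < e"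
      using Stone_Weierstrass_real_polynomial_function[OF compact_Icc f e] by blast
    obtain a n where an: "g = (\<lambda>y. \<Sum>i\<le>n. a i * y ^ i)"
      using g(1) unfolding real_polynomial_function_iff_sum by blast
    have "integral {0..1} (\<lambda>x. u x * (sin (x * pi) * g (cos (x * pi)))) =
        integral {0..1} (\<lambda>x. \<Sum>i\<le>n. a i * (u x * (sin (x * pi * real 1) * cos (x * pi) ^ i)))"
      unfolding an by (intro integral_cong) (simp add: sum_distrib_left algebra_simps)
    also have "\<dots> = (\<Sum>i\<le>n. a i * integral {0..1} (\<lambda>x. u x * (sin (x * pi * real 1) * cos (x * pi) ^ i)))"
      by (subst integral_sum) (auto intro!: integrable_on_mult_right int continuous_intros)
    also have "\<dots> = 0"
      by (simp only: sine_moments_zero[OF int zero]) simp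
    finally have g0: "integral {0..1} (\<lambda>x. u x * (sin (x * pi) * g (cos (x * pi)))) = 0" .
    have contg: "continuous_on {0..1} (\<lambda>x. g (cos (x * pi)))"
      unfolding an by (intro continuous_intros)
    have "?I = integral {0..1} (\<lambda>x. u x * (sin (x * pi) * f (cos (x * pi))))
        - integral {0..1} (\<lambda>x. u x * (sin (x * pi) * g (cos (x * pi))))" using g0 by simp
    also have "\<dots> = integral {0..1} (\<lambda>x. u x * (sin (x * pi) * f (cos (x * pi))) - u x * (sin (x * pi) * g (cos (x * pi))))"
      by (intro integral_diff[symmetric] int continuous_intros contf contg)
    finally have I: "?I = \<dots>" .
    have "norm (integral {0..1} (\<lambda>x. u x * (sin (x * pi) * f (cos (x * pi))) - u x * (sin (x * pi) * g (cos (x * pi)))))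
        \<le> integral {0..1::real} (\<lambda>x. M * e)"
    proof (rule integral_norm_bound_integral)
      show "(\<lambda>x. u x * (sin (x * pi) * f (cos (x * pi))) - u x * (sin (x * pi) * g (cos (x * pi)))) integrable_on {0..1}"
        by (intro integrable_diff int continuous_intros contf contg)
      fix x :: real assume x: "x \<in> {0..1}"
      have "\<bar>f (cos (x * pi)) - g (cos (x * pi))\<bar> \<le> e" using g(2)[of "cos (x * pi)"] by simp
      moreover have "\<bar>sin (x * pi)\<bar> \<le> 1" by simp
      ultimately have "\<bar>u x\<bar> * (\<bar>sin (x * pi)\<bar> * \<bar>f (cos (x * pi)) - g (cos (x * pi))\<bar>) \<le> M * (1 * e)"
        using bd[OF x] e M by (intro mult_mono) auto
      then show "norm (u x * (sin (x * pi) * f (cos (x * pi))) - u x * (sin (x * pi) * g (cos (x * pi)))) \<le> M * e"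
        by (simp add: abs_mult flip: right_diff_distrib)
    qed (rule integrable_const_ivl)
    then show ?thesis using I by simp
  qed
  then have small: "\<bar>?I\<bar> \<le> M * e" if "e > 0" for e using that by blast
  have "\<bar>?I\<bar> \<le> 0"
  proof (rule field_le_epsilon)
    fix e :: real assume e: "e > 0"
    have "M * (e / (M + 1)) \<le> e" using M e by (simp add: divide_le_eq mult.commute[of M])
    moreover have "e / (M + 1) > 0" using M e by simp
    ultimately show "\<bar>?I\<bar> \<le> 0 + e" using small[of "e / (M + 1)"] by linarith
  qed
  then show ?thesis by simp
qed

text \<open>If \<open>u x0\<close> were positive, a tent concentrated near \<open>x0\<close> would
  give a strictly positive integral. The tent is an admissible test function because
  \<open>arccos\<close> expresses it through \<open>cos (x * pi)\<close>.\<close>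

lemma sine_complete_nonpos:
  fixes u :: "real \<Rightarrow> real"
  assumes int: "\<And>h. continuous_on {0..1} h \<Longrightarrow> (\<lambda>x. u x * h x) integrable_on {0..1}"
    and bd: "\<And>x. x \<in> {0..1} \<Longrightarrow> \<bar>u x\<bar> \<le> M"
    and zero: "\<And>q::nat. q \<ge> 1 \<Longrightarrow> integral {0..1} (\<lambda>x. u x * sin (x * pi * real q)) = 0"
    and x0: "x0 \<in> {0<..<1}" and cont: "isCont u x0"
  shows "u x0 \<le> 0"
proof (rule ccontr)
  assume "\<not> u x0 \<le> 0"
  then have c: "u x0 / 2 > 0" by simp
  obtain \<delta> where \<delta>: "\<delta> > 0" "\<And>x. \<bar>x - x0\<bar> < \<delta> \<Longrightarrow> \<bar>u x - u x0\<bar> < u x0 / 2"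
    using cont c unfolding continuous_at_eps_delta real_norm_def dist_real_def by metis
  have ge: "u x \<ge> u x0 / 2" if "\<bar>x - x0\<bar> < \<delta>" for x
    using \<delta>(2)[OF that] by linarith
  define h where "h x = max 0 (\<delta> - \<bar>x - x0\<bar>)" for x
  define f where "f y = h (arccos y / pi)" for y
  have conth: "continuous_on S h" for S unfolding h_def by (intro continuous_intros)
  have "continuous_on {-1..1} f"
    unfolding f_def by (rule continuous_on_compose2[OF conth[of UNIV]]) (auto intro!: continuous_intros)
  from sine_complete_continuous[OF int bd zero this]
  have I: "integral {0..1} (\<lambda>x. u x * (sin (x * pi) * f (cos (x * pi)))) = 0" by blast
  have fh: "f (cos (x * pi)) = h x" if "x \<in> {0..1}" for x
    using that by (simp add: f_def arccos_cos)
  have I: "integral {0..1} (\<lambda>x. u x * (sin (x * pi) * h x)) = 0"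
    using I fh by (metis (mono_tags, lifting) integral_cong)
  \<comment> \<open>A continuous lower bound of the integrand, to which the criterion for vanishing
    integrals of nonnegative continuous functions applies.\<close>
  define k where "k x = u x0 / 2 * (sin (x * pi) * h x)" for x
  have contk: "continuous_on {0..1} k" unfolding k_def by (intro continuous_intros conth)
  have sin: "sin (x * pi) \<ge> 0" if "x \<in> {0..1}" for x
    using that by (intro sin_ge_zero) (auto simp: mult_le_cancel_right1)
  have k0: "k x \<ge> 0" if "x \<in> {0..1}" for x
    using sin[OF that] c by (simp add: k_def h_def)
  have "integral {0..1} k \<le> integral {0..1} (\<lambda>x. u x * (sin (x * pi) * h x))"
  proof (rule integral_le)
    show "k integrable_on {0..1}" using contk by (rule integrable_continuous_real)
    show "(\<lambda>x. u x * (sin (x * pi) * h x)) integrable_on {0..1}" by (intro int continuous_intros conth)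
    fix x :: real assume x: "x \<in> {0..1}"
    show "k x \<le> u x * (sin (x * pi) * h x)"
    proof (cases "\<bar>x - x0\<bar> < \<delta>")
      case True
      then show ?thesis unfolding k_def using ge[OF True] sin[OF x]
        by (intro mult_right_mono mult_nonneg_nonneg) (auto simp: h_def)
    qed (simp add: k_def h_def)
  qed
  moreover have "integral {0..1} k \<ge> 0" using k0 by (intro integral_nonneg integrable_continuous_real contk)
  ultimately have "integral {0..1} k = 0" using I by linarith
  then have "k x0 = 0" using integral_eq_0_iff[OF contk] k0 x0 by auto
  moreover have "sin (x0 * pi) > 0" using x0 by (intro sin_gt_zero) auto
  ultimately show False using c \<delta>(1) by (simp add: k_def h_def)
qed

lemma sine_complete:
  fixes u :: "real \<Rightarrow> real"
  assumes int: "\<And>h. continuous_on {0..1} h \<Longrightarrow> (\<lambda>x. u x * h x) integrable_on {0..1}"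
    and bd: "\<And>x. x \<in> {0..1} \<Longrightarrow> \<bar>u x\<bar> \<le> M"
    and zero: "\<And>q::nat. q \<ge> 1 \<Longrightarrow> integral {0..1} (\<lambda>x. u x * sin (x * pi * real q)) = 0"
    and x0: "x0 \<in> {0<..<1}" and cont: "isCont u x0"
  shows "u x0 = 0"
proof (rule antisym)
  show "u x0 \<le> 0" by (rule sine_complete_nonpos[OF assms])
  have "- u x0 \<le> 0"
  proof (rule sine_complete_nonpos[where u = "\<lambda>x. - u x" and M = M])
    show "(\<lambda>x. - u x * h x) integrable_on {0..1}" if "continuous_on {0..1} h" for h
      using integrable_neg[OF int[OF that]] by simp
    show "integral {0..1} (\<lambda>x. - u x * sin (x * pi * real q)) = 0" if "q \<ge> 1" for q
      using zero[OF that] integral_neg[of "{0..1}" "\<lambda>x. u x * sin (x * pi * real q)"] by simp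
    show "isCont (\<lambda>x. - u x) x0" using cont by (rule isCont_minus)
  qed (use bd x0 in auto)
  then show "0 \<le> u x0" by simp
qed

section \<open>Sine and cosine moments of the transported input\<close>

locale input_history =
  fixes p :: plant and X :: "real \<Rightarrow> nat \<Rightarrow> real"
  assumes delay: "delay p > 0"
    and cont_x1: "continuous_on {0..} (\<lambda>t. X t 1)"
    and history: "\<And>t. - delay p \<le> t \<Longrightarrow> t < 0 \<Longrightarrow> X t 1 = 0"
begin

text \<open>The input \<open>b x_1\<close>, extended by zero to the whole negative axis as in
  \<open>is_predictor\<close>, so that its only possible discontinuity is at time zero.\<close>

definition v :: "real \<Rightarrow> real" where
  "v \<sigma> = bcoef p * (if \<sigma> < 0 then 0 else X \<sigma> 1)"

lemma v_eq: "- delay p \<le> \<sigma> \<Longrightarrow> v \<sigma> = bcoef p * X \<sigma> 1"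
  using history by (simp add: v_def)

lemma v_cont: "continuous_on {0..} v"
  using continuous_on_mult_left[OF cont_x1, of "bcoef p"]
  by (rule continuous_on_eq) (simp add: v_def)

lemma v_neg: "\<sigma> < 0 \<Longrightarrow> v \<sigma> = 0"
  by (simp add: v_def)

lemma v_isCont:
  assumes "\<sigma> \<noteq> 0" shows "isCont v \<sigma>"
proof (cases "\<sigma> < 0")
  case True
  have "\<forall>\<^sub>F x in nhds \<sigma>. v x = 0"
    using eventually_nhds_in_open[of "{..<0}" \<sigma>] True by (auto elim!: eventually_mono simp: v_neg)
  then show ?thesis using isCont_cong[of v "\<lambda>_. 0" \<sigma>] by simp
next
  case False
  then have "continuous_on {0<..} v" "\<sigma> \<in> {0<..}"
    using assms by (auto intro: continuous_on_subset[OF v_cont])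
  then show ?thesis using continuous_on_eq_continuous_at[of "{0<..}" v] by auto
qed

text \<open>Splitting at time zero isolates the jump: the left part is zero up to one point, the
  right part continuous.\<close>

lemma v_mult_integrable:
  fixes a b :: real
  assumes h: "continuous_on {a..b} h"
  shows "(\<lambda>\<sigma>. v \<sigma> * h \<sigma>) integrable_on {a..b}"
proof -
  have neg: "(\<lambda>\<sigma>. v \<sigma> * h \<sigma>) integrable_on {a..c}" if "c \<le> 0" for c
  proof (rule integrable_spike_finite[of "{0}"])
    show "(\<lambda>_::real. 0::real) integrable_on {a..c}" by (rule integrable_const_ivl)
  qed (use that in \<open>auto simp: v_def\<close>)
  show ?thesis
  proof (cases "b \<le> 0 \<or> b < a")
    case False
    have "continuous_on {max a 0..b} (\<lambda>\<sigma>. v \<sigma> * h \<sigma>)"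
      by (intro continuous_intros continuous_on_subset[OF v_cont] continuous_on_subset[OF h]) auto
    then have pos: "(\<lambda>\<sigma>. v \<sigma> * h \<sigma>) integrable_on {max a 0..b}" by (rule integrable_continuous_real)
    show ?thesis
    proof (cases "a < 0")
      case True
      then show ?thesis using pos False by (intro Henstock_Kurzweil_Integration.integrable_combine[OF _ _ neg[of 0]]) auto
    qed (use pos in simp)
  qed (use neg in \<open>auto simp: not_le\<close>)
qed

lemma v_bounded: "\<exists>M. \<forall>\<sigma>\<in>{a..b}. \<bar>v \<sigma>\<bar> \<le> M"
proof -
  have "compact (v ` {0..b})"
    by (intro compact_continuous_image continuous_on_subset[OF v_cont]) auto
  then have "bounded (v ` {0..b})" by (rule compact_imp_bounded)
  then obtain M where M: "\<forall>\<sigma>\<in>{0..b}. \<bar>v \<sigma>\<bar> \<le> M"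
    unfolding bounded_iff by (auto simp del: atLeastAtMost_iff)
  have "\<bar>v \<sigma>\<bar> \<le> max M 0" if "\<sigma> \<in> {a..b}" for \<sigma>
    using M that v_neg[of \<sigma>] by (cases "\<sigma> < 0") (auto simp: le_max_iff_disj)
  then show ?thesis by blast
qed

lemma v_integral_has_derivative:
  fixes a :: real
  assumes "a < t" "t \<noteq> 0" and h: "continuous_on UNIV h"
  shows "((\<lambda>t. integral {a..t} (\<lambda>\<sigma>. v \<sigma> * h \<sigma>)) has_real_derivative v t * h t) (at t)"
proof -
  have "isCont (\<lambda>\<sigma>. v \<sigma> * h \<sigma>) t"
    using h v_isCont[OF assms(2)] by (intro continuous_mult) (auto simp: continuous_on_eq_continuous_at)
  then have "continuous (at t within {a..t+1}) (\<lambda>\<sigma>. v \<sigma> * h \<sigma>)" by (rule continuous_at_imp_continuous_within)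
  then have "((\<lambda>t. integral {a..t} (\<lambda>\<sigma>. v \<sigma> * h \<sigma>)) has_real_derivative v t * h t) (at t within {a..t+1})"
    unfolding has_real_derivative_iff_has_vector_derivative
    using assms v_mult_integrable[OF continuous_on_subset[OF h]]
      integral_has_vector_derivative_continuous_at[where S = "{}" and a = a and b = "t + 1" and x = t
        and f = "\<lambda>\<sigma>. v \<sigma> * h \<sigma>"] by simp
  then show ?thesis using assms by (simp add: at_within_Icc_at)
qed

lemma v_integral_cont:
  fixes a b :: real
  assumes h: "continuous_on UNIV h"
  shows "continuous_on {a..b} (\<lambda>t. integral {a..t} (\<lambda>\<sigma>. v \<sigma> * h \<sigma>))"
  by (intro indefinite_integral_continuous_1 v_mult_integrable continuous_on_subset[OF h]) auto

lemma transport_integral: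
  assumes h: "continuous_on UNIV h"
  shows "((\<lambda>x. v (t - delay p + delay p * x) * h (t - delay p + delay p * x)) has_integral
     integral {t - delay p..t} (\<lambda>\<sigma>. v \<sigma> * h \<sigma>) / delay p) {0..1}"
proof -
  have "((\<lambda>\<sigma>. v \<sigma> * h \<sigma>) has_integral integral {t - delay p..t} (\<lambda>\<sigma>. v \<sigma> * h \<sigma>)) (cbox (t - delay p) t)"
    using v_mult_integrable[OF continuous_on_subset[OF h]] by (simp add: has_integral_integral[symmetric])
  from has_integral_affinity'[OF this delay, of "t - delay p"] delay
  show ?thesis by (simp add: add.commute divide_inverse mult.commute)
qed

lemma ufun_eq: "t \<ge> 0 \<Longrightarrow> x \<in> {0..1} \<Longrightarrow> ufun p X x t = v (t - delay p + delay p * x)"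
  using delay by (subst v_eq) (auto simp: ufun_def)

lemma integral_split_v:
  assumes "t \<ge> 0" and h: "continuous_on UNIV h"
  shows "integral {t - delay p..t} (\<lambda>\<sigma>. v \<sigma> * h \<sigma>) =
    integral {- delay p..t} (\<lambda>\<sigma>. v \<sigma> * h \<sigma>) - integral {- delay p..t - delay p} (\<lambda>\<sigma>. v \<sigma> * h \<sigma>)"
  using Henstock_Kurzweil_Integration.integral_combine[where a = "- delay p" and c = "t - delay p" and b = t and f = "\<lambda>\<sigma>. v \<sigma> * h \<sigma>"] assms delay
    v_mult_integrable[OF continuous_on_subset[OF h]] by simp

lemma integral_before_zero: "integral {- delay p..0} (\<lambda>\<sigma>. v \<sigma> * h \<sigma>) = 0"
proof -
  have "integral {- delay p..0} (\<lambda>\<sigma>. v \<sigma> * h \<sigma>) = integral {- delay p..0} (\<lambda>\<sigma>. 0)"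
    by (rule integral_spike[of "{0}"]) (auto simp: v_neg)
  then show ?thesis by simp
qed

context
  fixes q :: nat and \<omega> :: real
  assumes q: "q \<ge> 1" and \<omega>_def: "\<omega> = pi * real q / delay p"
begin

text \<open>The substitution \<open>\<sigma> = t - delay p + delay p * x\<close> turns the moments
  into integrals over a moving window with phase \<open>\<omega> * (\<sigma> + delay p - t)\<close>.
  The addition formulas separate \<open>t\<close> from \<open>\<sigma>\<close> and leave differences
  of primitives with a fixed lower limit, which can be differentiated in \<open>t\<close>.\<close>

definition "sin_primitive t = integral {- delay p..t} (\<lambda>\<sigma>. v \<sigma> * sin (\<omega> * \<sigma>))"
definition "cos_primitive t = integral {- delay p..t} (\<lambda>\<sigma>. v \<sigma> * cos (\<omega> * \<sigma>))"
definition "sin_moment t = (cos (\<omega> * (delay p - t)) * (sin_primitive t - sin_primitive (t - delay p))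
   + sin (\<omega> * (delay p - t)) * (cos_primitive t - cos_primitive (t - delay p))) / delay p"
definition "cos_moment t = (cos (\<omega> * (delay p - t)) * (cos_primitive t - cos_primitive (t - delay p))
   - sin (\<omega> * (delay p - t)) * (sin_primitive t - sin_primitive (t - delay p))) / delay p"

lemma \<omega>_delay: "\<omega> * delay p = pi * real q"
  using delay by (simp add: \<omega>_def)

lemma integral_sin_u:
  assumes t: "t \<ge> 0"
  shows "integral {0..1} (\<lambda>x. sin (x * pi * real q) * ufun p X x t) = sin_moment t"
    and "integral {0..1} (\<lambda>x. cos (x * pi * real q) * ufun p X x t) = cos_moment t"
proof -
  let ?s = "\<lambda>x. t - delay p + delay p * x"
  have sin_moment_eq: "sin_moment t = cos (\<omega> * (delay p - t)) * ((sin_primitive t - sin_primitive (t - delay p)) / delay p)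
      + sin (\<omega> * (delay p - t)) * ((cos_primitive t - cos_primitive (t - delay p)) / delay p)"
    by (simp add: sin_moment_def add_divide_distrib)
  have cos_moment_eq: "cos_moment t = cos (\<omega> * (delay p - t)) * ((cos_primitive t - cos_primitive (t - delay p)) / delay p)
      - sin (\<omega> * (delay p - t)) * ((sin_primitive t - sin_primitive (t - delay p)) / delay p)"
    using delay by (simp add: cos_moment_def field_simps)
  have ang: "x * pi * real q = \<omega> * ?s x + \<omega> * (delay p - t)" for x
    using \<omega>_delay by (simp add: algebra_simps)
  have cont: "continuous_on UNIV (\<lambda>\<sigma>. sin (\<omega> * \<sigma>))" "continuous_on UNIV (\<lambda>\<sigma>. cos (\<omega> * \<sigma>))"
    by (intro continuous_intros)+
  have 1: "((\<lambda>x. v (?s x) * sin (\<omega> * ?s x)) has_integral (sin_primitive t - sin_primitive (t - delay p)) / delay p) {0..1}"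
    unfolding sin_primitive_def integral_split_v[OF t cont(1), symmetric] by (rule transport_integral[OF cont(1)])
  have 2: "((\<lambda>x. v (?s x) * cos (\<omega> * ?s x)) has_integral (cos_primitive t - cos_primitive (t - delay p)) / delay p) {0..1}"
    unfolding cos_primitive_def integral_split_v[OF t cont(2), symmetric] by (rule transport_integral[OF cont(2)])
  have "((\<lambda>x. cos (\<omega> * (delay p - t)) * (v (?s x) * sin (\<omega> * ?s x))
      + sin (\<omega> * (delay p - t)) * (v (?s x) * cos (\<omega> * ?s x))) has_integral sin_moment t) {0..1}"
    unfolding sin_moment_eq by (intro has_integral_add has_integral_mult_right 1 2)
  then have "((\<lambda>x. sin (x * pi * real q) * ufun p X x t) has_integral sin_moment t) {0..1}"
    by (rule has_integral_eq[rotated]) (simp only: ang sin_add ufun_eq[OF t], simp add: algebra_simps)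
  then show "integral {0..1} (\<lambda>x. sin (x * pi * real q) * ufun p X x t) = sin_moment t" by (rule integral_unique)
  have "((\<lambda>x. cos (\<omega> * (delay p - t)) * (v (?s x) * cos (\<omega> * ?s x))
      - sin (\<omega> * (delay p - t)) * (v (?s x) * sin (\<omega> * ?s x))) has_integral cos_moment t) {0..1}"
    unfolding cos_moment_eq by (intro has_integral_diff has_integral_mult_right 1 2)
  then have "((\<lambda>x. cos (x * pi * real q) * ufun p X x t) has_integral cos_moment t) {0..1}"
    by (rule has_integral_eq[rotated]) (simp only: ang cos_add ufun_eq[OF t], simp add: algebra_simps)
  then show "integral {0..1} (\<lambda>x. cos (x * pi * real q) * ufun p X x t) = cos_moment t" by (rule integral_unique)
qed

lemma primitive_cont: "continuous_on {0..b} sin_primitive" "continuous_on {0..b} cos_primitive"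
    "continuous_on {0..b} (\<lambda>t. sin_primitive (t - delay p))" "continuous_on {0..b} (\<lambda>t. cos_primitive (t - delay p))"
proof -
  have *: "continuous_on {- delay p..b} sin_primitive" "continuous_on {- delay p..b} cos_primitive"
    unfolding sin_primitive_def cos_primitive_def by (intro v_integral_cont continuous_intros)+
  then show "continuous_on {0..b} sin_primitive" "continuous_on {0..b} cos_primitive"
    using delay by (auto intro: continuous_on_subset)
  show "continuous_on {0..b} (\<lambda>t. sin_primitive (t - delay p))" "continuous_on {0..b} (\<lambda>t. cos_primitive (t - delay p))"
    by (rule continuous_on_compose2[OF *(1)] continuous_on_compose2[OF *(2)],
        use delay in \<open>auto intro!: continuous_intros\<close>)+
qed

lemma sin_moment_cont: "continuous_on {0..b} sin_moment" and cos_moment_cont: "continuous_on {0..b} cos_moment"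
  unfolding sin_moment_def cos_moment_def using delay by (intro continuous_intros primitive_cont; simp)+

text \<open>Integration by parts in \<open>D u_t = u_x\<close>, performed on the primitives because
  \<open>u\<close> has no derivative in \<open>x\<close>. The instant \<open>delay p\<close> is
  excluded since the jump of the input reaches the end \<open>x = 0\<close> then.\<close>

lemma sin_moment_has_derivative:
  assumes t: "t > 0" "t \<noteq> delay p"
  shows "(sin_moment has_real_derivative - \<omega> * cos_moment t) (at t)"
proof -
  have cont: "continuous_on UNIV (\<lambda>\<sigma>. sin (\<omega> * \<sigma>))" "continuous_on UNIV (\<lambda>\<sigma>. cos (\<omega> * \<sigma>))"
    by (intro continuous_intros)+
  have I: "(sin_primitive has_real_derivative v r * sin (\<omega> * r)) (at r)" "(cos_primitive has_real_derivative v r * cos (\<omega> * r)) (at r)"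
    if "- delay p < r" "r \<noteq> 0" for r
    unfolding sin_primitive_def cos_primitive_def using that cont by (intro v_integral_has_derivative; simp)+
  have J: "((\<lambda>t. sin_primitive (t - delay p)) has_real_derivative v (t - delay p) * sin (\<omega> * (t - delay p))) (at t)"
    "((\<lambda>t. cos_primitive (t - delay p)) has_real_derivative v (t - delay p) * cos (\<omega> * (t - delay p))) (at t)"
    using I[of "t - delay p"] t DERIV_shift[of sin_primitive _ t "- delay p"] DERIV_shift[of cos_primitive _ t "- delay p"] by simp_all
  \<comment> \<open>The boundary terms drop out: the phase is \<open>pi * real q\<close> at the end
    \<open>x = 1\<close> and zero at \<open>x = 0\<close>.\<close>
  have "sin (\<omega> * t + \<omega> * (delay p - t)) = 0" "sin (\<omega> * (t - delay p) + \<omega> * (delay p - t)) = 0"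
    using \<omega>_delay by (simp_all add: algebra_simps)
  then have z: "v t * (cos (\<omega> * (delay p - t)) * sin (\<omega> * t) + sin (\<omega> * (delay p - t)) * cos (\<omega> * t)) = 0"
    "v (t - delay p) * (cos (\<omega> * (delay p - t)) * sin (\<omega> * (t - delay p)) + sin (\<omega> * (delay p - t)) * cos (\<omega> * (t - delay p))) = 0"
    by (simp_all only: sin_add mult.commute mult_zero_right add.commute)
  have "(sin_moment has_real_derivative
     (\<omega> * sin (\<omega> * (delay p - t)) * (sin_primitive t - sin_primitive (t - delay p))
      + cos (\<omega> * (delay p - t)) * (v t * sin (\<omega> * t) - v (t - delay p) * sin (\<omega> * (t - delay p)))
      + (- \<omega> * cos (\<omega> * (delay p - t)) * (cos_primitive t - cos_primitive (t - delay p))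
      + sin (\<omega> * (delay p - t)) * (v t * cos (\<omega> * t) - v (t - delay p) * cos (\<omega> * (t - delay p))))) / delay p) (at t)"
    unfolding sin_moment_def
    by (rule DERIV_cdivide, intro DERIV_add)
      (rule derivative_eq_intros refl I J | use t delay in \<open>simp add: algebra_simps\<close>)+
  moreover have "(\<omega> * sin (\<omega> * (delay p - t)) * (sin_primitive t - sin_primitive (t - delay p))
      + cos (\<omega> * (delay p - t)) * (v t * sin (\<omega> * t) - v (t - delay p) * sin (\<omega> * (t - delay p)))
      + (- \<omega> * cos (\<omega> * (delay p - t)) * (cos_primitive t - cos_primitive (t - delay p))
      + sin (\<omega> * (delay p - t)) * (v t * cos (\<omega> * t) - v (t - delay p) * cos (\<omega> * (t - delay p))))) / delay p
    = - \<omega> * cos_moment t + (v t * (cos (\<omega> * (delay p - t)) * sin (\<omega> * t) + sin (\<omega> * (delay p - t)) * cos (\<omega> * t))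
       - v (t - delay p) * (cos (\<omega> * (delay p - t)) * sin (\<omega> * (t - delay p)) + sin (\<omega> * (delay p - t)) * cos (\<omega> * (t - delay p)))) / delay p"
    using delay unfolding cos_moment_def by (simp add: field_simps)
  ultimately show ?thesis unfolding z by simp
qed

lemma sin_moment_zero: "sin_moment 0 = 0"
  using delay by (simp add: sin_moment_def sin_primitive_def cos_primitive_def integral_before_zero)

text \<open>
  The sine moment of \<open>D u\<^sub>t = u\<^sub>x\<close>, integrated in time; the initial moment vanishes because the
  input history does.
\<close>

lemma fq_eq_gq:
  assumes t: "t \<ge> 0" shows "fq p X q t = delay p * gq p X q t"
proof -
  have "integral {0..t} (\<lambda>t. - \<omega> * cos_moment t) = sin_moment t - sin_moment 0"
  proof (rule integral_off_countable[OF t sin_moment_cont, of "{delay p}"])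
    show "(\<lambda>t. - \<omega> * cos_moment t) integrable_on {0..t}"
      by (intro integrable_continuous_real continuous_intros cos_moment_cont)
    have "continuous_on {0<..<t} cos_moment" by (rule continuous_on_subset[OF cos_moment_cont[of t]]) auto
    then show "isCont (\<lambda>t. - \<omega> * cos_moment t) r" if "0 < r" "r < t" for r
      using that by (intro continuous_intros) (auto simp: continuous_on_eq_continuous_at)
  qed (use sin_moment_has_derivative in auto)
  then have "\<omega> * integral {0..t} cos_moment = - sin_moment t" using sin_moment_zero by simp
  moreover have "integral {0..t} (\<lambda>\<tau>. integral {0..1} (\<lambda>x. cos (x * pi * real q) * ufun p X x \<tau>)) = integral {0..t} cos_moment"
    by (intro integral_cong) (simp add: integral_sin_u)
  moreover have "pi * real q * integral {0..t} cos_moment = delay p * (\<omega> * integral {0..t} cos_moment)"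
    by (simp add: \<omega>_delay[symmetric])
  ultimately show ?thesis
    unfolding fq_def gq_def integral_sin_u(1)[OF t] by simp
qed

lemma gq_cont: "continuous_on {0..b} (gq p X q)"
  using continuous_on_minus[OF sin_moment_cont]
  by (rule continuous_on_eq) (simp add: gq_def integral_sin_u)

end

lemma fq_eq: "q \<ge> 1 \<Longrightarrow> t \<ge> 0 \<Longrightarrow> fq p X q t = delay p * gq p X q t"
  using fq_eq_gq by blast

lemma Fq_eq_Gq:
  assumes "q \<ge> 1" "0 \<le> \<mu>"
  shows "Fq p X q t \<mu> = delay p * Gq p X q t \<mu>"
proof -
  have "Fq p X q t \<mu> = integral {\<mu>..t} (\<lambda>\<tau>. delay p * (gq p X q \<tau>)\<^sup>2)"
    unfolding Fq_def using assms by (intro integral_cong) (simp add: fq_eq power2_eq_square)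
  then show ?thesis by (simp add: Gq_def)
qed

lemma gq_zero:
  assumes "q \<ge> 1" "0 \<le> \<mu>" "\<mu> < t" "Gq p X q t \<mu> = 0" and r: "r \<in> {\<mu>..t}"
  shows "gq p X q r = 0"
proof -
  have "continuous_on {\<mu>..t} (\<lambda>\<tau>. (gq p X q \<tau>)\<^sup>2)"
    using assms by (intro continuous_intros continuous_on_subset[OF gq_cont[of q, OF _ refl, of t]]) auto
  from integral_eq_0_iff[OF this assms(3)] assms show ?thesis by (auto simp: Gq_def)
qed

text \<open>The values \<open>gq\<close> at one instant are, up to sign, all sine coefficients of
  the current window; completeness applies at every continuity point of the input inside it.\<close>

lemma input_zero_of_gq_zero:
  assumes "t \<ge> 0" and gq: "\<And>q. q \<ge> 1 \<Longrightarrow> gq p X q t = 0"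
    and \<sigma>: "t - delay p < \<sigma>" "\<sigma> < t" "\<sigma> \<noteq> 0"
  shows "v \<sigma> = 0"
proof -
  define u where "u x = v (t - delay p + delay p * x)" for x
  define x0 where "x0 = (\<sigma> - t + delay p) / delay p"
  have x0: "x0 \<in> {0<..<1}" and \<sigma>_eq: "t - delay p + delay p * x0 = \<sigma>"
    using \<sigma> delay by (auto simp: x0_def field_simps)
  obtain M where M: "\<And>r. r \<in> {t - delay p..t} \<Longrightarrow> \<bar>v r\<bar> \<le> M" using v_bounded by blast
  have "u x0 = 0"
  proof (rule sine_complete[where M = M, OF _ _ _ x0])
    fix h :: "real \<Rightarrow> real" assume h: "continuous_on {0..1} h"
    have "(\<lambda>\<sigma>. v \<sigma> * h ((\<sigma> - t + delay p) / delay p)) integrable_on cbox (t - delay p) t"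
      unfolding cbox_interval using delay
      by (intro v_mult_integrable continuous_on_compose2[OF h]) (auto intro!: continuous_intros simp: field_simps)
    then obtain I where "((\<lambda>\<sigma>. v \<sigma> * h ((\<sigma> - t + delay p) / delay p)) has_integral I) (cbox (t - delay p) t)"
      by (auto simp: integrable_on_def)
    from has_integral_affinity'[OF this delay, of "t - delay p"] delay
    show "(\<lambda>x. u x * h x) integrable_on {0..1}"
      by (auto simp: u_def integrable_on_def add.commute)
  next
    show "\<bar>u x\<bar> \<le> M" if "x \<in> {0..1}" for x
      unfolding u_def using that delay by (intro M) (auto simp: mult_le_cancel_left1)
    show "integral {0..1} (\<lambda>x. u x * sin (x * pi * real q)) = 0" if "q \<ge> 1" for q
    proof -
      have "integral {0..1} (\<lambda>x. u x * sin (x * pi * real q)) = - gq p X q t"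
        unfolding gq_def minus_minus u_def using \<open>t \<ge> 0\<close>
        by (intro integral_cong) (simp add: ufun_eq mult.commute)
      then show ?thesis using gq[OF that] by simp
    qed
    have "isCont v (t - delay p + delay p * x0)" using v_isCont \<sigma>_eq \<sigma> by simp
    then show "isCont u x0"
      unfolding u_def by (rule isCont_o2[rotated]) (intro continuous_intros)
  qed
  then show ?thesis by (simp add: u_def \<sigma>_eq)
qed

text \<open>If all \<open>Gq\<close> vanished, so would every sine coefficient at all times of the
  interval. The given nonzero value may sit at an end of its window or at the jump, where
  completeness says nothing, so a slightly later instant and argument are used.\<close>

lemma exists_Gq_nonzero:
  assumes "0 \<le> \<mu>" "\<mu> \<le> t'" "t' < t" "x \<in> {0..1}" "ufun p X x t' \<noteq> 0"
  shows "\<exists>q\<ge>1. Gq p X q t \<mu> \<noteq> 0"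
proof (rule ccontr)
  assume "\<not> ?thesis"
  then have gq: "gq p X q r = 0" if "q \<ge> 1" "r \<in> {\<mu>..t}" for q r
    using gq_zero[of q \<mu> t r] that assms by auto
  define \<sigma>0 where "\<sigma>0 = t' - delay p + delay p * x"
  have v0: "v \<sigma>0 \<noteq> 0" using assms ufun_eq[of t' x] by (auto simp: \<sigma>0_def)
  then have "\<sigma>0 \<ge> 0" by (metis not_le v_neg)
  have \<sigma>0: "t' - delay p \<le> \<sigma>0" "\<sigma>0 \<le> t'" using assms delay by (auto simp: \<sigma>0_def mult_le_cancel_left1)
  have "continuous (at \<sigma>0 within {0..}) v"
    using v_cont \<open>\<sigma>0 \<ge> 0\<close> by (auto simp: continuous_on_eq_continuous_within)
  moreover have "\<bar>v \<sigma>0\<bar> > 0" using v0 by simp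
  ultimately have "\<exists>\<epsilon>>0. \<forall>r\<in>{0..}. dist r \<sigma>0 < \<epsilon> \<longrightarrow> dist (v r) (v \<sigma>0) < \<bar>v \<sigma>0\<bar>"
    unfolding continuous_within_eps_delta by blast
  then obtain \<epsilon> where \<epsilon>: "\<epsilon> > 0" "\<And>r. r \<ge> 0 \<Longrightarrow> \<bar>r - \<sigma>0\<bar> < \<epsilon> \<Longrightarrow> \<bar>v r - v \<sigma>0\<bar> < \<bar>v \<sigma>0\<bar>"
    unfolding dist_real_def by auto
  \<comment> \<open>Later than \<open>t'\<close> by less than \<open>\<epsilon>\<close>, so some
    \<open>\<sigma> > \<sigma>0\<close> lies in the open window of \<open>t''\<close> and still
    within the range where \<open>v\<close> cannot vanish.\<close>
  define t'' where "t'' = min (t' + \<epsilon> / 2) t"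
  have t'': "t' < t''" "t'' < t' + \<epsilon>" "t'' \<le> t" using assms \<epsilon>(1) by (auto simp: t''_def)
  have "max \<sigma>0 (t'' - delay p) < min t'' (\<sigma>0 + \<epsilon>)" using t'' \<sigma>0 \<epsilon>(1) delay by auto
  then obtain \<sigma> where \<sigma>: "max \<sigma>0 (t'' - delay p) < \<sigma>" "\<sigma> < min t'' (\<sigma>0 + \<epsilon>)" using dense by blast
  have "v \<sigma> = 0"
    using \<sigma> \<open>\<sigma>0 \<ge> 0\<close> t'' assms by (intro input_zero_of_gq_zero[of t''] gq) auto
  moreover have "\<bar>v \<sigma> - v \<sigma>0\<bar> < \<bar>v \<sigma>0\<bar>" using \<sigma> \<open>\<sigma>0 \<ge> 0\<close> by (intro \<epsilon>(2)) auto
  ultimately show False by simp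
qed

end

section \<open>The predictor and the identified delay\<close>

lemma bounded_family:
  fixes f :: "'i \<Rightarrow> real \<Rightarrow> real"
  assumes "finite I" "\<And>k. k \<in> I \<Longrightarrow> continuous_on {a..b} (f k)"
  shows "\<exists>R\<ge>0. \<forall>t\<in>{a..b}. \<forall>k\<in>I. \<bar>f k t\<bar> \<le> R"
proof -
  have "\<exists>R\<ge>0. \<forall>t\<in>{a..b}. \<bar>f k t\<bar> \<le> R" if "k \<in> I" for k
  proof -
    have "bounded (f k ` {a..b})"
      using assms(2)[OF that] by (intro compact_imp_bounded compact_continuous_image) auto
    then obtain R where "\<forall>t\<in>{a..b}. \<bar>f k t\<bar> \<le> R"
      by (auto simp: bounded_iff simp del: atLeastAtMost_iff)
    then show ?thesis by (intro exI[of _ "max R 0"]) (auto simp: le_max_iff_disj)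
  qed
  then obtain R where R: "\<And>k. k \<in> I \<Longrightarrow> R k \<ge> 0" "\<And>k t. k \<in> I \<Longrightarrow> t \<in> {a..b} \<Longrightarrow> \<bar>f k t\<bar> \<le> R k"
    by metis
  have "\<bar>f k t\<bar> \<le> sum R I" if "k \<in> I" "t \<in> {a..b}" for k t
    using R(2)[OF that] member_le_sum[of k I R] assms(1) R(1) that by force
  moreover have "sum R I \<ge> 0" using R(1) by (rule sum_nonneg)
  ultimately show ?thesis by blast
qed

text \<open>The integral \<open>\<Phi>\<close> of \<open>w\<close> starts at zero and grows at a
  rate of at most \<open>L * \<Phi>\<close>, so \<open>- \<Phi>\<close> satisfies a linear
  inequality that preserves nonnegativity.\<close>

lemma gronwall_zero:
  fixes w :: "real \<Rightarrow> real"
  assumes cont: "continuous_on {a..b} w" and nonneg: "\<And>t. t \<in> {a..b} \<Longrightarrow> w t \<ge> 0" and "L \<ge> 0"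
    and le: "\<And>t. t \<in> {a..b} \<Longrightarrow> w t \<le> L * integral {a..t} w"
    and t: "t \<in> {a..b}"
  shows "w t = 0"
proof -
  define \<Phi> where "\<Phi> t = integral {a..t} w" for t
  have cont\<Phi>: "continuous_on {a..b} \<Phi>"
    unfolding \<Phi>_def by (intro indefinite_integral_continuous_1 integrable_continuous_real cont)
  have "- \<Phi> t \<ge> 0"
  proof (rule nonneg_of_linear_ode[where a = a and z = "\<lambda>t. - \<Phi> t" and E = "{}" and k = "- L"])
    show "continuous_on {a..t} (\<lambda>t. - \<Phi> t)"
      using t by (intro continuous_intros continuous_on_subset[OF cont\<Phi>]) auto
    fix r assume r: "a < r" "r < t"
    have "(\<Phi> has_real_derivative w r) (at r within {a..b})"
      unfolding \<Phi>_def using r t by (intro integral_has_real_derivative cont) auto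
    then have "(\<Phi> has_real_derivative w r) (at r)" using r t by (simp add: at_within_Icc_at)
    from DERIV_minus[OF this]
    show "\<exists>D. ((\<lambda>t. - \<Phi> t) has_real_derivative D) (at r) \<and> - (- L) * - \<Phi> r \<le> D"
      using le[of r] r t by (intro exI[of _ "- w r"]) (auto simp: \<Phi>_def)
  qed (use t in \<open>auto simp: \<Phi>_def\<close>)
  then have "L * \<Phi> t \<le> 0" using \<open>L \<ge> 0\<close> by (simp add: mult_nonneg_nonpos)
  then show ?thesis using le[OF t] nonneg[OF t] by (simp add: \<Phi>_def)
qed

section \<open>The sampled delay estimate\<close>

lemma samp_less: "Tsamp d > 0 \<Longrightarrow> samp d i < samp d j \<longleftrightarrow> i < j"
  by (simp add: samp_def)

text \<open>\<open>Nwin d \<ge> 1\<close> admits index \<open>i\<close> to the minimum, so the data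
  window always covers the last sampling interval.\<close>

lemma mu_Suc_bounds:
  assumes "Tsamp d > 0" "Nwin d \<ge> 1"
  shows "0 \<le> mu_Suc d i" "mu_Suc d i \<le> samp d i"
proof -
  let ?A = "{samp d g | g. g \<in> {0..i} \<and> samp d g \<ge> samp d (i + 1) - real (Nwin d) * Tsamp d}"
  have fin: "finite ?A"
    by (rule finite_subset[of _ "samp d ` {0..i}"]) auto
  have "Tsamp d * 1 \<le> Tsamp d * real (Nwin d)"
    using assms by (intro mult_left_mono) auto
  then have mem: "samp d i \<in> ?A" by (auto simp: samp_def algebra_simps)
  then have "Min ?A \<in> ?A" using fin by (intro Min_in) auto
  then show "0 \<le> mu_Suc d i" using assms by (auto simp: mu_Suc_def samp_def)
  show "mu_Suc d i \<le> samp d i" unfolding mu_Suc_def by (rule Min_le[OF fin mem])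
qed

text \<open>\<open>U\<close> and \<open>E\<close> are the witnesses of the existentials in
  \<open>closed_loop\<close> and \<open>plant_solution\<close>. The predictor recorded is the one
  for the true delay: it gives the nominal law after \<open>tf\<close> and the comparison value in
  the extremum over \<open>D_0\<close> before.\<close>

locale adaptive_loop = backstepping p d for p d +
  fixes s :: "real \<Rightarrow> real" and Y X :: "real \<Rightarrow> nat \<Rightarrow> real" and P :: "real \<Rightarrow> real \<Rightarrow> nat \<Rightarrow> real"
    and tf :: real and U :: "real \<Rightarrow> real" and E :: "real set"
  assumes Dlow: "0 < Dlow d" "Dlow d \<le> delay p" "delay p \<le> Dup d"
    and target: "smooth_target (ny p + nx p) s"
    and params: "cbar d > 0" "Tsamp d > 0" "Nwin d \<ge> 1" "Dhat0 d \<in> {Dlow d..Dup d}"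
    and tf: "is_tf p d X tf"
    and pred: "\<And>t. t \<ge> 0 \<Longrightarrow> is_predictor p Y X (delay p) t (P (delay p))"
    and input: "\<And>t. t \<ge> 0 \<Longrightarrow> is_adaptive_input p d s P X tf t (U t)"
    and contY: "\<And>i. i \<in> {1..ny p} \<Longrightarrow> continuous_on {0..} (\<lambda>t. Y t i)"
    and contX: "\<And>j. j \<in> {1..nx p} \<Longrightarrow> continuous_on {0..} (\<lambda>t. X t j)"
    and E: "countable E"
    and derY: "\<And>t i. t > 0 \<Longrightarrow> t \<notin> E \<Longrightarrow> i \<in> {1..ny p} \<Longrightarrow>
      ((\<lambda>t. Y t i) has_real_derivative fY p (Y t) (bcoef p * X (t - delay p) 1) i) (at t)"
    and derX: "\<And>t j. t > 0 \<Longrightarrow> t \<notin> E \<Longrightarrow> j \<in> {1..nx p} \<Longrightarrow>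
      ((\<lambda>t. X t j) has_real_derivative fX p (X t) (U t) j) (at t)"
    and hist: "\<And>t. t \<in> {- delay p..<0} \<Longrightarrow> X t 1 = 0"
begin

sublocale input_history p X
  by standard (use Dlow hist contX[of 1] nx in auto)

text \<open>
  Since \<open>F = D G\<close>, the feasible set of the identifier is either all of \<open>D\<^sub>0\<close> or the single point \<open>D\<close>.
\<close>

lemma Gq_Fq_feasible_iff:
  assumes "q \<ge> 1"
  shows "Gq p X q (samp d (i + 1)) (mu_Suc d i) * l = Fq p X q (samp d (i + 1)) (mu_Suc d i)
    \<longleftrightarrow> Gq p X q (samp d (i + 1)) (mu_Suc d i) = 0 \<or> l = delay p"
  using Fq_eq_Gq[OF assms mu_Suc_bounds(1)[OF params(2,3)]] by auto

text \<open>With every \<open>Gq\<close> zero the \<open>Fq\<close> vanish too, so all of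
  \<open>D_0\<close> is feasible and the nearest feasible point is the previous estimate.\<close>

lemma Dhat_Suc_unexcited:
  assumes prev: "Dhat_samp p d X i \<in> {Dlow d..Dup d}"
    and G: "\<And>q. q \<ge> 1 \<Longrightarrow> Gq p X q (samp d (i + 1)) (mu_Suc d i) = 0"
  shows "Dhat_samp p d X (Suc i) = Dhat_samp p d X i"
proof -
  let ?f = "\<lambda>l. \<bar>l - Dhat_samp p d X i\<bar>\<^sup>2"
  let ?P = "\<lambda>l. l \<in> {Dlow d..Dup d} \<and>
          (\<forall>q\<ge>1. Gq p X q (samp d (i + 1)) (mu_Suc d i) * l = Fq p X q (samp d (i + 1)) (mu_Suc d i))"
  have "Fq p X q (samp d (i + 1)) (mu_Suc d i) = 0" if "q \<ge> 1" for q
    using Fq_eq_Gq[OF that mu_Suc_bounds(1)[OF params(2,3)]] G[OF that] by simp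
  \<comment> \<open>\<open>arg_min\<close> is a choice operator; the minimal value zero of the
    squared distance is what forces the chosen point to be the previous estimate.\<close>
  then have "?f (arg_min ?f ?P) = ?f (Dhat_samp p d X i)"
    using prev G by (intro arg_min_equality) auto
  then show ?thesis by simp
qed

lemma Dhat_Suc_excited:
  assumes G: "q \<ge> 1" "Gq p X q (samp d (i + 1)) (mu_Suc d i) \<noteq> 0"
  shows "Dhat_samp p d X (Suc i) = delay p"
proof -
  have feas: "(l \<in> {Dlow d..Dup d} \<and> (\<forall>q\<ge>1. Gq p X q (samp d (i + 1)) (mu_Suc d i) * l
      = Fq p X q (samp d (i + 1)) (mu_Suc d i))) \<longleftrightarrow> l = delay p" for l
    using G Dlow Gq_Fq_feasible_iff[of _ i l] by auto
  show ?thesis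
    unfolding Dhat_samp.simps feas by (rule arg_minI) auto
qed

lemma Dhat_samp_mem: "Dhat_samp p d X i \<in> {Dlow d..Dup d}"
proof (induction i)
  case (Suc i)
  show ?case
  proof (cases "\<exists>q\<ge>1. Gq p X q (samp d (i + 1)) (mu_Suc d i) \<noteq> 0")
    case True
    then show ?thesis using Dhat_Suc_excited[of _ i] Dlow by auto
  next
    case False
    then show ?thesis using Dhat_Suc_unexcited[OF Suc.IH] Suc.IH by auto
  qed
qed (use params in simp)

text \<open>An unexcited step keeps the estimate and an excited one returns the true delay, so a
  correct estimate is never lost.\<close>

lemma Dhat_samp_stays:
  assumes "Dhat_samp p d X i = delay p" "i \<le> j"
  shows "Dhat_samp p d X j = delay p"
  using assms(2)
proof (induction rule: dec_induct)
  case (step j)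
  show ?case
  proof (cases "\<exists>q\<ge>1. Gq p X q (samp d (j + 1)) (mu_Suc d j) \<noteq> 0")
    case True
    then show ?thesis using Dhat_Suc_excited[of _ j] by auto
  next
    case False
    then show ?thesis using Dhat_Suc_unexcited[OF Dhat_samp_mem, of j] step.IH by auto
  qed
qed (rule assms(1))

text \<open>By minimality of \<open>tf\<close> the first nonzero input profile occurs in the
  sampling interval ending at \<open>tf\<close>. The window at \<open>tf\<close> covers that
  interval, so some \<open>Gq\<close> is excited.\<close>

lemma identified: "\<exists>i. tf = samp d i \<and> Dhat_samp p d X i = delay p"
proof -
  let ?u = "\<lambda>i. \<exists>t'\<in>{0..<samp d i}. \<exists>x\<in>{0..1}. ufun p X x t' \<noteq> 0"
  obtain i where i: "tf = samp d i" "?u i" and min: "\<And>j. ?u j \<Longrightarrow> samp d i \<le> samp d j"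
    using tf unfolding is_tf_def is_arg_min_linorder by blast
  obtain t' x where t': "0 \<le> t'" "t' < samp d i" "x \<in> {0..1}" "ufun p X x t' \<noteq> 0" using i(2) by auto
  then have "i > 0" by (cases i) (auto simp: samp_def)
  then obtain j where j: "i = Suc j" by (cases i) auto
  have "samp d j \<le> t'"
  proof (rule ccontr)
    assume "\<not> samp d j \<le> t'"
    then have "t' \<in> {0..<samp d j}" using t' by simp
    then have "?u j" using t'(3,4) by blast
    then show False using min[of j] samp_less[OF params(2), of j i] j by simp
  qed
  then obtain q where "q \<ge> 1" "Gq p X q (samp d i) (mu_Suc d j) \<noteq> 0"
    using exists_Gq_nonzero[of "mu_Suc d j" t' "samp d i" x] mu_Suc_bounds[OF params(2,3), of j] t' by auto
  then show ?thesis using Dhat_Suc_excited[of q j] i j by auto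
qed

lemma tf_nonneg: "tf \<ge> 0"
  using identified params(2) by (auto simp: samp_def)

lemma Dhat_bounded: "bounded (Dhat p d X ` {0..})"
  by (rule bounded_subset[OF bounded_closed_interval[of "Dlow d" "Dup d"]])
    (use Dhat_samp_mem in \<open>auto simp: Dhat_def\<close>)

lemma Dhat_eq_delay:
  assumes "t \<ge> tf" shows "Dhat p d X t = delay p"
proof -
  obtain i where i: "tf = samp d i" "Dhat_samp p d X i = delay p" using identified by blast
  have "real i \<le> t / Tsamp d" using assms i params(2) by (simp add: samp_def field_simps)
  then have "i \<le> nat \<lfloor>t / Tsamp d\<rfloor>" by (simp add: le_nat_floor)
  then show ?thesis unfolding Dhat_def using Dhat_samp_stays i(2) by blast
qed

section \<open>The predictor for the true delay is the shifted state\<close>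

lemma fY_split: "fY p y u i = fY p y 0 i + (if i < ny p then 0 else u)"
  by (simp add: fY_def)

lemma fY_regular:
  assumes "i \<in> {1..ny p}"
  shows "smooth (Suc 0) (\<lambda>y. fY p y 0 i)" "depends_on {1..ny p} (\<lambda>y. fY p y 0 i)"
proof -
  have "smooth (Suc 0) (psi p i)"
    by (rule smooth_mono[OF psi_regular(1)[OF assms]]) (use assms nx in auto)
  then show "smooth (Suc 0) (\<lambda>y. fY p y 0 i)"
    unfolding fY_def by (cases "i < ny p") (auto intro!: smooth_intros simp del: smooth.simps(2))
  have "depends_on {1..ny p} (psi p i)"
    by (rule depends_on_mono[OF psi_regular(2)[OF assms]]) (use assms in auto)
  then show "depends_on {1..ny p} (\<lambda>y. fY p y 0 i)"
    unfolding fY_def using assms by (cases "i < ny p") (auto intro!: depends_on_intros depends_on_coord)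
qed

lemma fY_cong:
  assumes "i \<in> {1..ny p}" "\<And>k. k \<in> {1..ny p} \<Longrightarrow> y k = y' k"
  shows "fY p y u i = fY p y' u i"
  using depends_onD[OF fY_regular(2)[OF assms(1)], of y y'] assms(2) fY_split[of y u i] fY_split[of y' u i] by simp

text \<open>The vector field is affine in the input, which separates a part continuous along the
  curve from the possibly jumping input.\<close>

lemma fY_integrable:
  assumes i: "i \<in> {1..ny p}" and c: "\<And>k. k \<in> {1..ny p} \<Longrightarrow> continuous_on {a..b} (\<lambda>t. c t k)"
  shows "(\<lambda>\<sigma>. fY p (c \<sigma>) (v \<sigma>) i) integrable_on {a..b}"
proof -
  have "(\<lambda>\<sigma>. fY p (c \<sigma>) 0 i) integrable_on {a..b}"
    by (intro integrable_continuous_real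
        continuous_on_depends[where F = "\<lambda>y. fY p y 0 i" and I = "{1..ny p}" and c = c] c
        smooth_continuous[OF fY_regular(1)[OF i]] fY_regular(2)[OF i])
  moreover have "(\<lambda>\<sigma>. v \<sigma> * (if i < ny p then 0 else 1)) integrable_on {a..b}"
    by (intro v_mult_integrable continuous_intros)
  ultimately have "(\<lambda>\<sigma>. fY p (c \<sigma>) 0 i + v \<sigma> * (if i < ny p then 0 else 1)) integrable_on {a..b}"
    by (rule integrable_add)
  then show ?thesis by (simp add: fY_split[of _ "v _"] if_distrib cong: if_cong)
qed

lemma shifted_has_derivative:
  assumes i: "i \<in> {1..ny p}" and "- delay p < \<sigma>" "\<sigma> + delay p \<notin> E"
  shows "((\<lambda>\<sigma>. Y (\<sigma> + delay p) i) has_real_derivative fY p (Y (\<sigma> + delay p)) (v \<sigma>) i) (at \<sigma>)"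
proof -
  have "((\<lambda>t. Y t i) has_real_derivative fY p (Y (\<sigma> + delay p)) (v \<sigma>) i) (at (\<sigma> + delay p))"
    using derY[of "\<sigma> + delay p" i] assms by (simp add: v_eq)
  then show ?thesis by (simp add: DERIV_shift)
qed

lemma shifted_cont:
  assumes "i \<in> {1..ny p}" shows "continuous_on {- delay p..} (\<lambda>\<sigma>. Y (\<sigma> + delay p) i)"
  by (rule continuous_on_compose2[OF contY[OF assms]]) (auto intro!: continuous_intros)

lemma shifted_integral:
  assumes i: "i \<in> {1..ny p}" and ab: "- delay p \<le> a" "a \<le> b"
  shows "integral {a..b} (\<lambda>\<sigma>. fY p (Y (\<sigma> + delay p)) (v \<sigma>) i) = Y (b + delay p) i - Y (a + delay p) i"
proof -
  have cont: "continuous_on S (\<lambda>\<sigma>. Y (\<sigma> + delay p) k)" if "k \<in> {1..ny p}" "S \<subseteq> {- delay p..}" for k S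
    by (rule continuous_on_subset[OF shifted_cont[OF that(1)] that(2)])
  show ?thesis
  proof (rule integral_off_countable[where f = "\<lambda>\<sigma>. Y (\<sigma> + delay p) i" and E = "insert 0 ((\<lambda>e. e - delay p) ` E)"])
    show "continuous_on {a..b} (\<lambda>\<sigma>. Y (\<sigma> + delay p) i)" using ab by (intro cont i) auto
    show "countable (insert 0 ((\<lambda>e. e - delay p) ` E))" using E by simp
    show "(\<lambda>\<sigma>. fY p (Y (\<sigma> + delay p)) (v \<sigma>) i) integrable_on {a..b}"
      using ab by (intro fY_integrable i cont) auto
    fix t assume t: "a < t" "t < b" "t \<notin> insert 0 ((\<lambda>e. e - delay p) ` E)"
    have "continuous_on {a<..<b} (\<lambda>\<sigma>. fY p (Y (\<sigma> + delay p)) 0 i)"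
      using ab by (intro continuous_on_depends[where F = "\<lambda>y. fY p y 0 i" and I = "{1..ny p}"
            and c = "\<lambda>\<sigma>. Y (\<sigma> + delay p)"] cont
        smooth_continuous[OF fY_regular(1)[OF i]] fY_regular(2)[OF i]) auto
    then have 1: "isCont (\<lambda>\<sigma>. fY p (Y (\<sigma> + delay p)) 0 i) t"
      using t by (simp add: continuous_on_eq_continuous_at)
    have 2: "isCont (\<lambda>\<sigma>. if i < ny p then 0 else v \<sigma>) t"
      using t v_isCont[of t] by (cases "i < ny p") auto
    show "isCont (\<lambda>\<sigma>. fY p (Y (\<sigma> + delay p)) (v \<sigma>) i) t"
      using isCont_add[OF 1 2] by (simp add: fY_split[of _ "v _"])
    have "t + delay p \<notin> E" using t(3) by force
    then show "((\<lambda>\<sigma>. Y (\<sigma> + delay p) i) has_real_derivative fY p (Y (t + delay p)) (v t) i) (at t)"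
      using t ab by (intro shifted_has_derivative i) auto
  qed (rule ab(2))
qed

lemma predictor_facts:
  assumes i: "i \<in> {1..ny p}"
  shows "continuous_on {- delay p..} (\<lambda>t. P (delay p) t i)"
    and "t \<in> {- delay p..0} \<Longrightarrow> P (delay p) t i = Y 0 i + integral {- delay p..t} (\<lambda>\<sigma>. fY p (P (delay p) \<sigma>) (v \<sigma>) i)"
    and "t \<ge> 0 \<Longrightarrow> P (delay p) t i = Y t i + integral {t - delay p..t} (\<lambda>\<sigma>. fY p (P (delay p) \<sigma>) (v \<sigma>) i)"
proof -
  have *: "continuous_on {- delay p..h} (\<lambda>t. P (delay p) t i) \<and>
      (\<forall>\<theta>\<in>{- delay p..0}. P (delay p) \<theta> i = Y 0 i + integral {- delay p..\<theta>} (\<lambda>\<sigma>. fY p (P (delay p) \<sigma>) (v \<sigma>) i)) \<and>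
      (\<forall>t\<in>{0..h}. P (delay p) t i = Y t i + integral {t - delay p..t} (\<lambda>\<sigma>. fY p (P (delay p) \<sigma>) (v \<sigma>) i))"
    if "h \<ge> 0" for h
    using pred[OF that] i unfolding is_predictor_def Let_def v_def by blast
  show "t \<in> {- delay p..0} \<Longrightarrow> P (delay p) t i = Y 0 i + integral {- delay p..t} (\<lambda>\<sigma>. fY p (P (delay p) \<sigma>) (v \<sigma>) i)"
    using *[of 0] by blast
  show "t \<ge> 0 \<Longrightarrow> P (delay p) t i = Y t i + integral {t - delay p..t} (\<lambda>\<sigma>. fY p (P (delay p) \<sigma>) (v \<sigma>) i)"
    using *[of t] by auto
  show "continuous_on {- delay p..} (\<lambda>t. P (delay p) t i)"
    unfolding continuous_on_eq_continuous_within
  proof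
    fix t assume t: "t \<in> {- delay p..}"
    have "continuous (at t within {- delay p..max 0 t + 1}) (\<lambda>t. P (delay p) t i)"
      using *[of "max 0 t + 1"] t by (auto simp: continuous_on_eq_continuous_within)
    moreover have "at t within {- delay p..max 0 t + 1} = at t within {- delay p..}"
      by (rule at_within_nhd[of _ "{..<max 0 t + 1}"]) auto
    ultimately show "continuous (at t within {- delay p..}) (\<lambda>t. P (delay p) t i)" by simp
  qed
qed

text \<open>Predictor and shifted state solve the same integral equations. On a bounded interval
  both stay in one box, where the vector field is Lipschitz in the state, and Gronwall forces their
  distance to vanish.\<close>

lemma predictor_eq:
  assumes "i \<in> {1..ny p}" "t \<ge> - delay p"
  shows "P (delay p) t i = Y (t + delay p) i"
proof -
  let ?P = "P (delay p)" and ?Q = "\<lambda>t. Y (t + delay p)" and ?a = "- delay p"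
  let ?I = "{1..ny p}"
  define T where "T = max 0 t"
  have Pc: "continuous_on S (\<lambda>t. ?P t k)" if "k \<in> ?I" "S \<subseteq> {?a..}" for k S
    by (rule continuous_on_subset[OF predictor_facts(1)[OF that(1)] that(2)])
  have Qc: "continuous_on S (\<lambda>t. ?Q t k)" if "k \<in> ?I" "S \<subseteq> {?a..}" for k S
    by (rule continuous_on_subset[OF shifted_cont[OF that(1)] that(2)])
  obtain R1 where R1: "\<And>t k. t \<in> {?a..T} \<Longrightarrow> k \<in> ?I \<Longrightarrow> \<bar>?P t k\<bar> \<le> R1"
  proof -
    have "\<exists>R\<ge>0. \<forall>t\<in>{?a..T}. \<forall>k\<in>?I. \<bar>?P t k\<bar> \<le> R"
      by (rule bounded_family) (auto intro!: Pc)
    then show ?thesis using that by blast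
  qed
  obtain R2 where R2: "\<And>t k. t \<in> {?a..T} \<Longrightarrow> k \<in> ?I \<Longrightarrow> \<bar>?Q t k\<bar> \<le> R2"
  proof -
    have "\<exists>R\<ge>0. \<forall>t\<in>{?a..T}. \<forall>k\<in>?I. \<bar>?Q t k\<bar> \<le> R"
      by (rule bounded_family) (auto intro!: Qc)
    then show ?thesis using that by blast
  qed
  define lip where "lip k L \<longleftrightarrow> L \<ge> 0 \<and> (\<forall>z z'. (\<forall>i\<in>?I. \<bar>z i\<bar> \<le> max R1 R2) \<longrightarrow>
      (\<forall>i\<in>?I. \<bar>z' i\<bar> \<le> max R1 R2) \<longrightarrow>
      \<bar>fY p z 0 k - fY p z' 0 k\<bar> \<le> L * (\<Sum>i\<in>?I. \<bar>z i - z' i\<bar>))" for k L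
  have "\<exists>L. lip k L" if k: "k \<in> ?I" for k
    unfolding lip_def
    by (rule lipschitz_on_box[OF _ fY_regular(1)[OF k] fY_regular(2)[OF k], where R = "max R1 R2"])
      (simp, blast)
  then obtain L where "\<And>k. k \<in> ?I \<Longrightarrow> lip k (L k)" by metis
  then have L: "\<And>k. k \<in> ?I \<Longrightarrow> L k \<ge> 0"
    "\<And>k z z'. k \<in> ?I \<Longrightarrow> (\<forall>i\<in>?I. \<bar>z i\<bar> \<le> max R1 R2) \<Longrightarrow> (\<forall>i\<in>?I. \<bar>z' i\<bar> \<le> max R1 R2)
      \<Longrightarrow> \<bar>fY p z 0 k - fY p z' 0 k\<bar> \<le> L k * (\<Sum>i\<in>?I. \<bar>z i - z' i\<bar>)"
    unfolding lip_def by blast+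
  define w where "w t = (\<Sum>i\<in>?I. \<bar>?P t i - ?Q t i\<bar>)" for t
  have wc: "continuous_on S w" if "S \<subseteq> {?a..}" for S
    unfolding w_def using that by (intro continuous_intros Pc Qc)
  have w0: "w t \<ge> 0" for t unfolding w_def by (intro sum_nonneg) auto
  have lip: "\<bar>fY p (?P \<sigma>) (v \<sigma>) k - fY p (?Q \<sigma>) (v \<sigma>) k\<bar> \<le> L k * w \<sigma>" if "\<sigma> \<in> {?a..T}" "k \<in> ?I" for \<sigma> k
  proof -
    have "\<bar>fY p (?P \<sigma>) 0 k - fY p (?Q \<sigma>) 0 k\<bar> \<le> L k * w \<sigma>"
      unfolding w_def using that R1 R2 by (intro L(2)) (auto simp: le_max_iff_disj)
    then show ?thesis by (simp add: fY_split[of _ "v _"])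
  qed
  have err: "\<bar>?P r k - ?Q r k\<bar> \<le> L k * integral {?a..r} w" if r: "r \<in> {?a..T}" and k: "k \<in> ?I" for r k
  proof -
    \<comment> \<open>In both regimes of the predictor equation the term outside the integral is the
      shifted state at \<open>lo\<close>. It cancels in the difference, and enlarging the domain to
      start at \<open>- delay p\<close> gives the Gronwall form.\<close>
    define lo where "lo = (if r \<le> 0 then ?a else r - delay p)"
    have lo: "?a \<le> lo" "lo \<le> r" using r delay by (auto simp: lo_def)
    have "?P r k = ?Q lo k + integral {lo..r} (\<lambda>\<sigma>. fY p (?P \<sigma>) (v \<sigma>) k)"
      using predictor_facts(2,3)[OF k, of r] r by (auto simp: lo_def)
    moreover have "?Q r k = ?Q lo k + integral {lo..r} (\<lambda>\<sigma>. fY p (?Q \<sigma>) (v \<sigma>) k)"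
      using shifted_integral[OF k lo] by simp
    moreover have int: "(\<lambda>\<sigma>. fY p (?P \<sigma>) (v \<sigma>) k) integrable_on {lo..r}" "(\<lambda>\<sigma>. fY p (?Q \<sigma>) (v \<sigma>) k) integrable_on {lo..r}"
      using lo by (intro fY_integrable k Pc Qc; auto)+
    ultimately have "?P r k - ?Q r k = integral {lo..r} (\<lambda>\<sigma>. fY p (?P \<sigma>) (v \<sigma>) k - fY p (?Q \<sigma>) (v \<sigma>) k)"
      by (simp add: integral_diff)
    also have "norm \<dots> \<le> integral {lo..r} (\<lambda>\<sigma>. L k * w \<sigma>)"
    proof (rule integral_norm_bound_integral)
      show "(\<lambda>\<sigma>. fY p (?P \<sigma>) (v \<sigma>) k - fY p (?Q \<sigma>) (v \<sigma>) k) integrable_on {lo..r}"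
        by (intro integrable_diff int)
      show "(\<lambda>\<sigma>. L k * w \<sigma>) integrable_on {lo..r}"
        using lo by (intro integrable_continuous_real continuous_intros wc) auto
    qed (use lip k lo r in auto)
    also have "\<dots> = L k * integral {lo..r} w" by simp
    also have "\<dots> \<le> L k * integral {?a..r} w"
      using lo w0 L(1)[OF k]
      by (intro mult_left_mono integral_subset_le integrable_continuous_real wc) auto
    finally show ?thesis by simp
  qed
  have wzero: "w t = 0"
  proof (rule gronwall_zero[where w = w and t = t and a = ?a and b = T and L = "sum L ?I"])
    show "continuous_on {?a..T} w" by (rule wc) auto
    show "sum L ?I \<ge> 0" using L(1) by (rule sum_nonneg)
    show "w r \<le> sum L ?I * integral {?a..r} w" if "r \<in> {?a..T}" for r
      unfolding w_def[of r] sum_distrib_right by (intro sum_mono err that)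
    show "t \<in> {?a..T}" using assms(2) by (simp add: T_def)
  qed (rule w0)
  then have "\<bar>?P t i - ?Q t i\<bar> = 0"
    unfolding w_def using assms(1) by (subst (asm) sum_nonneg_eq_0_iff) auto
  then show ?thesis by simp
qed

end

section \<open>The closed loop\<close>

context backstepping begin

text \<open>
  The components of X and the derivatives of Delta must be bounded alternately: the derivative of
  order \<open>j\<close> involves the components up to \<open>j\<close>, and the component \<open>j + 1\<close> the derivatives up to order \<open>j\<close>.
\<close>

lemma loop_bounded:
  "\<exists>B\<ge>0. \<forall>P X w. (\<forall>i\<in>{1..ny p}. \<bar>Y.err i P w\<bar> \<le> R) \<longrightarrow>
     (\<forall>j\<in>{1..nx p}. \<bar>X.err j X (Delta_jet p d P X w)\<bar> \<le> R) \<longrightarrow> (\<forall>k<ny p + nx p. \<bar>w k\<bar> \<le> R) \<longrightarrow>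
     (\<forall>i\<in>{1..ny p}. \<bar>P i\<bar> \<le> B) \<and> (\<forall>j\<in>{1..nx p}. \<bar>X j\<bar> \<le> B)"
proof -
  define ok where "ok P X w \<longleftrightarrow> (\<forall>i\<in>{1..ny p}. \<bar>Y.err i P w\<bar> \<le> R) \<and>
     (\<forall>j\<in>{1..nx p}. \<bar>X.err j X (Delta_jet p d P X w)\<bar> \<le> R) \<and> (\<forall>k<ny p + nx p. \<bar>w k\<bar> \<le> R)" for P X w
  obtain B0 where B0: "\<forall>P w. (\<forall>i\<in>{1..ny p}. \<bar>Y.err i P w\<bar> \<le> R) \<longrightarrow> (\<forall>k<ny p. \<bar>w k\<bar> \<le> R)
     \<longrightarrow> (\<forall>i\<in>{1..ny p}. \<bar>P i\<bar> \<le> B0)"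
    using Y.state_bounded[of "ny p" R] by auto
  have B0: "\<bar>P i\<bar> \<le> B0" if "ok P X w" "i \<in> {1..ny p}" for P X w i
  proof -
    from that(1) have "\<forall>i\<in>{1..ny p}. \<bar>Y.err i P w\<bar> \<le> R" "\<forall>k<ny p. \<bar>w k\<bar> \<le> R"
      by (auto simp: ok_def)
    then show ?thesis using B0 that(2) by blast
  qed
  have "\<exists>B\<ge>0. \<forall>P X w. ok P X w \<longrightarrow> (\<forall>l\<in>{1..j}. \<bar>X l\<bar> \<le> B) \<and> (\<forall>k<j. \<bar>Delta p d k P X w\<bar> \<le> B)"
    if "j \<le> nx p" for j
    using that
  proof (induction j)
    case 0
    show ?case by (rule exI[of _ 0]) simp
  next
    case (Suc j)
    then obtain B where B: "B \<ge> 0" "\<And>P X w l. ok P X w \<Longrightarrow> l \<in> {1..j} \<Longrightarrow> \<bar>X l\<bar> \<le> B"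
      "\<And>P X w k. ok P X w \<Longrightarrow> k < j \<Longrightarrow> \<bar>Delta p d k P X w\<bar> \<le> B" by (auto 0 3)
    define R' where "R' = max (max B0 B) R"
    obtain B' where B': "B' \<ge> 0" "\<And>P X w. (\<forall>i\<in>{1..ny p}. \<bar>P i\<bar> \<le> R') \<Longrightarrow> (\<forall>l\<in>{1..j}. \<bar>X l\<bar> \<le> R') \<Longrightarrow>
      (\<forall>k\<le>ny p + j. \<bar>w k\<bar> \<le> R') \<Longrightarrow> \<bar>Delta p d j P X w\<bar> \<le> B'"
      using Delta_bounded[of j R'] Suc.prems by auto
    have DB': "\<bar>Delta p d j P X w\<bar> \<le> B'" if "ok P X w" for P X w
    proof (rule B'(2))
      show "\<forall>i\<in>{1..ny p}. \<bar>P i\<bar> \<le> R'" using B0[OF that] by (auto simp: R'_def le_max_iff_disj)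
      show "\<forall>l\<in>{1..j}. \<bar>X l\<bar> \<le> R'" using B(2)[OF that] by (auto simp: R'_def le_max_iff_disj)
      show "\<forall>k\<le>ny p + j. \<bar>w k\<bar> \<le> R'"
        using that Suc.prems by (auto simp: R'_def le_max_iff_disj ok_def)
    qed
    define R'' where "R'' = max (max B B') R"
    obtain B'' where B'': "B'' \<ge> 0" "\<And>X w. (\<forall>i\<in>{1..Suc j}. \<bar>X.err i X w\<bar> \<le> R'') \<Longrightarrow> (\<forall>k<Suc j. \<bar>w k\<bar> \<le> R'')
      \<Longrightarrow> (\<forall>i\<in>{1..Suc j}. \<bar>X i\<bar> \<le> B'')"
      using X.state_bounded[of "Suc j" R''] Suc.prems by auto
    show ?case
    proof (intro exI[of _ "max B'' (max B B')"] conjI allI impI)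
      show "0 \<le> max B'' (max B B')" using B(1) by simp
      fix P X w assume ok: "ok P X w"
      have Dl: "\<bar>Delta p d k P X w\<bar> \<le> max B B'" if "k < Suc j" for k
        using DB'[OF ok] B(3)[OF ok, of k] that by (cases "k = j") (auto simp: le_max_iff_disj)
      have "\<forall>i\<in>{1..Suc j}. \<bar>X i\<bar> \<le> B''"
      proof (rule B''(2))
        show "\<forall>i\<in>{1..Suc j}. \<bar>X.err i X (Delta_jet p d P X w)\<bar> \<le> R''"
          using ok Suc.prems by (auto simp: R''_def ok_def le_max_iff_disj)
        show "\<forall>k<Suc j. \<bar>Delta_jet p d P X w k\<bar> \<le> R''"
          using Dl by (auto simp: R''_def Delta_jet_def le_max_iff_disj)
      qed
      then show "\<forall>l\<in>{1..Suc j}. \<bar>X l\<bar> \<le> max B'' (max B B')" by (auto simp: le_max_iff_disj)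
      show "\<bar>Delta p d k P X w\<bar> \<le> max B'' (max B B')" if "k < Suc j" for k
        using Dl[OF that] by (simp add: le_max_iff_disj)
    qed
  qed
  from this[of "nx p"] obtain B where B: "B \<ge> 0" "\<And>P X w l. ok P X w \<Longrightarrow> l \<in> {1..nx p} \<Longrightarrow> \<bar>X l\<bar> \<le> B"
    by (auto 0 3)
  show ?thesis
  proof (intro exI[of _ "max B0 B"] conjI allI impI ballI)
    show "0 \<le> max B0 B" using B(1) by simp
    fix P X w i
    assume "\<forall>i\<in>{1..ny p}. \<bar>Y.err i P w\<bar> \<le> R"
      "\<forall>j\<in>{1..nx p}. \<bar>X.err j X (Delta_jet p d P X w)\<bar> \<le> R" "\<forall>k<ny p + nx p. \<bar>w k\<bar> \<le> R"
    then have ok: "ok P X w" by (simp add: ok_def)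
    show "\<bar>P i\<bar> \<le> max B0 B" if "i \<in> {1..ny p}" using B0[OF ok that] by simp
    show "\<bar>X i\<bar> \<le> max B0 B" if "i \<in> {1..nx p}" using B(2)[OF ok that] by simp
  qed
qed

text \<open>The same alternation as for boundedness; decay passes through Delta of order
  \<open>j < nx p\<close> because it is locally Lipschitz and vanishes at the origin.\<close>

lemma loop_decays:
  assumes Yerr: "\<And>i. i \<in> {1..ny p} \<Longrightarrow> decays_exponentially (\<lambda>t. Y.err i (P t) (w t))"
    and Xerr: "\<And>j. j \<in> {1..nx p} \<Longrightarrow> decays_exponentially (\<lambda>t. X.err j (X t) (Delta_jet p d (P t) (X t) (w t)))"
    and w: "\<And>k. k < ny p + nx p \<Longrightarrow> decays_exponentially (\<lambda>t. w t k)"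
  shows "i \<in> {1..ny p} \<Longrightarrow> decays_exponentially (\<lambda>t. P t i)"
    and "j \<in> {1..nx p} \<Longrightarrow> decays_exponentially (\<lambda>t. X t j)"
proof -
  have P: "decays_exponentially (\<lambda>t. P t i)" if "i \<in> {1..ny p}" for i
    by (rule Y.state_decays[OF order_refl Yerr w that]) auto
  then show "i \<in> {1..ny p} \<Longrightarrow> decays_exponentially (\<lambda>t. P t i)" .
  have "j \<le> nx p \<Longrightarrow> (\<forall>l\<in>{1..j}. decays_exponentially (\<lambda>t. X t l)) \<and>
      (\<forall>k<j. decays_exponentially (\<lambda>t. Delta_jet p d (P t) (X t) (w t) k))" for j
  proof (induction j)
    case (Suc j)
    have Dj: "decays_exponentially (\<lambda>t. Delta_jet p d (P t) (X t) (w t) j)"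
      unfolding Delta_jet_def using Suc by (intro Delta_decays P w) auto
    have D: "\<forall>k<Suc j. decays_exponentially (\<lambda>t. Delta_jet p d (P t) (X t) (w t) k)"
      using Dj Suc by (auto simp: less_Suc_eq)
    have "decays_exponentially (\<lambda>t. X t l)" if "l \<in> {1..Suc j}" for l
      by (rule X.state_decays[where n = "Suc j" and w = "\<lambda>t. Delta_jet p d (P t) (X t) (w t)"])
        (use Suc.prems D that Xerr in auto)
    then show ?case using D by blast
  qed simp
  then show "j \<in> {1..nx p} \<Longrightarrow> decays_exponentially (\<lambda>t. X t j)" by auto
qed

end

lemma vnorm_le:
  assumes "\<And>i. i \<in> {1..N} \<Longrightarrow> \<bar>x i\<bar> \<le> B"
  shows "vnorm N x \<le> real N * B"
proof -
  have "vnorm N x \<le> (\<Sum>i\<in>{1..N}. \<bar>x i\<bar>)" unfolding vnorm_def by (rule L2_set_le_sum_abs)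
  also have "\<dots> \<le> real N * B" using sum_bounded_above[of "{1..N}" "\<lambda>i. \<bar>x i\<bar>" B] assms by simp
  finally show ?thesis .
qed

text \<open>Positive times only: \<open>deriv\<close> is two-sided, so at zero it would see values
  of \<open>s\<close> at negative times.\<close>

lemma jet_zero:
  assumes "\<And>t. t \<ge> 0 \<Longrightarrow> s t = 0" and "t > 0"
  shows "jet s t k = 0"
  using assms(2)
proof (induction k arbitrary: t)
  case 0
  then show ?case using assms(1) by (simp add: jet_def)
next
  case (Suc k)
  have "(deriv ^^ k) s r = 0" if "r > 0" for r
    using Suc.IH[OF that] by (simp add: jet_def)
  then have "((deriv ^^ k) s has_real_derivative 0) (at t)"
    using Suc.prems
    by (intro has_field_derivative_transform_within_open[OF DERIV_const, where S = "{0<..}"]) auto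
  then show ?case by (simp add: jet_def DERIV_imp_deriv)
qed

section \<open>The error cascade along a solution\<close>

context adaptive_loop begin

text \<open>For \<open>t \<ge> 0\<close> the jet is read at a positive time, where the target is
  differentiable.\<close>

definition "w t = jet s (t + delay p)"
definition "\<delta> t = Delta_jet p d (P (delay p) t) (X t) (w t)"
definition "z = (\<lambda>i t. Y.err i (P (delay p) t) (w t))"
definition "r = (\<lambda>j t. X.err j (X t) (\<delta> t))"
text \<open>The predictor is the state shifted by the delay, so it inherits the exceptional times of
  \<open>Y\<close> shifted back.\<close>

definition "E' = E \<union> (\<lambda>e. e - delay p) ` E"

lemma countable_E': "countable E'"
  using E by (simp add: E'_def)

lemma P_cont: "i \<in> {1..ny p} \<Longrightarrow> continuous_on {0..} (\<lambda>t. P (delay p) t i)"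
  by (rule continuous_on_subset[OF predictor_facts(1)]) (use delay in auto)

lemma P_has_derivative:
  assumes t: "t > 0" "t \<notin> E'" and i: "i \<in> {1..ny p}"
  shows "((\<lambda>t. P (delay p) t i) has_real_derivative fY p (P (delay p) t) (bcoef p * X t 1) i) (at t)"
proof -
  have "t + delay p \<notin> E" using t(2) by (force simp: E'_def)
  then have "((\<lambda>\<sigma>. Y (\<sigma> + delay p) i) has_real_derivative fY p (Y (t + delay p)) (v t) i) (at t)"
    using t delay by (intro shifted_has_derivative i) auto
  moreover have "fY p (Y (t + delay p)) (v t) i = fY p (P (delay p) t) (bcoef p * X t 1) i"
  proof -
    have "P (delay p) t k = Y (t + delay p) k" if "k \<in> {1..ny p}" for k
      using predictor_eq[OF that] t delay by simp
    from fY_cong[OF i this] show ?thesis using t delay by (simp add: v_eq)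
  qed
  ultimately have der: "((\<lambda>\<sigma>. Y (\<sigma> + delay p) i) has_real_derivative
      fY p (P (delay p) t) (bcoef p * X t 1) i) (at t)" by (simp only:)
  show ?thesis
    by (rule has_field_derivative_transform_within_open[OF der, where S = "{0<..}"])
      (use t i delay in \<open>auto simp: predictor_eq\<close>)
qed

lemma w_has_derivative:
  assumes "t \<ge> 0" "k < ny p + nx p"
  shows "((\<lambda>t. w t k) has_real_derivative w t (k + 1)) (at t)"
proof -
  have "(deriv ^^ k) s differentiable at (t + delay p)"
    using target assms delay unfolding smooth_target_def by auto
  then have "((deriv ^^ k) s has_real_derivative (deriv ^^ (k + 1)) s (t + delay p)) (at (t + delay p))"
    by (simp add: DERIV_deriv_iff_real_differentiable)
  then show ?thesis by (simp add: w_def jet_def DERIV_shift)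
qed

lemma w_cont: "k < ny p + nx p \<Longrightarrow> continuous_on {0..} (\<lambda>t. w t k)"
  using w_has_derivative by (intro DERIV_continuous_on) (auto intro: has_field_derivative_at_within)

lemma X_has_derivative:
  assumes "t > 0" "t \<notin> E'" "j \<in> {1..<nx p}"
  shows "((\<lambda>t. X t j) has_real_derivative X t (j + 1) + phi p j (X t)) (at t)"
  using derX[of t j] assms by (simp add: E'_def fX_def)

lemma \<delta>_has_derivative:
  assumes "t > 0" "t \<notin> E'" "j < nx p"
  shows "((\<lambda>t. \<delta> t j) has_real_derivative \<delta> t (j + 1)) (at t)"
  unfolding \<delta>_def Delta_jet_def Suc_eq_plus1[symmetric]
  using assms by (intro Delta_has_derivative P_has_derivative X_has_derivative w_has_derivative[unfolded Suc_eq_plus1]) auto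

lemma \<delta>_cont: "j < nx p \<Longrightarrow> continuous_on {0..} (\<lambda>t. \<delta> t j)"
  unfolding \<delta>_def Delta_jet_def by (intro Delta_continuous P_cont contX w_cont) auto

lemma z_cont: "i \<in> {1..ny p} \<Longrightarrow> continuous_on {0..} (z i)"
  unfolding z_def by (intro Y.err_continuous P_cont w_cont) auto

lemma r_cont: "j \<in> {1..nx p} \<Longrightarrow> continuous_on {0..} (r j)"
  unfolding r_def by (intro X.err_continuous contX \<delta>_cont) auto

lemma z_has_derivative:
  assumes t: "t > 0" "t \<notin> E'" and i: "i \<in> {1..<ny p}"
  shows "(z i has_real_derivative - kgain d i * z i t + z (Suc i) t) (at t)"
  unfolding z_def
proof (rule Y.err_has_derivative)
  show "((\<lambda>t. P (delay p) t k) has_real_derivative P (delay p) t (k + 1) + psi p k (P (delay p) t)) (at t)"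
    if "k \<in> {1..i}" for k
    using P_has_derivative[OF t, of k] that i by (simp add: fY_def)
qed (use i t w_has_derivative in auto)

text \<open>The mismatch \<open>b x_1 - h_n - s^(n)\<close> of the Y-chain is \<open>r 1\<close>,
  because Delta is \<open>h_n + s^(n)\<close>; this is the coupling of the two chains.\<close>

lemma z_last_has_derivative:
  assumes t: "t > 0" "t \<notin> E'"
  shows "(z (ny p) has_real_derivative - kgain d (ny p) * z (ny p) t + r 1 t) (at t)"
proof -
  have "r 1 t = 1 * (bcoef p * X t 1) - Y.H (ny p) (P (delay p) t) (w t) - w t (ny p)"
    by (simp add: r_def X.err_def \<delta>_def Delta_jet_def hfun_virt)
  moreover have "((\<lambda>t. Y.err (ny p) (P (delay p) t) (w t)) has_real_derivative
      - kgain d (ny p) * Y.err (ny p) (P (delay p) t) (w t)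
      + (1 * (bcoef p * X t 1) - Y.H (ny p) (P (delay p) t) (w t) - w t (ny p))) (at t)"
  proof (rule Y.err_last_has_derivative[OF ny])
    show "((\<lambda>t. P (delay p) t k) has_real_derivative P (delay p) t (k + 1) + psi p k (P (delay p) t)) (at t)"
      if "k \<in> {1..<ny p}" for k
      using P_has_derivative[OF t, of k] that by (simp add: fY_def)
    show "((\<lambda>t. P (delay p) t (ny p)) has_real_derivative psi p (ny p) (P (delay p) t) + bcoef p * X t 1) (at t)"
      using P_has_derivative[OF t, of "ny p"] ny by (simp add: fY_def)
  qed (use t w_has_derivative in auto)
  ultimately show ?thesis by (simp add: z_def)
qed

lemma r_has_derivative:
  assumes t: "t > 0" "t \<notin> E'" and j: "j \<in> {1..<nx p}"
  shows "(r j has_real_derivative - cgain d j * r j t + r (Suc j) t) (at t)"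
  unfolding r_def
  by (rule X.err_has_derivative) (use j t X_has_derivative[OF t] \<delta>_has_derivative[OF t] in auto)

lemma r_last_has_derivative:
  assumes t: "t > 0" "t \<notin> E'"
  shows "(r (nx p) has_real_derivative - cgain d (nx p) * r (nx p) t
     + (bcoef p * U t - X.H (nx p) (X t) (\<delta> t) - \<delta> t (nx p))) (at t)"
  unfolding r_def
proof (rule X.err_last_has_derivative[OF nx])
  show "((\<lambda>t. X t (nx p)) has_real_derivative phi p (nx p) (X t) + U t) (at t)"
    using derX[of t "nx p"] t nx by (simp add: fX_def E'_def)
qed (use t X_has_derivative[OF t] \<delta>_has_derivative[OF t] in auto)

lemma U_after:
  assumes "t > tf"
  shows "bcoef p * U t = X.H (nx p) (X t) (\<delta> t) + \<delta> t (nx p)"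
proof -
  have "U t = U_nominal p d (P (delay p) t) (X t) (w t)"
    using input[of t] assms tf_nonneg Dhat_eq_delay[of t] by (simp add: is_adaptive_input_def w_def)
  then show ?thesis using bcoef by (simp add: U_nominal_def Let_def \<delta>_def tau_virt)
qed

lemma U_star_eq:
  "bcoef p * U_star p d (P (delay p) t) (X t) (w t)
    = (cgain d (nx p) - cbar d) * r (nx p) t + X.H (nx p) (X t) (\<delta> t) + \<delta> t (nx p)"
  using bcoef by (simp add: U_star_def Let_def r_def X.err_def rfun_def \<delta>_def tau_virt)

text \<open>The true delay competes in the extremum over \<open>D_0\<close>. Multiplication by
  \<open>b\<close> reverses the order exactly when the law uses a minimum, so both signs give one
  inequality; in the last error equation it replaces \<open>c_m\<close> by
  \<open>cbar\<close>.\<close>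

lemma U_before:
  assumes "0 \<le> t" "t \<le> tf"
  shows "bcoef p * U t \<ge> (cgain d (nx p) - cbar d) * r (nx p) t + X.H (nx p) (X t) (\<delta> t) + \<delta> t (nx p)"
proof -
  let ?Us = "\<lambda>D. U_star p d (P D t) (X t) (jet s (t + D))"
  have D: "delay p \<in> {Dlow d..Dup d}" using Dlow by simp
  have "bcoef p * U t \<ge> bcoef p * ?Us (delay p)"
  proof (cases "bcoef p > 0")
    case True
    obtain D where "is_arg_max ?Us (\<lambda>D. D \<in> {Dlow d..Dup d}) D" "?Us D \<le> U t"
      using input[OF assms(1)] assms(2) True by (auto simp: is_adaptive_input_def Let_def)
    then have "?Us (delay p) \<le> U t" using D by (fastforce simp: is_arg_max_linorder)
    then show ?thesis using True by simp
  next
    case False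
    obtain D where "is_arg_min ?Us (\<lambda>D. D \<in> {Dlow d..Dup d}) D" "U t \<le> ?Us D"
      using input[OF assms(1)] assms(2) False by (auto simp: is_adaptive_input_def Let_def)
    then have "U t \<le> ?Us (delay p)" using D by (fastforce simp: is_arg_min_linorder)
    then show ?thesis using False by (simp add: mult_left_mono_neg)
  qed
  then show ?thesis using U_star_eq[of t] by (simp add: w_def)
qed

text \<open>\<open>Y t\<close> is the left end of the predictor segment, hence the factor 2 at
  \<open>ny p\<close>; \<open>sqrt (delay p)\<close> comes from the L2 norm over a window of length
  \<open>delay p\<close>.\<close>

lemma Psi_bound:
  assumes t: "t \<ge> 0" and "B \<ge> 0"
    and P: "\<And>\<sigma> i. \<sigma> \<in> {t - delay p..t} \<Longrightarrow> i \<in> {1..ny p} \<Longrightarrow> \<bar>P (delay p) \<sigma> i\<bar> \<le> B"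
    and x1: "\<And>\<sigma>. \<sigma> \<in> {t - delay p..t} \<Longrightarrow> \<bar>X \<sigma> 1\<bar> \<le> B"
    and X: "\<And>j. j \<in> {1..nx p} \<Longrightarrow> \<bar>X t j\<bar> \<le> B"
  shows "\<bar>Psi p Y X P t\<bar> \<le> (real (nx p) + 2 * real (ny p) + sqrt (delay p)) * B"
proof -
  have "\<bar>Y t i\<bar> \<le> B" if "i \<in> {1..ny p}" for i
    using predictor_eq[OF that, of "t - delay p"] P[of "t - delay p" i] that t delay by auto
  then have 1: "vnorm (ny p) (Y t) \<le> real (ny p) * B" by (rule vnorm_le)
  have 2: "vnorm (nx p) (X t) \<le> real (nx p) * B" using X by (rule vnorm_le)
  let ?f = "\<lambda>x. vnorm (ny p) (P (delay p) (t - delay p + delay p * x))"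
  have f: "?f x \<le> real (ny p) * B" if "x \<in> {0..1}" for x
    using that delay by (intro vnorm_le P) (auto simp: mult_le_cancel_left1)
  then have 3: "(SUP x\<in>{0..1}. ?f x) \<le> real (ny p) * B" by (intro cSUP_least) auto
  have "?f 0 \<le> (SUP x\<in>{0..1}. ?f x)" by (rule cSUP_upper2[of _ _ 0]) (auto intro!: bdd_aboveI2 f)
  moreover have vn: "vnorm N x \<ge> 0" for N x unfolding vnorm_def by (rule L2_set_nonneg)
  ultimately have sup0: "(SUP x\<in>{0..1}. ?f x) \<ge> 0" by (meson order.trans)
  let ?I = "integral {t - delay p..t} (\<lambda>\<tau>. (X \<tau> 1)\<^sup>2)"
  have "0 \<le> ?I \<and> ?I \<le> delay p * B\<^sup>2"
  proof (cases "(\<lambda>\<tau>. (X \<tau> 1)\<^sup>2) integrable_on {t - delay p..t}")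
    case True
    have "?I \<le> integral {t - delay p..t} (\<lambda>\<tau>. B\<^sup>2)"
      using x1 \<open>B \<ge> 0\<close> by (intro integral_le True) (auto simp: abs_le_square_iff[symmetric])
    then show ?thesis using True delay by (auto intro: integral_nonneg)
  next
    \<comment> \<open>An integral that does not exist has the default value 0, so the estimate holds
      in this case too.\<close>
    case False
    then show ?thesis using delay by (simp add: not_integrable_integral)
  qed
  then have 4: "0 \<le> sqrt ?I" "sqrt ?I \<le> sqrt (delay p) * B"
    using real_sqrt_le_mono[of ?I "delay p * B\<^sup>2"] \<open>B \<ge> 0\<close> by (auto simp: real_sqrt_mult)
  show ?thesis
    unfolding Psi_def using 1 2 3 sup0 4 vn[of "ny p" "Y t"] vn[of "nx p" "X t"] by (simp add: algebra_simps)
qed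

end

section \<open>Positivity, safety and exponential convergence\<close>

locale safe_loop = adaptive_loop +
  assumes A4: "\<And>\<theta>. \<theta> \<in> {- delay p..0} \<Longrightarrow> P (delay p) \<theta> 1 > s (\<theta> + delay p)"
    and A5: "bcoef p * X 0 1 > Delta p d 0 (P (delay p) 0) (X 0) (jet s (delay p))"
    and gains: "gains_ok p d s P X"
begin

lemma kgain_pos: "i \<in> {1..ny p} \<Longrightarrow> kgain d i > 0"
proof (cases "i = ny p")
  case False
  assume "i \<in> {1..ny p}"
  then have "kgain d i > max 2 (k_check p d i (P (delay p) 0) (jet s (delay p)))"
    using gains False Dlow unfolding gains_ok_def by auto
  then show ?thesis by simp
qed (use gains in \<open>auto simp: gains_ok_def\<close>)

lemma cgain_pos: "j \<in> {1..nx p} \<Longrightarrow> cgain d j > 0"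
proof (cases "j = nx p")
  case False
  assume "j \<in> {1..nx p}"
  then have "cgain d j > max 2 (c_check p d j (X 0) (Delta_jet p d (P (delay p) 0) (X 0) (jet s (delay p))))"
    using gains False Dlow unfolding gains_ok_def by auto
  then show ?thesis by simp
qed (use gains in \<open>auto simp: gains_ok_def\<close>)

text \<open>The gain conditions range over \<open>D_0\<close>, in particular over the true delay.
  Strict positivity is carried along because each error is the denominator of the next
  threshold.\<close>

lemma z_init: "1 \<le> i \<Longrightarrow> i \<le> ny p \<Longrightarrow> z i 0 > 0"
proof (induction rule: dec_induct)
  case base
  then show ?case using A4[of 0] delay by (simp add: z_def Y.err_def w_def jet_def)
next
  case (step i)
  then have "kgain d i > k_check p d i (P (delay p) 0) (w 0)"
    using gains Dlow unfolding gains_ok_def by (auto simp: w_def)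
  then show ?case
    unfolding z_def using step
    by (intro Y.err_Suc_pos) (auto simp: z_def k_check_def Y.err_def hfun_virt)
qed

lemma r_init: "1 \<le> j \<Longrightarrow> j \<le> nx p \<Longrightarrow> r j 0 > 0"
proof (induction rule: dec_induct)
  case base
  then show ?case using A5 by (simp add: r_def X.err_def w_def \<delta>_def Delta_jet_def)
next
  case (step j)
  then have "cgain d j > c_check p d j (X 0) (\<delta> 0)"
    using gains Dlow unfolding gains_ok_def by (auto simp: w_def \<delta>_def)
  then show ?case
    unfolding r_def using step
    by (intro X.err_Suc_pos) (auto simp: r_def c_check_def X.err_def tau_virt)
qed

text \<open>The rate is \<open>cbar\<close> up to \<open>tf\<close> and \<open>c_m\<close>
  afterwards; the first phase supplies the nonnegative starting value of the second.\<close>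

lemma r_last_nonneg:
  assumes "t \<ge> 0" shows "r (nx p) t \<ge> 0"
proof -
  have cont: "continuous_on {a..b} (r (nx p))" if "a \<ge> 0" for a b
    using nx that by (intro continuous_on_subset[OF r_cont]) auto
  have before: "r (nx p) t \<ge> 0" if t: "0 \<le> t" "t \<le> tf" for t
  proof (rule nonneg_of_linear_ode[where z = "r (nx p)" and k = "cbar d", OF t(1) cont countable_E'])
    show "r (nx p) 0 \<ge> 0" using r_init[of "nx p"] nx by simp
    fix u assume u: "0 < u" "u < t" "u \<notin> E'"
    have "- cbar d * r (nx p) u \<le> - cgain d (nx p) * r (nx p) u
       + (bcoef p * U u - X.H (nx p) (X u) (\<delta> u) - \<delta> u (nx p))"
      using U_before[of u] u t by (simp add: algebra_simps)
    then show "\<exists>D. (r (nx p) has_real_derivative D) (at u) \<and> - cbar d * r (nx p) u \<le> D"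
      using r_last_has_derivative[OF u(1,3)] by blast
  qed simp
  show ?thesis
  proof (cases "t \<le> tf")
    case False
    then have le: "tf \<le> t" by simp
    show ?thesis
    proof (rule nonneg_of_linear_ode[where z = "r (nx p)" and k = "cgain d (nx p)", OF le cont countable_E'])
      show "r (nx p) tf \<ge> 0" using before[of tf] tf_nonneg by simp
      fix u assume u: "tf < u" "u < t" "u \<notin> E'"
      then show "\<exists>D. (r (nx p) has_real_derivative D) (at u) \<and> - cgain d (nx p) * r (nx p) u \<le> D"
        using r_last_has_derivative[of u] U_after[of u] tf_nonneg by (intro exI[of _ "- cgain d (nx p) * r (nx p) u"]) auto
    qed (rule tf_nonneg)
  qed (use before assms in auto)
qed

lemma r_nonneg:
  assumes "t \<ge> 0" and j: "j \<le> nx p" "1 \<le> j" shows "r j t \<ge> 0"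
  using j assms(1)
proof (induction arbitrary: t rule: inc_induct)
  case base
  then show ?case by (intro r_last_nonneg)
next
  case (step j)
  show ?case
  proof (rule nonneg_of_linear_ode[where z = "r j" and k = "cgain d j", OF step.prems(2) _ countable_E'])
    show "continuous_on {0..t} (r j)" using step by (intro continuous_on_subset[OF r_cont]) auto
    show "r j 0 \<ge> 0" using r_init[of j] step by simp
    fix u assume u: "0 < u" "u < t" "u \<notin> E'"
    then have "r (Suc j) u \<ge> 0" using step by auto
    then show "\<exists>D. (r j has_real_derivative D) (at u) \<and> - cgain d j * r j u \<le> D"
      using r_has_derivative[OF u(1,3), of j] step by (intro exI[of _ "- cgain d j * r j u + r (Suc j) u"]) auto
  qed
qed

lemma z_nonneg:
  assumes "t \<ge> 0" and i: "i \<le> ny p" "1 \<le> i" shows "z i t \<ge> 0"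
  using i assms(1)
proof (induction arbitrary: t rule: inc_induct)
  case base
  show ?case
  proof (rule nonneg_of_linear_ode[where z = "z (ny p)" and k = "kgain d (ny p)", OF base(2) _ countable_E'])
    show "continuous_on {0..t} (z (ny p))" using base by (intro continuous_on_subset[OF z_cont]) auto
    show "z (ny p) 0 \<ge> 0" using z_init[of "ny p"] base by simp
    fix u assume u: "0 < u" "u < t" "u \<notin> E'"
    then have "r 1 u \<ge> 0" using r_nonneg[of u 1] nx by simp
    then show "\<exists>D. (z (ny p) has_real_derivative D) (at u) \<and> - kgain d (ny p) * z (ny p) u \<le> D"
      using z_last_has_derivative[OF u(1,3)] by (intro exI[of _ "- kgain d (ny p) * z (ny p) u + r 1 u"]) auto
  qed
next
  case (step i)
  show ?case
  proof (rule nonneg_of_linear_ode[where z = "z i" and k = "kgain d i", OF step.prems(2) _ countable_E'])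
    show "continuous_on {0..t} (z i)" using step by (intro continuous_on_subset[OF z_cont]) auto
    show "z i 0 \<ge> 0" using z_init[of i] step by simp
    fix u assume u: "0 < u" "u < t" "u \<notin> E'"
    then have "z (Suc i) u \<ge> 0" using step by auto
    then show "\<exists>D. (z i has_real_derivative D) (at u) \<and> - kgain d i * z i u \<le> D"
      using z_has_derivative[OF u(1,3), of i] step by (intro exI[of _ "- kgain d i * z i u + z (Suc i) u"]) auto
  qed
qed

lemma z_1: "t \<ge> delay p \<Longrightarrow> z 1 (t - delay p) = Y t 1 - s t"
  using predictor_eq[of 1 "t - delay p"] ny delay by (simp add: z_def Y.err_def w_def jet_def)

text \<open>Before time \<open>delay p\<close> the Y-part runs on the zero history and cannot be
  influenced; there the claim is (A4) itself, read through the predictor. Afterwards it is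
  nonnegativity of the first error.\<close>

lemma safe:
  assumes "t \<ge> 0" shows "Y t 1 - s t \<ge> 0"
proof (cases "t \<ge> delay p")
  case True
  then show ?thesis using z_nonneg[of "t - delay p" 1] z_1[OF True] ny by simp
next
  case False
  then show ?thesis
    using A4[of "t - delay p"] predictor_eq[of 1 "t - delay p"] ny assms by simp
qed

lemma r_decays: "j \<le> nx p \<Longrightarrow> 1 \<le> j \<Longrightarrow> decays_exponentially (r j)"
proof (induction rule: inc_induct)
  case base
  show ?case
  proof (rule decays_exponentially_linear_ode[OF r_cont countable_E' cgain_pos tf_nonneg])
    show "decays_exponentially (\<lambda>t. 0)" by (rule decays_exponentially_zero) simp
    show "(r (nx p) has_real_derivative - cgain d (nx p) * r (nx p) t + 0) (at t)" if "t > tf" "t \<notin> E'" for t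
      using r_last_has_derivative[of t] U_after[of t] that tf_nonneg by simp
  qed (use nx in auto)
next
  case (step j)
  show ?case
    by (rule decays_exponentially_linear_ode[OF r_cont countable_E' cgain_pos order_refl, of j j "r (Suc j)"])
      (use step r_has_derivative in auto)
qed

lemma z_decays: "i \<le> ny p \<Longrightarrow> 1 \<le> i \<Longrightarrow> decays_exponentially (z i)"
proof (induction rule: inc_induct)
  case base
  show ?case
    by (rule decays_exponentially_linear_ode[OF z_cont countable_E' kgain_pos order_refl, of _ _ "r 1"])
      (use base r_decays[of 1] nx z_last_has_derivative in auto)
next
  case (step i)
  show ?case
    by (rule decays_exponentially_linear_ode[OF z_cont countable_E' kgain_pos order_refl, of i i "z (Suc i)"])
      (use step z_has_derivative in auto)
qed

lemma tracking: "decays_exponentially (\<lambda>t. Y t 1 - s t)"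
proof -
  obtain C \<kappa> where C: "\<kappa> > 0" "\<And>t. t \<ge> 0 \<Longrightarrow> \<bar>z 1 t\<bar> \<le> C * exp (- \<kappa> * t)"
    using z_decays[of 1] ny unfolding decays_exponentially_def by auto
  show ?thesis
  proof (rule decays_exponentially_eventually_imp[OF _ C(1)])
    show "continuous_on {0..} (\<lambda>t. Y t 1 - s t)"
      using target ny by (intro continuous_intros contY) (auto simp: smooth_target_def)
    fix t assume t: "t \<ge> delay p"
    have "\<bar>Y t 1 - s t\<bar> \<le> C * exp (- \<kappa> * (t - delay p))"
      using C(2)[of "t - delay p"] t z_1[OF t] by simp
    also have "\<dots> = (C * exp (\<kappa> * delay p)) * exp (- \<kappa> * t)"
      by (simp add: right_diff_distrib exp_diff exp_minus field_simps)
    finally show "\<bar>Y t 1 - s t\<bar> \<le> (C * exp (\<kappa> * delay p)) * exp (- \<kappa> * t)" .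
  qed
qed

end

section \<open>Bounds on the state norm\<close>

lemma decays_family:
  assumes "finite I" "\<And>i. i \<in> I \<Longrightarrow> decays_exponentially (f i)"
  shows "\<exists>C\<ge>0. \<exists>\<kappa>>0. \<forall>i\<in>I. \<forall>t\<ge>0. \<bar>f i t\<bar> \<le> C * exp (- \<kappa> * t)"
proof -
  have "decays_exponentially (\<lambda>t. \<Sum>i\<in>I. \<bar>f i t\<bar>)"
    by (intro decays_exponentially_sum decays_exponentially_abs assms)
  then obtain C \<kappa> where C: "C \<ge> 0" "\<kappa> > 0" "\<And>t. t \<ge> 0 \<Longrightarrow> \<bar>\<Sum>i\<in>I. \<bar>f i t\<bar>\<bar> \<le> C * exp (- \<kappa> * t)"
    using decays_exponentiallyE[OF _ zero_less_one] by metis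
  have "\<bar>f i t\<bar> \<le> C * exp (- \<kappa> * t)" if "i \<in> I" "t \<ge> 0" for i t
    using C(3)[OF that(2)] member_le_sum[of i I "\<lambda>i. \<bar>f i t\<bar>"] that assms(1) by fastforce
  then show ?thesis using C by blast
qed

lemma exp_decay_le: "\<kappa> > 0 \<Longrightarrow> C \<ge> 0 \<Longrightarrow> a \<le> t \<Longrightarrow> C * exp (- \<kappa> * t) \<le> C * exp (- \<kappa> * (a::real))"
  by (intro mult_left_mono) auto

context safe_loop begin

abbreviation "K \<equiv> real (nx p) + 2 * real (ny p) + sqrt (delay p)"

lemma P_history_bounded: "\<exists>M\<ge>0. \<forall>t\<in>{- delay p..0}. \<forall>i\<in>{1..ny p}. \<bar>P (delay p) t i\<bar> \<le> M"
  by (rule bounded_family[where f = "\<lambda>i t. P (delay p) t i"])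
    (auto intro: continuous_on_subset[OF predictor_facts(1)])

lemma x1_history: "- delay p \<le> t \<Longrightarrow> t < 0 \<Longrightarrow> X t 1 = 0"
  using hist by simp

text \<open>All errors eventually drop below 1, so a radius of at least 1 that bounds the jet also
  bounds them. Hence \<open>B\<close> carries no information about the initial data.\<close>

lemma Psi_eventually:
  assumes M: "\<And>t k. t > 0 \<Longrightarrow> k < ny p + nx p \<Longrightarrow> \<bar>jet s t k\<bar> \<le> R" and R: "R \<ge> 1"
    and B: "B \<ge> 0" "\<And>P X w. (\<forall>i\<in>{1..ny p}. \<bar>Y.err i P w\<bar> \<le> R) \<Longrightarrow>
     (\<forall>j\<in>{1..nx p}. \<bar>X.err j X (Delta_jet p d P X w)\<bar> \<le> R) \<Longrightarrow> (\<forall>k<ny p + nx p. \<bar>w k\<bar> \<le> R) \<Longrightarrow>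
     (\<forall>i\<in>{1..ny p}. \<bar>P i\<bar> \<le> B) \<and> (\<forall>j\<in>{1..nx p}. \<bar>X j\<bar> \<le> B)"
  shows "\<forall>\<^sub>F t in at_top. Psi p Y X P t \<le> K * B"
proof -
  have small: "\<forall>\<^sub>F t in at_top. \<bar>f t\<bar> \<le> R" if "decays_exponentially f" for f
    using tendstoD[OF decays_exponentially_tendsto[OF that] zero_less_one]
    by (rule eventually_mono) (use R in \<open>auto simp: dist_real_def\<close>)
  have "\<forall>\<^sub>F t in at_top. (\<forall>i\<in>{1..ny p}. \<bar>z i t\<bar> \<le> R) \<and> (\<forall>j\<in>{1..nx p}. \<bar>r j t\<bar> \<le> R)"
    by (intro eventually_conj eventually_ball_finite ballI small z_decays r_decays) auto
  then obtain t1 where t1: "\<And>t. t \<ge> t1 \<Longrightarrow> (\<forall>i\<in>{1..ny p}. \<bar>z i t\<bar> \<le> R) \<and> (\<forall>j\<in>{1..nx p}. \<bar>r j t\<bar> \<le> R)"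
    unfolding eventually_at_top_linorder by blast
  have bd: "(\<forall>i\<in>{1..ny p}. \<bar>P (delay p) t i\<bar> \<le> B) \<and> (\<forall>j\<in>{1..nx p}. \<bar>X t j\<bar> \<le> B)"
    if "t \<ge> max t1 0" for t
  proof (rule B(2))
    show "\<forall>i\<in>{1..ny p}. \<bar>Y.err i (P (delay p) t) (w t)\<bar> \<le> R"
      using t1[of t] that by (simp add: z_def)
    show "\<forall>j\<in>{1..nx p}. \<bar>X.err j (X t) (Delta_jet p d (P (delay p) t) (X t) (w t))\<bar> \<le> R"
      using t1[of t] that by (simp add: r_def \<delta>_def)
    show "\<forall>k<ny p + nx p. \<bar>w t k\<bar> \<le> R" using M that delay by (auto simp: w_def)
  qed
  show ?thesis
    unfolding eventually_at_top_linorder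
  \<comment> \<open>One extra delay, so that the whole window ending at \<open>t\<close> lies after
    \<open>t1\<close>.\<close>
  proof (intro exI[of _ "max t1 0 + delay p"] allI impI)
    fix t assume t: "t \<ge> max t1 0 + delay p"
    have "\<bar>Psi p Y X P t\<bar> \<le> K * B"
    proof (rule Psi_bound[OF _ B(1)])
      show "t \<ge> 0" using t delay by simp
      show "\<bar>P (delay p) \<sigma> i\<bar> \<le> B" if "\<sigma> \<in> {t - delay p..t}" "i \<in> {1..ny p}" for \<sigma> i
        using bd[of \<sigma>] that t by (simp add: le_diff_eq max_def split: if_splits)
      show "\<bar>X \<sigma> 1\<bar> \<le> B" if "\<sigma> \<in> {t - delay p..t}" for \<sigma>
        using bd[of \<sigma>] that t nx by (simp add: le_diff_eq max_def split: if_splits)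
      show "\<bar>X t j\<bar> \<le> B" if "j \<in> {1..nx p}" for j
      proof -
        have "t \<ge> max t1 0" using t delay by linarith
        then show ?thesis using bd that by blast
      qed
    qed
    then show "Psi p Y X P t \<le> K * B" by simp
  qed
qed

lemma Psi_bounded:
  assumes M: "\<And>t k. t > 0 \<Longrightarrow> k < ny p + nx p \<Longrightarrow> \<bar>jet s t k\<bar> \<le> M"
  shows "bounded (Psi p Y X P ` {0..})"
proof -
  obtain C1 \<kappa>1 where C1: "C1 \<ge> 0" "\<kappa>1 > 0" "\<forall>i\<in>{1..ny p}. \<forall>t\<ge>0. \<bar>z i t\<bar> \<le> C1 * exp (- \<kappa>1 * t)"
    using decays_family[of "{1..ny p}" z] z_decays by auto
  obtain C2 \<kappa>2 where C2: "C2 \<ge> 0" "\<kappa>2 > 0" "\<forall>j\<in>{1..nx p}. \<forall>t\<ge>0. \<bar>r j t\<bar> \<le> C2 * exp (- \<kappa>2 * t)"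
    using decays_family[of "{1..nx p}" r] r_decays by auto
  \<comment> \<open>Here the radius includes the decay constants of this particular trajectory,
    since the bound must hold from time zero on.\<close>
  define R where "R = max (max C1 C2) M"
  have zR: "\<bar>z i t\<bar> \<le> R" if "i \<in> {1..ny p}" "t \<ge> 0" for i t
  proof -
    have "\<bar>z i t\<bar> \<le> C1 * exp (- \<kappa>1 * t)" using C1(3) that by blast
    also have "\<dots> \<le> C1" using exp_decay_le[OF C1(2,1) that(2)] by simp
    finally show ?thesis by (simp add: R_def)
  qed
  have rR: "\<bar>r j t\<bar> \<le> R" if "j \<in> {1..nx p}" "t \<ge> 0" for j t
  proof -
    have "\<bar>r j t\<bar> \<le> C2 * exp (- \<kappa>2 * t)" using C2(3) that by blast
    also have "\<dots> \<le> C2" using exp_decay_le[OF C2(2,1) that(2)] by simp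
    finally show ?thesis by (simp add: R_def)
  qed
  obtain B where B: "B \<ge> 0" "\<forall>P X w. (\<forall>i\<in>{1..ny p}. \<bar>Y.err i P w\<bar> \<le> R) \<longrightarrow>
     (\<forall>j\<in>{1..nx p}. \<bar>X.err j X (Delta_jet p d P X w)\<bar> \<le> R) \<longrightarrow> (\<forall>k<ny p + nx p. \<bar>w k\<bar> \<le> R) \<longrightarrow>
     (\<forall>i\<in>{1..ny p}. \<bar>P i\<bar> \<le> B) \<and> (\<forall>j\<in>{1..nx p}. \<bar>X j\<bar> \<le> B)"
    using loop_bounded[of R] by blast
  have bd: "(\<forall>i\<in>{1..ny p}. \<bar>P (delay p) t i\<bar> \<le> B) \<and> (\<forall>j\<in>{1..nx p}. \<bar>X t j\<bar> \<le> B)" if t: "t \<ge> 0" for t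
  proof (rule B(2)[rule_format])
    show "\<bar>Y.err i (P (delay p) t) (w t)\<bar> \<le> R" if "i \<in> {1..ny p}" for i
      using zR[OF that t] by (simp add: z_def)
    show "\<bar>X.err j (X t) (Delta_jet p d (P (delay p) t) (X t) (w t))\<bar> \<le> R" if "j \<in> {1..nx p}" for j
      using rR[OF that t] by (simp add: r_def \<delta>_def)
    show "\<bar>w t k\<bar> \<le> R" if "k < ny p + nx p" for k
      using M[OF _ that, of "t + delay p"] t delay by (simp add: w_def R_def)
  qed
  obtain M0 where M0: "M0 \<ge> 0" "\<forall>t\<in>{- delay p..0}. \<forall>i\<in>{1..ny p}. \<bar>P (delay p) t i\<bar> \<le> M0"
    using P_history_bounded by blast
  have "norm (Psi p Y X P t) \<le> K * max B M0" if t: "t \<in> {0..}" for t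
    unfolding real_norm_def
  proof (rule Psi_bound)
    show "0 \<le> max B M0" using B(1) by simp
    show "\<bar>P (delay p) \<sigma> i\<bar> \<le> max B M0" if "\<sigma> \<in> {t - delay p..t}" "i \<in> {1..ny p}" for \<sigma> i
      using bd[of \<sigma>] M0(2) that t by (cases "\<sigma> \<ge> 0") (auto simp: le_max_iff_disj)
    show "\<bar>X \<sigma> 1\<bar> \<le> max B M0" if "\<sigma> \<in> {t - delay p..t}" for \<sigma>
      using bd[of \<sigma>] x1_history[of \<sigma>] B(1) nx that t by (cases "\<sigma> \<ge> 0") (auto simp: le_max_iff_disj)
    show "\<bar>X t j\<bar> \<le> max B M0" if "j \<in> {1..nx p}" for j using bd[of t] that t by (auto simp: le_max_iff_disj)
  qed (use t in simp)
  then show ?thesis unfolding bounded_iff by blast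
qed

lemma Psi_decays:
  assumes s: "\<And>t. t \<ge> 0 \<Longrightarrow> s t = 0"
  shows "decays_exponentially (Psi p Y X P)"
proof -
  have w: "decays_exponentially (\<lambda>t. w t k)" for k
    using jet_zero[OF s] delay by (intro decays_exponentially_zero) (simp add: w_def)
  have Yerr: "decays_exponentially (\<lambda>t. Y.err i (P (delay p) t) (w t))" if "i \<in> {1..ny p}" for i
    using z_decays[of i] that by (simp add: z_def)
  have Xerr: "decays_exponentially (\<lambda>t. X.err j (X t) (Delta_jet p d (P (delay p) t) (X t) (w t)))"
    if "j \<in> {1..nx p}" for j
    using r_decays[of j] that by (simp add: r_def \<delta>_def)
  note PX = loop_decays[where P = "P (delay p)" and X = X and w = w, OF Yerr Xerr w]
  have "\<exists>C\<ge>0. \<exists>\<kappa>>0. \<forall>q\<in>{1..ny p} <+> {1..nx p}. \<forall>t\<ge>0.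
      \<bar>case_sum (\<lambda>i t. P (delay p) t i) (\<lambda>j t. X t j) q t\<bar> \<le> C * exp (- \<kappa> * t)"
    by (rule decays_family) (use PX in auto)
  then obtain C \<kappa> where C: "C \<ge> 0" "\<kappa> > 0"
    and PXC: "\<forall>q\<in>{1..ny p} <+> {1..nx p}. \<forall>t\<ge>0.
      \<bar>case_sum (\<lambda>i t. P (delay p) t i) (\<lambda>j t. X t j) q t\<bar> \<le> C * exp (- \<kappa> * t)" by blast
  have CP: "\<bar>P (delay p) t i\<bar> \<le> C * exp (- \<kappa> * t)" if "i \<in> {1..ny p}" "t \<ge> 0" for t i
    using bspec[OF PXC InlI[OF that(1)]] that(2) by simp
  have CX: "\<bar>X t j\<bar> \<le> C * exp (- \<kappa> * t)" if "j \<in> {1..nx p}" "t \<ge> 0" for t j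
    using bspec[OF PXC InrI[OF that(1)]] that(2) by simp
  obtain M0 where M0: "M0 \<ge> 0" "\<forall>t\<in>{- delay p..0}. \<forall>i\<in>{1..ny p}. \<bar>P (delay p) t i\<bar> \<le> M0"
    using P_history_bounded by blast
  define C' where "C' = max C M0"
  have C': "C' \<ge> 0" "C \<le> C'" "M0 \<le> C'" using C(1) by (auto simp: C'_def)
  have P': "\<bar>P (delay p) t i\<bar> \<le> C' * exp (- \<kappa> * t)" if "i \<in> {1..ny p}" "- delay p \<le> t" for t i
  proof (cases "t \<ge> 0")
    case True
    have "C * exp (- \<kappa> * t) \<le> C' * exp (- \<kappa> * t)" using C' by simp
    then show ?thesis using CP[OF that(1) True] by linarith
  next
    \<comment> \<open>At negative times the exponential is at least 1, so the history bound
      \<open>M0\<close> fits below the decaying one.\<close>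
    case False
    then have "\<bar>P (delay p) t i\<bar> \<le> M0" using M0(2) that by auto
    then have "\<bar>P (delay p) t i\<bar> \<le> C' * exp (- \<kappa> * 0)" using C'(3) by simp
    also have "\<dots> \<le> C' * exp (- \<kappa> * t)" using False by (intro exp_decay_le C C') auto
    finally show ?thesis .
  qed
  have X': "\<bar>X t j\<bar> \<le> C' * exp (- \<kappa> * t)" if "j \<in> {1..nx p}" "t \<ge> 0" for t j
  proof -
    have "C * exp (- \<kappa> * t) \<le> C' * exp (- \<kappa> * t)" using C' by simp
    then show ?thesis using CX[OF that] by linarith
  qed
  have x1': "\<bar>X t 1\<bar> \<le> C' * exp (- \<kappa> * t)" if "- delay p \<le> t" for t
    using X'[of 1 t] x1_history[of t] that nx C'(1) by (cases "t \<ge> 0") auto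
  show ?thesis
  proof (rule decays_exponentiallyI[OF C(2)])
    fix t :: real assume t: "t \<ge> 0"
    \<comment> \<open>A decaying bound is largest at the left end of the window, which costs the
      factor \<open>exp (\<kappa> * delay p)\<close>.\<close>
    let ?B = "C' * exp (- \<kappa> * (t - delay p))"
    have mono: "C' * exp (- \<kappa> * \<sigma>) \<le> ?B" if "t - delay p \<le> \<sigma>" for \<sigma>
      by (rule exp_decay_le[OF C(2) C'(1) that])
    have "\<bar>Psi p Y X P t\<bar> \<le> K * ?B"
    proof (rule Psi_bound[OF t])
      show "0 \<le> ?B" using C'(1) by simp
      show "\<bar>P (delay p) \<sigma> i\<bar> \<le> ?B" if "\<sigma> \<in> {t - delay p..t}" "i \<in> {1..ny p}" for \<sigma> i
        using P'[of i \<sigma>] mono[of \<sigma>] that t by force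
      show "\<bar>X \<sigma> 1\<bar> \<le> ?B" if "\<sigma> \<in> {t - delay p..t}" for \<sigma>
        using x1'[of \<sigma>] mono[of \<sigma>] that t by force
      show "\<bar>X t j\<bar> \<le> ?B" if "j \<in> {1..nx p}" for j
        using X'[OF that t] mono[of t] delay by force
    qed
    also have "\<dots> = K * C' * exp (\<kappa> * delay p) * exp (- \<kappa> * t)"
      by (simp add: right_diff_distrib exp_diff exp_minus field_simps)
    finally show "\<bar>Psi p Y X P t\<bar> \<le> K * C' * exp (\<kappa> * delay p) * exp (- \<kappa> * t)" .
  qed
qed

end

theorem theorem2:
  fixes p :: plant and d :: design and s :: "real \<Rightarrow> real"
  assumes "ny p \<ge> 1" and "nx p \<ge> 1" and "bcoef p \<noteq> 0"
    and "0 < Dlow d" and "Dlow d \<le> delay p" and "delay p \<le> Dup d"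
    and "smooth_plant p"
    and "smooth_target (ny p + nx p) s"
    and "cbar d > 0" and "Tsamp d > 0" and "Nwin d \<ge> 1"
    and "Dhat0 d \<in> {Dlow d..Dup d}"
  shows "\<exists>B. \<forall>Y X P tf.
     closed_loop p d s Y X P tf \<and>
     (\<forall>t\<in>{-delay p..<0}. X t 1 = 0) \<and>
     (\<forall>\<theta>\<in>{-delay p..0}. P (delay p) \<theta> 1 > s (\<theta> + delay p)) \<and>
     bcoef p * X 0 1 > Delta p d 0 (P (delay p) 0) (X 0) (jet s (delay p)) \<and>
     gains_ok p d s P X
     \<longrightarrow>
       (bounded (Dhat p d X ` {0..}) \<and> (\<forall>t\<ge>tf. Dhat p d X t = delay p)) \<and>
       (decays_exponentially (\<lambda>t. Y t 1 - s t) \<and>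
        ((\<forall>k<ny p + nx p. bounded ((deriv ^^ k) s ` {0<..})) \<longrightarrow>
           bounded (Psi p Y X P ` {0..}) \<and> (\<forall>\<^sub>F t in at_top. Psi p Y X P t \<le> B)) \<and>
        ((\<forall>t\<ge>0. s t = 0) \<longrightarrow> decays_exponentially (Psi p Y X P))) \<and>
       (\<forall>t\<ge>0. Y t 1 - s t \<ge> 0)"
proof -
  interpret L: backstepping p d
    by standard (use assms in auto)
  let ?bd = "\<forall>k<ny p + nx p. bounded ((deriv ^^ k) s ` {0<..})"
  \<comment> \<open>The guard lets \<open>M\<close> be fixed before the trajectories even if the jet
    is unbounded, in which case the claim guarded by \<open>?bd\<close> is void.\<close>
  have "\<exists>M. ?bd \<longrightarrow> (\<forall>t>0. \<forall>k<ny p + nx p. \<bar>jet s t k\<bar> \<le> M)"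
  proof (cases ?bd)
    case True
    have "\<forall>k\<in>{..<ny p + nx p}. \<exists>a. \<forall>t>0. \<bar>(deriv ^^ k) s t\<bar> \<le> a"
    proof
      fix k assume "k \<in> {..<ny p + nx p}"
      then have "bounded ((deriv ^^ k) s ` {0<..})" using True by simp
      then obtain a where "\<forall>x\<in>(deriv ^^ k) s ` {0<..}. \<bar>x\<bar> \<le> a" unfolding bounded_iff by auto
      then show "\<exists>a. \<forall>t>0. \<bar>(deriv ^^ k) s t\<bar> \<le> a" by auto
    qed
    then obtain a where a: "\<forall>k\<in>{..<ny p + nx p}. \<forall>t>0. \<bar>(deriv ^^ k) s t\<bar> \<le> a k" by (rule bchoice[THEN exE])
    have "\<bar>jet s t k\<bar> \<le> (\<Sum>k<ny p + nx p. \<bar>a k\<bar>)" if "t > 0" "k < ny p + nx p" for t k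
    proof -
      have "\<bar>jet s t k\<bar> \<le> \<bar>a k\<bar>" using a that by (force simp: jet_def)
      also have "\<dots> \<le> (\<Sum>k<ny p + nx p. \<bar>a k\<bar>)" using that by (intro member_le_sum) auto
      finally show ?thesis .
    qed
    then show ?thesis by blast
  qed blast
  then obtain M where M: "?bd \<Longrightarrow> t > 0 \<Longrightarrow> k < ny p + nx p \<Longrightarrow> \<bar>jet s t k\<bar> \<le> M" for t k by blast
  \<comment> \<open>Fixed from the plant, the design and the size of the jet, before any trajectory:
    this makes it an ultimate bound depending on the target rather than on initial data.\<close>
  obtain B where B: "B \<ge> 0" "\<And>P X w. (\<forall>i\<in>{1..ny p}. \<bar>L.Y.err i P w\<bar> \<le> max 1 M) \<Longrightarrow>
     (\<forall>j\<in>{1..nx p}. \<bar>L.X.err j X (Delta_jet p d P X w)\<bar> \<le> max 1 M) \<Longrightarrow>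
     (\<forall>k<ny p + nx p. \<bar>w k\<bar> \<le> max 1 M) \<Longrightarrow>
     (\<forall>i\<in>{1..ny p}. \<bar>P i\<bar> \<le> B) \<and> (\<forall>j\<in>{1..nx p}. \<bar>X j\<bar> \<le> B)"
    using L.loop_bounded[of "max 1 M"] by blast
  show ?thesis
  proof (intro exI[of _ "(real (nx p) + 2 * real (ny p) + sqrt (delay p)) * B"] allI impI, elim conjE)
    fix Y X P tf
    assume cl: "closed_loop p d s Y X P tf"
      and hist: "\<forall>t\<in>{- delay p..<0}. X t 1 = 0"
      and A4: "\<forall>\<theta>\<in>{- delay p..0}. P (delay p) \<theta> 1 > s (\<theta> + delay p)"
      and A5: "bcoef p * X 0 1 > Delta p d 0 (P (delay p) 0) (X 0) (jet s (delay p))"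
      and gains: "gains_ok p d s P X"
    obtain U where U: "\<forall>t\<ge>0. is_adaptive_input p d s P X tf t (U t)" "plant_solution p U Y X"
      using cl unfolding closed_loop_def by blast
    obtain E where E: "countable E" "\<forall>t>0. t \<notin> E \<longrightarrow>
        (\<forall>i\<in>{1..ny p}. ((\<lambda>t. Y t i) has_real_derivative
            fY p (Y t) (bcoef p * X (t - delay p) 1) i) (at t)) \<and>
        (\<forall>j\<in>{1..nx p}. ((\<lambda>t. X t j) has_real_derivative fX p (X t) (U t) j) (at t))"
      using U(2) unfolding plant_solution_def by blast
    interpret S: safe_loop p d s Y X P tf U E
    proof
      show "is_tf p d X tf" using cl unfolding closed_loop_def by blast
      show "is_predictor p Y X (delay p) t (P (delay p))" if "t \<ge> 0" for t
        using cl that unfolding closed_loop_def by blast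
      show "continuous_on {0..} (\<lambda>t. Y t i)" if "i \<in> {1..ny p}" for i
        using U(2) that unfolding plant_solution_def by blast
      show "continuous_on {0..} (\<lambda>t. X t j)" if "j \<in> {1..nx p}" for j
        using U(2) that unfolding plant_solution_def by blast
    qed (use assms U(1) E hist A4 A5 gains in blast)+
    show "(bounded (Dhat p d X ` {0..}) \<and> (\<forall>t\<ge>tf. Dhat p d X t = delay p)) \<and>
       (decays_exponentially (\<lambda>t. Y t 1 - s t) \<and>
        (?bd \<longrightarrow> bounded (Psi p Y X P ` {0..}) \<and>
           (\<forall>\<^sub>F t in at_top. Psi p Y X P t \<le> (real (nx p) + 2 * real (ny p) + sqrt (delay p)) * B)) \<and>
        ((\<forall>t\<ge>0. s t = 0) \<longrightarrow> decays_exponentially (Psi p Y X P))) \<and>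
       (\<forall>t\<ge>0. Y t 1 - s t \<ge> 0)"
    proof (intro conjI allI impI)
      assume bd: ?bd
      show "bounded (Psi p Y X P ` {0..})" by (rule S.Psi_bounded[OF M[OF bd]])
      show "\<forall>\<^sub>F t in at_top. Psi p Y X P t \<le> (real (nx p) + 2 * real (ny p) + sqrt (delay p)) * B"
      proof (rule S.Psi_eventually[OF _ _ B])
        show "\<bar>jet s t k\<bar> \<le> max 1 M" if "t > 0" "k < ny p + nx p" for t k
          using M[OF bd that] by simp
      qed auto
    qed (use S.Dhat_bounded S.Dhat_eq_delay S.tracking S.Psi_decays S.safe in auto)
  qed
qed

end
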